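(* Consider the zero-temperature Glauber dynamics $(\sigma(t))_{t\ge 0}$ on the slab $S_k=\mathbb{Z}^2\times\{0,\dots,k-1\}$ started from i.i.d. symmetric spins ($p=1/2$). For $k=2$, with free boundary conditions and also with periodic boundary conditions in the third coordinate, $S_k$ fixates. For $k=3$ with periodic boundary conditions in the third coordinate, $S_k$ fixates.
   Context: For $k\ge 2$, the slab $S_k$ is the graph with vertex set $\mathbb{Z}^2\times\{0,1,\dots,k-1\}$. With free boundary conditions its edge set is $\mathcal{E}_k=\{\{x,y\}: \|x-y\|_1=1\}$. With periodic boundary conditions, in addition $(x,y,k-1)$ and $(x,y,0)$ are joined by an edge for every $(x,y)\in\mathbb{Z}^2$; if $k=2$ this gives two edges between $(x,y,0)$ and $(x,y,1)$, so that in the energy below each of these two sites counts twice as a neighbor of the other. The initial configuration $\sigma(0)=(\sigma_x(0))_{x\in S_k}\in\Omega_k=\{-1,1\}^{S_k}$ has i.i.d. coordinates with $\sigma_x(0)=+1$ with probability $1/2$ and $-1$ with probability $1/2$. The energy of site $x$ at time $t$ is $$e_x(t)=-\sum_{y:\{x,y\}\in\mathcal{E}_k}\sigma_x(t)\sigma_y(t),$$ the sum being over edges at $x$ (counted with multiplicity, for the edge set of the boundary condition in question). Each site has an exponential clock of rate 1 (ringing repeatedly, at the points of a Poisson process), the clocks being independent of each other and of $\sigma(0)$. When the clock of $x$ rings at time $t$: $\sigma_x(t)=-\sigma_x(t^-)$ if $e_x(t^-)>0$; $\sigma_x(t)=\pm1$ with probability $1/2$ each (by an independent fair coin) if $e_x(t^-)=0$;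 $\sigma_x(t)=\sigma_x(t^-)$ if $e_x(t^-)<0$. Let $\omega$ denote the realization of the dynamics (clocks and coins), and $\mathbb{P}$ the joint distribution of $(\sigma(0),\omega)$. The slab $S_k$ (with given boundary conditions) fixates if, $\mathbb{P}$-almost surely, for every site $v\in S_k$ there exists $T=T_v(\sigma(0),\omega)<\infty$ such that $\sigma_v(t)=\sigma_v(T)$ for all $t\ge T$. *)

theory Defs
  imports "HOL-Probability.Probability"
begin

type_synonym site = "int \<times> int \<times> int"

datatype boundary = Free | Periodic

definition slab :: "nat \<Rightarrow> site set" where
  "slab k = UNIV \<times> UNIV \<times> {0..<int k}"

fun l1_dist :: "site \<Rightarrow> site \<Rightarrow> int" where
  "l1_dist (x, y, z) (x', y', z') = \<bar>x - x'\<bar> + \<bar>y - y'\<bar> + \<bar>z - z'\<bar>"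

(* Whether the additional edge between (x, y, k - 1) and (x, y, 0) joins the two given sites. *)
fun wrap_edge :: "nat \<Rightarrow> site \<Rightarrow> site \<Rightarrow> bool" where
  "wrap_edge k (x, y, z) (x', y', z') \<longleftrightarrow> x = x' \<and> y = y' \<and> {z, z'} = {0, int k - 1}"

(* Number of edges joining two sites of the slab. The summands are added, not merged: for k = 2
   with periodic boundary conditions the two sites of a column are joined by two edges. *)
definition edge_mult :: "nat \<Rightarrow> boundary \<Rightarrow> site \<Rightarrow> site \<Rightarrow> nat" where
  "edge_mult k b u v =
     (if l1_dist u v = 1 then 1 else 0) + (if b = Periodic \<and> wrap_edge k u v then 1 else 0)"

definition neighbours :: "nat \<Rightarrow> boundary \<Rightarrow> site \<Rightarrow> site set" where
  "neighbours k b u = {v \<in> slab k. edge_mult k b u v > 0}"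

lemma finite_neighbours: "finite (neighbours k b u)"
proof -
  obtain x y z where u: "u = (x, y, z)" by (metis prod_cases3)
  have "neighbours k b u \<subseteq> {x-1..x+1} \<times> {y-1..y+1} \<times> {0..<int k}"
    unfolding neighbours_def slab_def u edge_mult_def by (auto split: if_splits)
  then show ?thesis by (rule finite_subset) auto
qed

definition energy :: "nat \<Rightarrow> boundary \<Rightarrow> (site \<Rightarrow> int) \<Rightarrow> site \<Rightarrow> int" where
  "energy k b \<eta> u = - (\<Sum>v\<in>neighbours k b u. int (edge_mult k b u v) * (\<eta> u * \<eta> v))"

(* New spin at a site whose clock rings: energy e and spin s just before the ring, coin c. *)
definition updated_spin :: "int \<Rightarrow> int \<Rightarrow> int \<Rightarrow> int" where
  "updated_spin e s c = (if e > 0 then - s else if e = 0 then c else s)"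

(* A sample is a triple (s, w, c): initial spins s x, waiting times w (x, n) between consecutive
   rings of the clock at x, and the coin c (x, n) attached to the n-th ring at x (n = 0, 1, ...). *)
type_synonym sample = "(site \<Rightarrow> int) \<times> (site \<times> nat \<Rightarrow> real) \<times> (site \<times> nat \<Rightarrow> int)"

definition spin_measure :: "int measure" where
  "spin_measure = measure_pmf (pmf_of_set {-1, 1})"

definition glauber_measure :: "nat \<Rightarrow> sample measure" where
  "glauber_measure k =
     (\<Pi>\<^sub>M x\<in>slab k. spin_measure) \<Otimes>\<^sub>M
     ((\<Pi>\<^sub>M i\<in>slab k \<times> UNIV. density lborel (\<lambda>t. ennreal (exponential_density 1 t))) \<Otimes>\<^sub>M
      (\<Pi>\<^sub>M i\<in>slab k \<times> UNIV. spin_measure))"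

lemma prob_space_glauber_measure: "prob_space (glauber_measure k)"
proof -
  have s: "prob_space spin_measure"
    unfolding spin_measure_def by (rule prob_space_measure_pmf)
  have e: "prob_space (density lborel (\<lambda>t. ennreal (exponential_density 1 t)))"
    by (rule prob_space_exponential_density) simp
  show ?thesis
    unfolding glauber_measure_def by (intro prob_space_pair prob_space_PiM s e)
qed

(* The rings of a Poisson process of rate 1, as partial sums of i.i.d. exponential waiting times. *)
definition ring_time :: "(site \<times> nat \<Rightarrow> real) \<Rightarrow> site \<Rightarrow> nat \<Rightarrow> real" where
  "ring_time w x n = (\<Sum>i\<le>n. w (x, i))"

(* "sigma t x" is the spin of x at time t; only t >= 0 and x in the slab matter. Spins change only
   when the clock of their site rings. Almost surely, near x the configuration at time r is constant
   for r < t close to t, so the filter at_left t expresses the evaluation at time t-. *)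
definition glauber_trajectory ::
    "nat \<Rightarrow> boundary \<Rightarrow> sample \<Rightarrow> (real \<Rightarrow> site \<Rightarrow> int) \<Rightarrow> bool" where
  "glauber_trajectory k b = (\<lambda>(s, w, c) \<sigma>.
     (\<forall>x\<in>slab k. \<sigma> 0 x = s x) \<and>
     (\<forall>x\<in>slab k. \<forall>r\<ge>0. \<forall>t\<ge>r. (\<forall>n. ring_time w x n \<notin> {r<..t}) \<longrightarrow> \<sigma> t x = \<sigma> r x) \<and>
     (\<forall>x\<in>slab k. \<forall>n. \<forall>\<^sub>F r in at_left (ring_time w x n).
        \<sigma> (ring_time w x n) x = updated_spin (energy k b (\<sigma> r) x) (\<sigma> r x) (c (x, n))))"

(* On an infinite graph almost every sample determines exactly one trajectory, on [0, infinity) and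
   the slab. The existence clause makes this well-definedness part of the notion, so that the
   universal clause is never vacuous. *)
definition slab_fixates :: "nat \<Rightarrow> boundary \<Rightarrow> bool" where
  "slab_fixates k b \<longleftrightarrow>
     (AE \<omega> in glauber_measure k.
        (\<exists>\<sigma>. glauber_trajectory k b \<omega> \<sigma>) \<and>
        (\<forall>\<sigma>. glauber_trajectory k b \<omega> \<sigma> \<longrightarrow>
           (\<forall>v\<in>slab k. \<exists>T\<ge>0. \<forall>t\<ge>T. \<sigma> t v = \<sigma> T v)))"

end

theory Submission imports Defs
begin

text \<open>Along the dynamics the mean energy per site is bounded, it never increases at a ring, and by
  translation invariance every flip that strictly lowers the energy contributes to it. Hence every
  site sees only finitely many lowering flips. By the memoryless property of the clocks, a local
  configuration from which some finite sequence of allowed flips leads to a lowering flip can then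
  also be seen only finitely often. For \<open>k = 2\<close> with free boundary conditions all degrees are odd, so
  every flip is lowering. For \<open>k = 2\<close> with periodic boundary conditions such a sequence exists, in a
  fixed window, around every site of energy zero. For \<open>k = 3\<close> this fails, because a boundary between
  the two signs in one layer can wander without changing the energy when the two other layers
  have opposite signs. But such a boundary can be pushed along rows or columns until it meets one
  of the \<open>2 \<times> 2 \<times> 3\<close> blocks of plus spins that are present at time zero and frozen forever.\<close>

section \<open>Trajectories from the graphical construction\<close>

text \<open>On an infinite graph there is neither a total energy nor a first ring. The spin of a
  site is therefore computed backwards from its own rings; this recursion ends because chains of
  ringing neighbours within a short enough time slot are almost surely finite, and the same
  well-founded order shows that every trajectory in the sense of \<open>glauber_trajectory\<close>
  agrees with the constructed one at all rings. Energy is balanced in a finite box up to a fixed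
  time, where rings near the boundary cost only a perimeter term; dividing by the volume bounds the
  expected number of lowering rings per site uniformly in the time. Independence enters by redrawing
  a single coordinate of the sample. The argument there is by contradiction: a configuration from
  which no lowering flip can be reached inside the box keeps this property under every flip of
  energy zero away from the blocks, and this rigidity dictates the spins around a free site.\<close>

definition rings_before :: "(site \<times> nat \<Rightarrow> real) \<Rightarrow> site \<Rightarrow> real \<Rightarrow> nat" where
  "rings_before w x t = card {m. ring_time w x m < t}"

text \<open>As rings are numbered from 0, for a regular clock this count is also the index of the
  first ring after t, hence of the waiting time and of the coin that are still undisclosed at time
  t.\<close>

definition rings_upto :: "(site \<times> nat \<Rightarrow> real) \<Rightarrow> site \<Rightarrow> real \<Rightarrow> nat" where
  "rings_upto w x t = card {m. ring_time w x m \<le> t}"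

definition regular_clock :: "(site \<times> nat \<Rightarrow> real) \<Rightarrow> site \<Rightarrow> bool" where
  "regular_clock w x \<longleftrightarrow> (\<forall>n. w (x, n) > 0) \<and> (\<forall>t. finite {n. ring_time w x n < t})"

lemma ring_time_Suc: "ring_time w x (Suc n) = ring_time w x n + w (x, Suc n)"
  by (simp add: ring_time_def)

lemma ring_time_strict_mono:
  assumes "\<And>n. w (x, n) > 0" shows "strict_mono (ring_time w x)"
  unfolding strict_mono_Suc_iff using assms by (simp add: ring_time_Suc)

lemma ring_time_pos:
  assumes "\<And>n. w (x, n) > 0" shows "ring_time w x n > 0"
  unfolding ring_time_def using assms by (intro sum_pos) auto

lemma down_closed_eq_lessThan_card:
  fixes S :: "nat set"
  assumes "finite S" "\<And>m n. n \<in> S \<Longrightarrow> m < n \<Longrightarrow> m \<in> S"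
  shows "S = {..<card S}"
proof (cases "S = {}")
  case False
  have "S = {..Max S}"
    using assms(2)[OF Max_in[OF assms(1) False]] Max_in[OF assms(1) False] Max_ge[OF assms(1)]
    by (force simp: le_less)
  then show ?thesis by (metis card_atMost lessThan_Suc_atMost)
qed simp

lemma
  assumes "regular_clock w x"
  shows less_rings_before_iff: "n < rings_before w x t \<longleftrightarrow> ring_time w x n < t"
    and less_rings_upto_iff: "n < rings_upto w x t \<longleftrightarrow> ring_time w x n \<le> t"
proof -
  have mono: "strict_mono (ring_time w x)"
    using assms by (intro ring_time_strict_mono) (simp add: regular_clock_def)
  have fin: "finite {n. ring_time w x n < t}" for t
    using assms by (simp add: regular_clock_def)
  then have fin': "finite {n. ring_time w x n \<le> t}"
    by (rule rev_finite_subset[of "{n. ring_time w x n < t + 1}"]) auto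
  have "{n. ring_time w x n < t} = {..<rings_before w x t}"
    unfolding rings_before_def by (rule down_closed_eq_lessThan_card[OF fin])
      (use strict_monoD[OF mono] in force)
  then show "n < rings_before w x t \<longleftrightarrow> ring_time w x n < t" by auto
  have "{n. ring_time w x n \<le> t} = {..<rings_upto w x t}"
    unfolding rings_upto_def by (rule down_closed_eq_lessThan_card[OF fin'])
      (use strict_monoD[OF mono] in force)
  then show "n < rings_upto w x t \<longleftrightarrow> ring_time w x n \<le> t" by auto
qed

lemma nat_eqI_less: "(\<And>m::nat. m < a \<longleftrightarrow> m < b) \<Longrightarrow> a = b"
  by (rule linorder_cases[of a b]) blast+

lemma
  assumes "regular_clock w x"
  shows rings_before_ring_time: "rings_before w x (ring_time w x n) = n"
    and rings_upto_ring_time: "rings_upto w x (ring_time w x n) = Suc n"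
proof -
  have mono: "strict_mono (ring_time w x)"
    using assms by (intro ring_time_strict_mono) (simp add: regular_clock_def)
  show "rings_before w x (ring_time w x n) = n"
    by (rule nat_eqI_less) (simp add: less_rings_before_iff[OF assms] strict_mono_less[OF mono])
  show "rings_upto w x (ring_time w x n) = Suc n"
    by (rule nat_eqI_less) (simp add: less_rings_upto_iff[OF assms] strict_mono_less_eq[OF mono] less_Suc_eq_le)
qed

lemma energy_cong:
  assumes "\<And>y. y \<in> insert x (neighbours k b x) \<Longrightarrow> \<eta> y = \<eta>' y"
  shows "energy k b \<eta> x = energy k b \<eta>' x"
  unfolding energy_def using assms by (intro arg_cong[of _ _ uminus] sum.cong) auto

lemma neighbours_slab: "neighbours k b x \<subseteq> slab k"
  by (auto simp: neighbours_def)

section \<open>The spin of a site as a function of the number of its own rings\<close>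

locale slab_dynamics =
  fixes k :: nat and b :: boundary
begin

text \<open>Reading the neighbours' spins just before a ring is a recursion that need not end for
  every sample. The first argument bounds its depth, which makes it total, and measurable for each
  depth. The value 0, which is no spin, marks exhausted depth.\<close>

fun spin_fuel ::
  "nat \<Rightarrow> (site \<Rightarrow> int) \<Rightarrow> (site \<times> nat \<Rightarrow> real) \<Rightarrow> (site \<times> nat \<Rightarrow> int) \<Rightarrow> site \<Rightarrow> nat \<Rightarrow> int" where
  "spin_fuel 0 s w c x n = 0"
| "spin_fuel (Suc d) s w c x 0 = s x"
| "spin_fuel (Suc d) s w c x (Suc n) =
     (let \<eta> = (\<lambda>y. spin_fuel d s w c y (rings_before w y (ring_time w x n)))
      in updated_spin (energy k b \<eta> x) (\<eta> x) (c (x, n)))"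

text \<open>The value on which the depth-bounded recursion settles. Where it never settles the value
  is arbitrary, but still measurable in the sample; for sites of the slab this concerns a null set
  only.\<close>

definition spin_after where
  "spin_after s w c x n =
     spin_fuel (LEAST d. \<forall>e\<ge>d. spin_fuel e s w c x n = spin_fuel d s w c x n) s w c x n"

definition config_before where
  "config_before s w c t x = spin_after s w c x (rings_before w x t)"

definition config_at where
  "config_at s w c t x = spin_after s w c x (rings_upto w x t)"

text \<open>A pair consists of a ring and a later ring that may read its result. Well-foundedness of
  this relation is the substitute for the first ring, which an infinite system does not
  have.\<close>

definition influence :: "(site \<times> nat \<Rightarrow> real) \<Rightarrow> ((site \<times> nat) \<times> (site \<times> nat)) set" where
  "influence w = {((y, m), (x, n)). x \<in> slab k \<and> y \<in> insert x (neighbours k b x) \<and>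
     ring_time w y m < ring_time w x n}"

end

text \<open>Almost every sample has these properties (\<open>AE_good_sample\<close>); under them the
  dynamics is a deterministic object and can be treated without measure theory.\<close>

locale good_sample = slab_dynamics +
  fixes s :: "site \<Rightarrow> int" and w :: "site \<times> nat \<Rightarrow> real" and c :: "site \<times> nat \<Rightarrow> int"
  assumes clocks: "\<And>x. x \<in> slab k \<Longrightarrow> regular_clock w x"
    and distinct_rings: "\<And>x y n m. x \<in> slab k \<Longrightarrow> y \<in> slab k \<Longrightarrow> x \<noteq> y \<Longrightarrow> ring_time w x n \<noteq> ring_time w y m"
    and wf_influence: "wf (influence w)"
    and initial_spins: "\<And>x. x \<in> slab k \<Longrightarrow> s x \<in> {-1, 1}"
    and coins: "\<And>x n. x \<in> slab k \<Longrightarrow> c (x, n) \<in> {-1, 1}"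
begin

abbreviation "T \<equiv> ring_time w"
abbreviation "fuel d x n \<equiv> spin_fuel d s w c x n"
abbreviation "spin x n \<equiv> spin_after s w c x n"
abbreviation "before t \<equiv> config_before s w c t"
abbreviation "at_time t \<equiv> config_at s w c t"

lemma T_mono: "x \<in> slab k \<Longrightarrow> strict_mono (T x)"
  using clocks by (intro ring_time_strict_mono) (simp add: regular_clock_def)

lemma T_pos: "x \<in> slab k \<Longrightarrow> T x n > 0"
  using clocks by (intro ring_time_pos) (simp add: regular_clock_def)

lemma nbr_in_slab: "y \<in> insert x (neighbours k b x) \<Longrightarrow> x \<in> slab k \<Longrightarrow> y \<in> slab k"
  using neighbours_slab by blast

lemma fuel_stabilises_ring:
  "x \<in> slab k \<Longrightarrow> \<exists>d. \<forall>e\<ge>d. fuel e x (Suc n) = fuel d x (Suc n)"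
proof (induction "(x, n)" arbitrary: x n rule: wf_induct_rule[OF wf_influence])
  case (1 x n)
  have "\<exists>d. \<forall>e\<ge>d. fuel e y (rings_before w y (T x n)) = fuel d y (rings_before w y (T x n))"
    if y: "y \<in> insert x (neighbours k b x)" for y
  proof (cases "rings_before w y (T x n)")
    case 0
    have "fuel e y 0 = s y" if "e \<ge> 1" for e using that by (cases e) auto
    then show ?thesis unfolding 0 by (intro exI[of _ 1]) auto
  next
    case (Suc m)
    have "y \<in> slab k" using y 1 nbr_in_slab by blast
    moreover have "T y m < T x n"
      using less_rings_before_iff[OF clocks[OF \<open>y \<in> slab k\<close>], of m "T x n"] Suc by simp
    then have "((y, m), (x, n)) \<in> influence w"
      using 1 y by (auto simp: influence_def)
    ultimately show ?thesis unfolding Suc using 1 by blast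
  qed
  then obtain D where D: "\<And>y e. y \<in> insert x (neighbours k b x) \<Longrightarrow> e \<ge> D y \<Longrightarrow>
      fuel e y (rings_before w y (T x n)) = fuel (D y) y (rings_before w y (T x n))"
    by metis
  \<comment> \<open>A site has finitely many neighbours, so one depth serves them all.\<close>
  define d where "d = Max (D ` insert x (neighbours k b x))"
  have dge: "D y \<le> d" if "y \<in> insert x (neighbours k b x)" for y
    unfolding d_def using that finite_neighbours by (intro Max_ge) auto
  have "fuel e x (Suc n) = fuel (Suc d) x (Suc n)" if e: "e \<ge> Suc d" for e
  proof -
    obtain e' where e': "e = Suc e'" "e' \<ge> d" using e by (cases e) auto
    have *: "fuel e' y (rings_before w y (T x n)) = fuel d y (rings_before w y (T x n))"
      if "y \<in> insert x (neighbours k b x)" for y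
      using D[OF that] dge[OF that] e'(2) by (metis le_trans)
    show ?thesis unfolding e' spin_fuel.simps Let_def
      using * by (intro arg_cong3[where f = updated_spin] energy_cong) auto
  qed
  then show ?case by blast
qed

lemma fuel_stabilises: "x \<in> slab k \<Longrightarrow> \<exists>d. \<forall>e\<ge>d. fuel e x n = spin x n"
proof -
  assume x: "x \<in> slab k"
  have "\<exists>d. \<forall>e\<ge>d. fuel e x n = fuel d x n"
  proof (cases n)
    case 0
    have "fuel e x 0 = s x" if "e \<ge> 1" for e using that by (cases e) auto
    then show ?thesis unfolding 0 by (intro exI[of _ 1]) auto
  qed (use fuel_stabilises_ring[OF x] in simp)
  from LeastI_ex[OF this] show ?thesis unfolding spin_after_def by blast
qed

lemma spin_0: "x \<in> slab k \<Longrightarrow> spin x 0 = s x"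
proof -
  assume "x \<in> slab k"
  then obtain d where "\<And>e. e \<ge> d \<Longrightarrow> fuel e x 0 = spin x 0" using fuel_stabilises by blast
  from this[of "Suc d"] show ?thesis by simp
qed

lemma spin_Suc:
  assumes x: "x \<in> slab k"
  shows "spin x (Suc n) = updated_spin (energy k b (before (T x n)) x) (spin x n) (c (x, n))"
proof -
  have "\<exists>d. \<forall>e\<ge>d. fuel e y (rings_before w y (T x n)) = before (T x n) y"
    if "y \<in> insert x (neighbours k b x)" for y
    unfolding config_before_def using fuel_stabilises nbr_in_slab[OF that x] by simp
  then obtain D where D: "\<And>y e. y \<in> insert x (neighbours k b x) \<Longrightarrow> e \<ge> D y \<Longrightarrow>
      fuel e y (rings_before w y (T x n)) = before (T x n) y"
    by metis
  obtain d' where d': "\<And>e. e \<ge> d' \<Longrightarrow> fuel e x (Suc n) = spin x (Suc n)"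
    using fuel_stabilises[OF x] by metis
  define d where "d = max d' (Max (D ` insert x (neighbours k b x)))"
  have dge: "D y \<le> d" if "y \<in> insert x (neighbours k b x)" for y
    unfolding d_def using that finite_neighbours by (intro max.coboundedI2 Max_ge) auto
  have "spin x (Suc n) = fuel (Suc d) x (Suc n)"
    by (rule d'[symmetric]) (simp add: d_def)
  also have "\<dots> = updated_spin (energy k b (before (T x n)) x) (before (T x n) x) (c (x, n))"
    unfolding spin_fuel.simps Let_def using D dge
    by (intro arg_cong3[where f = updated_spin] energy_cong) auto
  finally show ?thesis
    by (simp add: config_before_def rings_before_ring_time[OF clocks[OF x]])
qed

lemma spin_pm1: "x \<in> slab k \<Longrightarrow> spin x n \<in> {-1, 1}"
proof (induction n)
  case 0 then show ?case using spin_0 initial_spins by simp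
next
  case (Suc n)
  then show ?case using coins[of x n] by (auto simp: spin_Suc updated_spin_def)
qed

lemma before_ring: "x \<in> slab k \<Longrightarrow> before (T x n) x = spin x n"
  by (simp add: config_before_def rings_before_ring_time[OF clocks])

lemma at_ring: "x \<in> slab k \<Longrightarrow> at_time (T x n) x = spin x (Suc n)"
  by (simp add: config_at_def rings_upto_ring_time[OF clocks])

lemma at_ring_other:
  assumes "x \<in> slab k" "y \<in> slab k" "x \<noteq> y"
  shows "at_time (T x n) y = before (T x n) y"
proof -
  have "rings_upto w y (T x n) = rings_before w y (T x n)"
  proof (rule nat_eqI_less)
    fix m
    have "T y m \<le> T x n \<longleftrightarrow> T y m < T x n"
      using distinct_rings[OF assms, of n m] by linarith
    then show "m < rings_upto w y (T x n) \<longleftrightarrow> m < rings_before w y (T x n)"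
      by (simp add: less_rings_upto_iff[OF clocks[OF assms(2)]] less_rings_before_iff[OF clocks[OF assms(2)]])
  qed
  then show ?thesis by (simp add: config_at_def config_before_def)
qed

text \<open>A regular clock has finitely many rings before t, hence a last one; from that ring, or
  from time 0, up to t nothing happens at y. This turns the evaluation at t- in the definition of a
  trajectory into \<open>config_before\<close>.\<close>

lemma eventually_at_time_left:
  assumes y: "y \<in> slab k" and t: "t > 0"
  shows "\<forall>\<^sub>F r in at_left t. r \<ge> 0 \<and> at_time r y = before t y"
proof -
  have fin: "finite {n. T y n < t}" using clocks[OF y] by (simp add: regular_clock_def)
  define q where "q = Max (insert 0 (T y ` {n. T y n < t}))"
  have q: "0 \<le> q" "q < t" "\<And>n. T y n < t \<Longrightarrow> T y n \<le> q"
    unfolding q_def using fin t by auto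
  have "\<forall>\<^sub>F r in at_left t. r \<in> {q<..<t}"
    using q(2) eventually_at_left_real by blast
  then show ?thesis
  proof eventually_elim
    case (elim r)
    have "rings_upto w y r = rings_before w y t"
      by (rule nat_eqI_less) (use elim q(3) in
        \<open>auto simp: less_rings_upto_iff[OF clocks[OF y]] less_rings_before_iff[OF clocks[OF y]] intro: order_trans less_imp_le\<close>)
    then show ?case using q elim by (simp add: config_at_def config_before_def)
  qed
qed

text \<open>Supplies the existence clause in \<open>slab_fixates\<close>.\<close>

lemma config_at_is_trajectory: "glauber_trajectory k b (s, w, c) at_time"
  unfolding glauber_trajectory_def prod.case
proof (intro conjI ballI allI impI)
  fix x assume x: "x \<in> slab k"
  have "rings_upto w x 0 = 0"
    by (rule nat_eqI_less) (use T_pos[OF x] in \<open>simp add: less_rings_upto_iff[OF clocks[OF x]] not_le\<close>)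
  then show "at_time 0 x = s x" by (simp add: config_at_def spin_0[OF x])
next
  fix x r t assume x: "x \<in> slab k" and rt: "r \<ge> (0::real)" "t \<ge> r" "\<forall>n. T x n \<notin> {r<..t}"
  have "rings_upto w x t = rings_upto w x r"
    by (rule nat_eqI_less) (use rt in \<open>auto simp: less_rings_upto_iff[OF clocks[OF x]] not_less intro: order_trans\<close>)
  then show "at_time t x = at_time r x" by (simp add: config_at_def)
next
  fix x n assume x: "x \<in> slab k"
  have "\<forall>\<^sub>F r in at_left (T x n). \<forall>y\<in>insert x (neighbours k b x). at_time r y = before (T x n) y"
    using finite_neighbours eventually_at_time_left[OF nbr_in_slab[OF _ x] T_pos[OF x]]
    by (intro eventually_ball_finite finite.insertI ballI) (blast intro: eventually_mono)+
  then show "\<forall>\<^sub>F r in at_left (T x n). at_time (T x n) x = updated_spin (energy k b (at_time r) x) (at_time r x) (c (x, n))"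
  proof eventually_elim
    case (elim r)
    have "energy k b (at_time r) x = energy k b (before (T x n)) x"
      using elim by (intro energy_cong) auto
    then show ?case using elim by (simp add: at_ring[OF x] spin_Suc[OF x] before_ring[OF x])
  qed
qed

lemma trajectory_const:
  assumes "glauber_trajectory k b (s, w, c) \<sigma>" "x \<in> slab k" "0 \<le> r" "r \<le> t" "\<And>n. T x n \<notin> {r<..t}"
  shows "\<sigma> t x = \<sigma> r x"
  using assms unfolding glauber_trajectory_def prod.case by blast

text \<open>Uniqueness, by induction along \<open>influence\<close>: the energy just before a ring
  depends on earlier rings at which the trajectory has already been identified. Between rings a
  trajectory is constant, so its values at the rings determine it.\<close>

lemma trajectory_at_ring:
  assumes traj: "glauber_trajectory k b (s, w, c) \<sigma>"
  shows "x \<in> slab k \<Longrightarrow> \<sigma> (T x n) x = spin x (Suc n)"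
proof (induction "(x, n)" arbitrary: x n rule: wf_induct_rule[OF wf_influence])
  case (1 x n)
  note x = \<open>x \<in> slab k\<close>
  have "\<forall>\<^sub>F r in at_left (T x n). \<sigma> r y = before (T x n) y"
    if y: "y \<in> insert x (neighbours k b x)" for y
  proof -
    have ys: "y \<in> slab k" using nbr_in_slab[OF y x] .
    \<comment> \<open>q is the last ring of y before \<open>T x n\<close>, or 0 if there is none;
      from q until \<open>T x n\<close> the trajectory keeps its value at y.\<close>
    obtain q where q: "0 \<le> q" "q < T x n" "\<sigma> q y = before (T x n) y"
        "\<And>m. T y m < T x n \<Longrightarrow> T y m \<le> q"
    proof (cases "rings_before w y (T x n)")
      case 0
      have "\<sigma> 0 y = s y" using traj ys by (auto simp: glauber_trajectory_def)
      then show thesis using 0 that[of 0] T_pos[OF x] spin_0[OF ys] less_rings_before_iff[OF clocks[OF ys], of _ "T x n"]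
        by (auto simp: config_before_def)
    next
      case (Suc m)
      have m: "T y m < T x n" using less_rings_before_iff[OF clocks[OF ys], of m "T x n"] Suc by simp
      then have "((y, m), (x, n)) \<in> influence w" using x y by (auto simp: influence_def)
      then have "\<sigma> (T y m) y = spin y (Suc m)" using 1 ys by blast
      moreover have "T y i \<le> T y m" if "T y i < T x n" for i
      proof -
        have "i < Suc m" using that Suc less_rings_before_iff[OF clocks[OF ys], of i "T x n"] by simp
        then show ?thesis using strict_mono_less_eq[OF T_mono[OF ys]] by simp
      qed
      ultimately show thesis using m Suc that[of "T y m"] T_pos[OF ys, of m]
        by (auto simp: config_before_def)
    qed
    have "\<forall>\<^sub>F r in at_left (T x n). r \<in> {q<..<T x n}"
      using q(2) eventually_at_left_real by blast
    then show ?thesis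
    proof eventually_elim
      case (elim r)
      have "T y m \<notin> {q<..r}" for m using elim q(4)[of m] by auto
      then have "\<sigma> r y = \<sigma> q y" using q(1) elim by (intro trajectory_const[OF traj ys]) auto
      then show ?case using q by simp
    qed
  qed
  then have "\<forall>\<^sub>F r in at_left (T x n). \<forall>y\<in>insert x (neighbours k b x). \<sigma> r y = before (T x n) y"
    using finite_neighbours by (intro eventually_ball_finite finite.insertI ballI) blast+
  moreover have "\<forall>\<^sub>F r in at_left (T x n). \<sigma> (T x n) x = updated_spin (energy k b (\<sigma> r) x) (\<sigma> r x) (c (x, n))"
    using traj x by (auto simp: glauber_trajectory_def)
  ultimately have "\<forall>\<^sub>F r in at_left (T x n). \<sigma> (T x n) x = spin x (Suc n)"
  proof eventually_elim
    case (elim r)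
    have "energy k b (\<sigma> r) x = energy k b (before (T x n)) x"
      using elim by (intro energy_cong) auto
    then show ?case using elim by (simp add: spin_Suc[OF x] before_ring[OF x])
  qed
  then show ?case using trivial_limit_at_left_real eventually_happens by blast
qed

lemma trajectory_fixates:
  assumes traj: "glauber_trajectory k b (s, w, c) \<sigma>" and x: "x \<in> slab k"
    and fin: "finite {n. spin x (Suc n) \<noteq> spin x n}"
  shows "\<exists>t\<ge>0. \<forall>r\<ge>t. \<sigma> r x = \<sigma> t x"
proof -
  obtain N where N: "\<And>n. n \<ge> N \<Longrightarrow> spin x (Suc n) = spin x n"
    using fin unfolding finite_nat_set_iff_bounded by (metis (mono_tags) mem_Collect_eq not_less)
  have const: "spin x n = spin x N" if "n \<ge> N" for n
    using that by (induction n rule: dec_induct) (auto simp: N)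
  have eq: "\<sigma> r x = \<sigma> (T x N) x" if r: "r \<ge> T x N" for r
  proof -
    define m where "m = rings_upto w x r - 1"
    have "N < rings_upto w x r" using r by (simp add: less_rings_upto_iff[OF clocks[OF x]])
    then have m: "rings_upto w x r = Suc m" "N \<le> m" by (auto simp: m_def)
    have mr: "T x m \<le> r" using m less_rings_upto_iff[OF clocks[OF x], of m r] by simp
    have "T x i \<notin> {T x m<..r}" for i
      using less_rings_upto_iff[OF clocks[OF x], of i r] m strict_mono_less[OF T_mono[OF x], of m i] by auto
    then have "\<sigma> r x = \<sigma> (T x m) x"
      using mr T_pos[OF x, of m] by (intro trajectory_const[OF traj x]) auto
    also have "\<dots> = \<sigma> (T x N) x"
      using const[of "Suc m"] const[of "Suc N"] m(2) by (simp add: trajectory_at_ring[OF traj x])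
    finally show ?thesis .
  qed
  then show ?thesis using less_imp_le[OF T_pos[OF x, of N]] by blast
qed

end

section \<open>Resampling and the memoryless property\<close>

text \<open>Here \<open>\<phi> a u\<close> is a with one coordinate replaced by u. The identity says
  that redrawing this coordinate from E preserves the law A. Independence is used in this form: all
  other coordinates are fixed, and the integral runs over a single one.\<close>

definition resampling :: "'a measure \<Rightarrow> 'b measure \<Rightarrow> ('a \<Rightarrow> 'b \<Rightarrow> 'a) \<Rightarrow> bool" where
  "resampling A E \<phi> \<longleftrightarrow> (\<lambda>(a, u). \<phi> a u) \<in> A \<Otimes>\<^sub>M E \<rightarrow>\<^sub>M A \<and>
     (\<forall>f\<in>borel_measurable A. (\<integral>\<^sup>+a. f a \<partial>A) = (\<integral>\<^sup>+a. \<integral>\<^sup>+u. f (\<phi> a u) \<partial>E \<partial>A))"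

lemma resamplingD:
  "resampling A E \<phi> \<Longrightarrow> f \<in> borel_measurable A \<Longrightarrow> (\<integral>\<^sup>+a. f a \<partial>A) = (\<integral>\<^sup>+a. \<integral>\<^sup>+u. f (\<phi> a u) \<partial>E \<partial>A)"
  by (simp add: resampling_def)

lemma upd_measurable:
  assumes "i \<in> I" shows "(\<lambda>(X, u). X(i := u)) \<in> PiM I M \<Otimes>\<^sub>M M i \<rightarrow>\<^sub>M PiM I M"
  using measurable_add_dim[of i I M] insert_absorb[OF assms] by simp

lemma resampling_PiM:
  assumes M: "\<And>j. j \<in> I \<Longrightarrow> prob_space (M j)" and i: "i \<in> I"
  shows "resampling (PiM I M) (M i) (\<lambda>X u. X(i := u))"
  unfolding resampling_def
proof (intro conjI ballI)
  show upd: "(\<lambda>(X, u). X(i := u)) \<in> PiM I M \<Otimes>\<^sub>M M i \<rightarrow>\<^sub>M PiM I M"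
    using i by (rule upd_measurable)
  fix f :: "_ \<Rightarrow> ennreal" assume f: "f \<in> borel_measurable (PiM I M)"
  define J where "J = I - {i}"
  have I: "I = insert i J" using i by (auto simp: J_def)
  have MJ: "\<And>j. j \<in> J \<Longrightarrow> prob_space (M j)" using M by (simp add: J_def)
  interpret Mi: prob_space "M i" using M i .
  interpret PJ: prob_space "PiM J M" by (rule prob_space_PiM) (rule MJ)
  interpret pair_sigma_finite "M i" "PiM J M" ..
  \<comment> \<open>Coordinate i is split off as an independent factor. The redrawing identity then
    follows because the inner average no longer depends on the old value of that coordinate.\<close>
  have *: "(\<integral>\<^sup>+X. g X \<partial>PiM I M) = (\<integral>\<^sup>+X. (\<integral>\<^sup>+u. g (X(i := u)) \<partial>M i) \<partial>PiM J M)"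
    if g[measurable]: "g \<in> borel_measurable (PiM I M)" for g
  proof -
    have meas: "(\<lambda>(x, X). X(i := x)) \<in> M i \<Otimes>\<^sub>M PiM J M \<rightarrow>\<^sub>M PiM I M"
      unfolding I by measurable
    have "(\<integral>\<^sup>+X. g X \<partial>PiM I M) = (\<integral>\<^sup>+X. g X \<partial>distr (M i \<Otimes>\<^sub>M PiM J M) (PiM I M) (\<lambda>(x, X). X(i := x)))"
      using distr_pair_PiM_eq_PiM[of J M i, OF MJ Mi.prob_space_axioms] by (simp add: I)
    also have "\<dots> = (\<integral>\<^sup>+z. g ((\<lambda>(x, X). X(i := x)) z) \<partial>(M i \<Otimes>\<^sub>M PiM J M))"
      by (rule nn_integral_distr[OF meas]) simp
    also have "\<dots> = (\<integral>\<^sup>+X. (\<integral>\<^sup>+u. g (X(i := u)) \<partial>M i) \<partial>PiM J M)"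
      using measurable_compose[OF meas g] by (subst nn_integral_snd[symmetric]) auto
    finally show ?thesis .
  qed
  have inner: "(\<lambda>X. \<integral>\<^sup>+u. f (X(i := u)) \<partial>M i) \<in> borel_measurable (PiM I M)"
    using measurable_compose[OF upd f] by (intro Mi.borel_measurable_nn_integral) (simp add: case_prod_beta')
  show "(\<integral>\<^sup>+X. f X \<partial>PiM I M) = (\<integral>\<^sup>+X. (\<integral>\<^sup>+u. f (X(i := u)) \<partial>M i) \<partial>PiM I M)"
    unfolding *[OF inner] by (simp add: *[OF f] Mi.emeasure_space_1)
qed

lemma resampling_fst:
  assumes "sigma_finite_measure A" "sigma_finite_measure B" "sigma_finite_measure E" and r: "resampling A E \<phi>"
  shows "resampling (A \<Otimes>\<^sub>M B) E (\<lambda>(a, b) u. (\<phi> a u, b))"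
  unfolding resampling_def
proof (intro conjI ballI)
  interpret A: sigma_finite_measure A by fact
  interpret B: sigma_finite_measure B by fact
  interpret E: sigma_finite_measure E by fact
  interpret AB: pair_sigma_finite A B ..
  have phi: "(\<lambda>(a, u). \<phi> a u) \<in> A \<Otimes>\<^sub>M E \<rightarrow>\<^sub>M A" using r by (simp add: resampling_def)
  have "(\<lambda>z. \<phi> (fst (fst z)) (snd z)) \<in> (A \<Otimes>\<^sub>M B) \<Otimes>\<^sub>M E \<rightarrow>\<^sub>M A"
    by (rule measurable_compose[of "\<lambda>z. (fst (fst z), snd z)", OF _ phi, simplified]) measurable
  then show phi': "(\<lambda>(ab, u). (case ab of (a, b) \<Rightarrow> \<lambda>u. (\<phi> a u, b)) u) \<in> (A \<Otimes>\<^sub>M B) \<Otimes>\<^sub>M E \<rightarrow>\<^sub>M A \<Otimes>\<^sub>M B"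
    by (simp add: case_prod_beta')
  fix f :: "_ \<Rightarrow> ennreal" assume f[measurable]: "f \<in> borel_measurable (A \<Otimes>\<^sub>M B)"
  have g: "(\<lambda>z. \<integral>\<^sup>+u. f (\<phi> (fst z) u, snd z) \<partial>E) \<in> borel_measurable (A \<Otimes>\<^sub>M B)"
    using measurable_compose[OF phi' f] by (intro E.borel_measurable_nn_integral) (simp add: case_prod_beta')
  have "(\<integral>\<^sup>+z. f z \<partial>(A \<Otimes>\<^sub>M B)) = (\<integral>\<^sup>+b. \<integral>\<^sup>+a. f (a, b) \<partial>A \<partial>B)"
    by (subst AB.nn_integral_snd[symmetric]) auto
  also have "\<dots> = (\<integral>\<^sup>+b. \<integral>\<^sup>+a. \<integral>\<^sup>+u. f (\<phi> a u, b) \<partial>E \<partial>A \<partial>B)"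
  proof (rule nn_integral_cong)
    fix b assume "b \<in> space B"
    then show "(\<integral>\<^sup>+a. f (a, b) \<partial>A) = (\<integral>\<^sup>+a. \<integral>\<^sup>+u. f (\<phi> a u, b) \<partial>E \<partial>A)"
      using resamplingD[OF r, of "\<lambda>a. f (a, b)"] measurable_Pair1[OF f] by simp
  qed
  also have "\<dots> = (\<integral>\<^sup>+z. \<integral>\<^sup>+u. f (\<phi> (fst z) u, snd z) \<partial>E \<partial>(A \<Otimes>\<^sub>M B))"
    using AB.nn_integral_snd[of "\<lambda>(a, b). \<integral>\<^sup>+u. f (\<phi> a u, b) \<partial>E"] g by (simp add: case_prod_beta')
  finally show "(\<integral>\<^sup>+z. f z \<partial>(A \<Otimes>\<^sub>M B)) = (\<integral>\<^sup>+z. \<integral>\<^sup>+u. f ((case z of (a, b) \<Rightarrow> \<lambda>u. (\<phi> a u, b)) u) \<partial>E \<partial>(A \<Otimes>\<^sub>M B))"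
    by (simp add: case_prod_beta')
qed

lemma resampling_snd:
  assumes "sigma_finite_measure A" "sigma_finite_measure B" "sigma_finite_measure E" and r: "resampling B E \<phi>"
  shows "resampling (A \<Otimes>\<^sub>M B) E (\<lambda>(a, b) u. (a, \<phi> b u))"
  unfolding resampling_def
proof (intro conjI ballI)
  interpret A: sigma_finite_measure A by fact
  interpret B: sigma_finite_measure B by fact
  interpret E: sigma_finite_measure E by fact
  have phi: "(\<lambda>(a, u). \<phi> a u) \<in> B \<Otimes>\<^sub>M E \<rightarrow>\<^sub>M B" using r by (simp add: resampling_def)
  have "(\<lambda>z. \<phi> (snd (fst z)) (snd z)) \<in> (A \<Otimes>\<^sub>M B) \<Otimes>\<^sub>M E \<rightarrow>\<^sub>M B"
    by (rule measurable_compose[of "\<lambda>z. (snd (fst z), snd z)", OF _ phi, simplified]) measurable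
  then show phi': "(\<lambda>(ab, u). (case ab of (a, b) \<Rightarrow> \<lambda>u. (a, \<phi> b u)) u) \<in> (A \<Otimes>\<^sub>M B) \<Otimes>\<^sub>M E \<rightarrow>\<^sub>M A \<Otimes>\<^sub>M B"
    by (simp add: case_prod_beta')
  fix f :: "_ \<Rightarrow> ennreal" assume f[measurable]: "f \<in> borel_measurable (A \<Otimes>\<^sub>M B)"
  have g: "(\<lambda>z. \<integral>\<^sup>+u. f (fst z, \<phi> (snd z) u) \<partial>E) \<in> borel_measurable (A \<Otimes>\<^sub>M B)"
    using measurable_compose[OF phi' f] by (intro E.borel_measurable_nn_integral) (simp add: case_prod_beta')
  have "(\<integral>\<^sup>+z. f z \<partial>(A \<Otimes>\<^sub>M B)) = (\<integral>\<^sup>+a. \<integral>\<^sup>+b. f (a, b) \<partial>B \<partial>A)"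
    by (subst B.nn_integral_fst[symmetric]) auto
  also have "\<dots> = (\<integral>\<^sup>+a. \<integral>\<^sup>+b. \<integral>\<^sup>+u. f (a, \<phi> b u) \<partial>E \<partial>B \<partial>A)"
  proof (rule nn_integral_cong)
    fix a assume "a \<in> space A"
    then show "(\<integral>\<^sup>+b. f (a, b) \<partial>B) = (\<integral>\<^sup>+b. \<integral>\<^sup>+u. f (a, \<phi> b u) \<partial>E \<partial>B)"
      using resamplingD[OF r, of "\<lambda>b. f (a, b)"] measurable_Pair2[OF f] by simp
  qed
  also have "\<dots> = (\<integral>\<^sup>+z. \<integral>\<^sup>+u. f (fst z, \<phi> (snd z) u) \<partial>E \<partial>(A \<Otimes>\<^sub>M B))"
    using B.nn_integral_fst[of "\<lambda>(a, b). \<integral>\<^sup>+u. f (a, \<phi> b u) \<partial>E" A] g by (simp add: case_prod_beta')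
  finally show "(\<integral>\<^sup>+z. f z \<partial>(A \<Otimes>\<^sub>M B)) = (\<integral>\<^sup>+z. \<integral>\<^sup>+u. f ((case z of (a, b) \<Rightarrow> \<lambda>u. (a, \<phi> b u)) u) \<partial>E \<partial>(A \<Otimes>\<^sub>M B))"
    by (simp add: case_prod_beta')
qed

section \<open>Laws of waiting times, ring times and spins\<close>

abbreviation exp_measure :: "real measure" where
  "exp_measure \<equiv> density lborel (\<lambda>t. ennreal (exponential_density 1 t))"

lemma prob_space_exp_measure: "prob_space exp_measure"
  by (rule prob_space_exponential_density) simp

lemma prob_space_spin_measure: "prob_space spin_measure"
  unfolding spin_measure_def by (rule prob_space_measure_pmf)

lemma emeasure_exp_measure_greater:
  assumes "a \<ge> 0" shows "emeasure exp_measure {a<..} = ennreal (exp (- a))"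
proof -
  interpret prob_space exp_measure by (rule prob_space_exp_measure)
  have "distributed exp_measure lborel (\<lambda>x. x) (exponential_density 1)"
    unfolding distributed_def by (auto simp: distr_id2)
  from exponential_distributedD_gt[OF this assms] show ?thesis
    by (simp add: emeasure_eq_measure greaterThan_def)
qed

lemma AE_exp_measure_pos: "AE u in exp_measure. u > 0"
proof -
  have "AE u in lborel. u \<noteq> (0::real)" by (rule AE_lborel_singleton)
  then show ?thesis
    by (subst AE_density) (auto simp: exponential_density_def elim!: eventually_mono split: if_splits)
qed

lemma emeasure_exp_measure_singleton: "emeasure exp_measure {v} = 0"
  by (subst emeasure_density) (auto simp: nn_integral_indicator_singleton' mult.commute)

text \<open>The Laplace transform of the exponential law at 1: the integrand is half the density of
  the exponential law of rate 2.\<close>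

lemma nn_integral_exp_measure_exp: "(\<integral>\<^sup>+u. ennreal (exp (- u)) \<partial>exp_measure) = 1 / 2"
proof -
  interpret P: prob_space "density lborel (\<lambda>t. ennreal (exponential_density 2 t))"
    by (rule prob_space_exponential_density) simp
  have "(\<integral>\<^sup>+u. ennreal (exp (- u)) \<partial>exp_measure)
      = (\<integral>\<^sup>+u. ennreal (exponential_density 1 u) * ennreal (exp (- u)) \<partial>lborel)"
    by (subst nn_integral_density) auto
  also have "\<dots> = (\<integral>\<^sup>+u. ennreal (1/2) * ennreal (exponential_density 2 u) \<partial>lborel)"
    by (intro nn_integral_cong)
      (auto simp: exponential_density_def ennreal_mult'[symmetric] exp_add[symmetric] simp del: ennreal_half)
  also have "\<dots> = ennreal (1/2) * emeasure (density lborel (\<lambda>t. ennreal (exponential_density 2 t))) UNIV"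
    by (subst emeasure_density) (auto simp: nn_integral_cmult)
  also have "\<dots> = 1 / 2" using P.emeasure_space_1 by (simp add: divide_ennreal_def)
  finally show ?thesis .
qed

lemma countable_slab: "countable (slab k)"
  unfolding slab_def by simp

abbreviation clock_measure :: "nat \<Rightarrow> (site \<times> nat \<Rightarrow> real) measure" where
  "clock_measure k \<equiv> \<Pi>\<^sub>M i\<in>slab k \<times> UNIV. exp_measure"
abbreviation initial_measure :: "nat \<Rightarrow> (site \<Rightarrow> int) measure" where
  "initial_measure k \<equiv> \<Pi>\<^sub>M x\<in>slab k. spin_measure"
abbreviation coin_measure :: "nat \<Rightarrow> (site \<times> nat \<Rightarrow> int) measure" where
  "coin_measure k \<equiv> \<Pi>\<^sub>M i\<in>slab k \<times> UNIV. spin_measure"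

lemma prob_space_factors:
  "prob_space (clock_measure k)" "prob_space (initial_measure k)" "prob_space (coin_measure k)"
  by (intro prob_space_PiM prob_space_exp_measure prob_space_spin_measure)+

lemma sigma_finite_factors:
  "sigma_finite_measure (clock_measure k)" "sigma_finite_measure (initial_measure k)"
  "sigma_finite_measure (coin_measure k)" "sigma_finite_measure (clock_measure k \<Otimes>\<^sub>M coin_measure k)"
  "sigma_finite_measure exp_measure" "sigma_finite_measure spin_measure"
  by (intro prob_space_imp_sigma_finite prob_space_pair prob_space_factors
      prob_space_exp_measure prob_space_spin_measure)+

lemma
  shows resampling_clock: "x \<in> slab k \<Longrightarrow>
      resampling (glauber_measure k) exp_measure (\<lambda>(s, w, c) u. (s, w((x, n) := u), c))"
    and resampling_coin: "x \<in> slab k \<Longrightarrow>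
      resampling (glauber_measure k) spin_measure (\<lambda>(s, w, c) u. (s, w, c((x, n) := u)))"
    and resampling_initial: "x \<in> slab k \<Longrightarrow>
      resampling (glauber_measure k) spin_measure (\<lambda>(s, w, c) u. (s(x := u), w, c))"
proof -
  assume x: "x \<in> slab k"
  have *: "resampling (clock_measure k) exp_measure (\<lambda>w u. w((x, n) := u))"
    by (rule resampling_PiM) (use x prob_space_exp_measure in auto)
  from resampling_snd[OF sigma_finite_factors(2,4,5) resampling_fst[OF sigma_finite_factors(1,3,5) *]]
  show "resampling (glauber_measure k) exp_measure (\<lambda>(s, w, c) u. (s, w((x, n) := u), c))"
    unfolding glauber_measure_def by (simp add: case_prod_beta')
  have *: "resampling (coin_measure k) spin_measure (\<lambda>w u. w((x, n) := u))"
    by (rule resampling_PiM) (use x prob_space_spin_measure in auto)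
  from resampling_snd[OF sigma_finite_factors(2,4,6) resampling_snd[OF sigma_finite_factors(1,3,6) *]]
  show "resampling (glauber_measure k) spin_measure (\<lambda>(s, w, c) u. (s, w, c((x, n) := u)))"
    unfolding glauber_measure_def by (simp add: case_prod_beta')
  have *: "resampling (initial_measure k) spin_measure (\<lambda>w u. w(x := u))"
    by (rule resampling_PiM) (use x prob_space_spin_measure in auto)
  from resampling_fst[OF sigma_finite_factors(2,4,6) *]
  show "resampling (glauber_measure k) spin_measure (\<lambda>(s, w, c) u. (s(x := u), w, c))"
    unfolding glauber_measure_def by (simp add: case_prod_beta')
qed

lemma emeasure_resampling:
  assumes r: "resampling A E \<phi>" and S: "S \<in> sets A" and E: "sigma_finite_measure E"
  shows "emeasure A S = (\<integral>\<^sup>+a. emeasure E {u\<in>space E. \<phi> a u \<in> S} \<partial>A)"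
proof -
  have phi: "(\<lambda>(a, u). \<phi> a u) \<in> A \<Otimes>\<^sub>M E \<rightarrow>\<^sub>M A" using r by (simp add: resampling_def)
  have "emeasure A S = (\<integral>\<^sup>+a. indicator S a \<partial>A)" using S by simp
  also have "\<dots> = (\<integral>\<^sup>+a. \<integral>\<^sup>+u. indicator S (\<phi> a u) \<partial>E \<partial>A)"
    by (rule resamplingD[OF r]) (use S in measurable)
  also have "\<dots> = (\<integral>\<^sup>+a. emeasure E {u\<in>space E. \<phi> a u \<in> S} \<partial>A)"
  proof (rule nn_integral_cong)
    fix a assume a: "a \<in> space A"
    have m: "(\<lambda>u. \<phi> a u) \<in> E \<rightarrow>\<^sub>M A"
      using measurable_compose[OF measurable_Pair1'[OF a] phi] by simp
    have "{u\<in>space E. \<phi> a u \<in> S} \<in> sets E"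
      using measurable_sets[OF m S] by (simp add: vimage_def Int_def conj_commute)
    then have "emeasure E {u\<in>space E. \<phi> a u \<in> S} = (\<integral>\<^sup>+u. indicator {u\<in>space E. \<phi> a u \<in> S} u \<partial>E)" by simp
    also have "\<dots> = (\<integral>\<^sup>+u. indicator S (\<phi> a u) \<partial>E)"
      by (intro nn_integral_cong) (auto simp: indicator_def)
    finally show "(\<integral>\<^sup>+u. indicator S (\<phi> a u) \<partial>E) = emeasure E {u\<in>space E. \<phi> a u \<in> S}" by simp
  qed
  finally show ?thesis .
qed

lemma measurable_emeasure_fiber:
  assumes r: "resampling A E \<phi>" and S: "S \<in> sets A" and E: "sigma_finite_measure E"
  shows "(\<lambda>a. emeasure E {u\<in>space E. \<phi> a u \<in> S}) \<in> borel_measurable A"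
proof -
  interpret sigma_finite_measure E by fact
  have phi: "(\<lambda>(a, u). \<phi> a u) \<in> A \<Otimes>\<^sub>M E \<rightarrow>\<^sub>M A" using r by (simp add: resampling_def)
  have "(\<lambda>(a, u). \<phi> a u) -` S \<inter> space (A \<Otimes>\<^sub>M E) \<in> sets (A \<Otimes>\<^sub>M E)"
    by (rule measurable_sets[OF phi S])
  from measurable_emeasure_Pair[OF this] show ?thesis
    by (rule measurable_cong[THEN iffD1, rotated]) (auto simp: space_pair_measure intro!: arg_cong[where f = "emeasure E"])
qed

text \<open>Two probabilities are compared fibre by fibre, where all coordinates but one are fixed
  and only a one-dimensional law remains.\<close>

lemma emeasure_fiber_ratio:
  assumes r: "resampling A E \<phi>" and S: "S \<in> sets A" "S' \<in> sets A" and E: "sigma_finite_measure E"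
    and ae: "AE a in A. emeasure E {u\<in>space E. \<phi> a u \<in> S'} = q * emeasure E {u\<in>space E. \<phi> a u \<in> S}"
  shows "emeasure A S' = q * emeasure A S"
  unfolding emeasure_resampling[OF r S(1) E] emeasure_resampling[OF r S(2) E]
  by (subst nn_integral_cmult[symmetric]) (use measurable_emeasure_fiber[OF r S(1) E] ae in \<open>auto intro: nn_integral_cong_AE\<close>)

lemma space_glauber_measure:
  "space (glauber_measure k) = (\<Pi>\<^sub>E x\<in>slab k. UNIV) \<times> (\<Pi>\<^sub>E i\<in>slab k \<times> UNIV. UNIV) \<times> (\<Pi>\<^sub>E i\<in>slab k \<times> UNIV. UNIV)"
  by (simp add: glauber_measure_def space_pair_measure space_PiM spin_measure_def)

lemma
  assumes x: "x \<in> slab k"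
  shows measurable_waiting_time[measurable]: "(\<lambda>\<omega>. fst (snd \<omega>) (x, n)) \<in> borel_measurable (glauber_measure k)"
    and measurable_coin[measurable]: "(\<lambda>\<omega>. snd (snd \<omega>) (x, n)) \<in> glauber_measure k \<rightarrow>\<^sub>M count_space UNIV"
    and measurable_initial[measurable]: "(\<lambda>\<omega>. fst \<omega> x) \<in> glauber_measure k \<rightarrow>\<^sub>M count_space UNIV"
proof -
  have 1: "(\<lambda>w. w (x, n)) \<in> borel_measurable (clock_measure k)"
    using measurable_component_singleton[of "(x, n)" "slab k \<times> UNIV" "\<lambda>_. exp_measure"] x
    by (simp cong: measurable_cong_sets)
  have sets: "sets spin_measure = sets (count_space UNIV)" by (simp add: spin_measure_def)
  have 2: "(\<lambda>w. w (x, n)) \<in> coin_measure k \<rightarrow>\<^sub>M count_space UNIV"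
    using measurable_component_singleton[of "(x, n)" "slab k \<times> UNIV" "\<lambda>_. spin_measure"] x
    by (simp add: measurable_cong_sets[OF refl sets])
  have 3: "(\<lambda>w. w x) \<in> initial_measure k \<rightarrow>\<^sub>M count_space UNIV"
    using measurable_component_singleton[of x "slab k" "\<lambda>_. spin_measure"] x
    by (simp add: measurable_cong_sets[OF refl sets])
  show "(\<lambda>\<omega>. fst (snd \<omega>) (x, n)) \<in> borel_measurable (glauber_measure k)"
    unfolding glauber_measure_def by (rule measurable_compose[OF _ 1]) measurable
  show "(\<lambda>\<omega>. snd (snd \<omega>) (x, n)) \<in> glauber_measure k \<rightarrow>\<^sub>M count_space UNIV"
    unfolding glauber_measure_def by (rule measurable_compose[OF _ 2]) measurable
  show "(\<lambda>\<omega>. fst \<omega> x) \<in> glauber_measure k \<rightarrow>\<^sub>M count_space UNIV"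
    unfolding glauber_measure_def by (rule measurable_compose[OF _ 3]) measurable
qed

lemma measurable_ring_time[measurable]:
  "x \<in> slab k \<Longrightarrow> (\<lambda>\<omega>. ring_time (fst (snd \<omega>)) x n) \<in> borel_measurable (glauber_measure k)"
  unfolding ring_time_def by measurable

lemma
  shows ring_time_upd: "ring_time (w((x, n) := u)) x n = (\<Sum>i<n. w (x, i)) + u"
    and ring_time_upd_less: "m < n \<Longrightarrow> ring_time (w((x, n) := u)) x m = ring_time w x m"
    and ring_time_upd_other: "y \<noteq> x \<Longrightarrow> ring_time (w((x, n) := u)) y m = ring_time w y m"
  by (auto simp: ring_time_def lessThan_Suc_atMost[symmetric] intro!: sum.cong)

text \<open>A ring time is a sum of n + 1 independent waiting times, and each contributes a factor
  1/2; redrawing the last summand separates it from the others.\<close>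

lemma nn_integral_exp_ring_time:
  assumes x: "x \<in> slab k"
  shows "(\<integral>\<^sup>+\<omega>. ennreal (exp (- ring_time (fst (snd \<omega>)) x n)) \<partial>glauber_measure k) = (1/2) ^ Suc n"
proof (induction n)
  note [measurable] = x
  interpret prob_space "glauber_measure k" by (rule prob_space_glauber_measure)
  have step: "(\<integral>\<^sup>+\<omega>. ennreal (exp (- ring_time (fst (snd \<omega>)) x n)) \<partial>glauber_measure k) =
      (\<integral>\<^sup>+\<omega>. ennreal (exp (- (\<Sum>i<n. fst (snd \<omega>) (x, i)))) \<partial>glauber_measure k) * (1/2)" for n
  proof -
    have "(\<integral>\<^sup>+\<omega>. ennreal (exp (- ring_time (fst (snd \<omega>)) x n)) \<partial>glauber_measure k) =
      (\<integral>\<^sup>+\<omega>. \<integral>\<^sup>+u. ennreal (exp (- (\<Sum>i<n. fst (snd \<omega>) (x, i)))) * ennreal (exp (- u)) \<partial>exp_measure \<partial>glauber_measure k)"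
      by (subst resamplingD[OF resampling_clock[OF x, of n]])
        (auto simp: case_prod_beta' ring_time_upd exp_add exp_diff exp_minus field_simps ennreal_mult'[symmetric] intro!: nn_integral_cong)
    also have "\<dots> = (\<integral>\<^sup>+\<omega>. ennreal (exp (- (\<Sum>i<n. fst (snd \<omega>) (x, i)))) * (1/2) \<partial>glauber_measure k)"
      by (intro nn_integral_cong) (simp add: nn_integral_cmult nn_integral_exp_measure_exp)
    also have "\<dots> = (\<integral>\<^sup>+\<omega>. ennreal (exp (- (\<Sum>i<n. fst (snd \<omega>) (x, i)))) \<partial>glauber_measure k) * (1/2)"
      by (rule nn_integral_multc) measurable
    finally show ?thesis .
  qed
  {
    case 0
    show ?case unfolding step by (simp add: emeasure_space_1)
  next
    case (Suc n)
    then show ?case unfolding step[of "Suc n"]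
      by (simp add: ring_time_def lessThan_Suc_atMost mult.commute)
  }
qed

text \<open>Markov's inequality for \<open>exp (- ring_time w x n)\<close> bounds the n-th
  probability by \<open>exp t\<close> divided by 2^(n+1). The bound on the expected number of rings
  is crude, but it only has to multiply a perimeter.\<close>

lemma suminf_emeasure_ring_less:
  assumes x: "x \<in> slab k"
  shows "(\<Sum>n. emeasure (glauber_measure k) {\<omega>\<in>space (glauber_measure k). ring_time (fst (snd \<omega>)) x n < t}) \<le> ennreal (exp t)"
proof -
  note [measurable] = x
  have "emeasure (glauber_measure k) {\<omega>\<in>space (glauber_measure k). ring_time (fst (snd \<omega>)) x n < t}
      \<le> ennreal (exp t) * (1/2) ^ Suc n" for n
  proof -
    have "emeasure (glauber_measure k) {\<omega>\<in>space (glauber_measure k). ring_time (fst (snd \<omega>)) x n < t}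
       = (\<integral>\<^sup>+\<omega>. indicator {\<omega>\<in>space (glauber_measure k). ring_time (fst (snd \<omega>)) x n < t} \<omega> \<partial>glauber_measure k)"
      by simp
    also have "\<dots> \<le> (\<integral>\<^sup>+\<omega>. ennreal (exp t) * ennreal (exp (- ring_time (fst (snd \<omega>)) x n)) \<partial>glauber_measure k)"
      by (intro nn_integral_mono) (auto simp: indicator_def ennreal_mult'[symmetric] exp_add[symmetric])
    also have "\<dots> = ennreal (exp t) * (1/2) ^ Suc n"
      by (subst nn_integral_cmult) (auto simp: nn_integral_exp_ring_time[OF x])
    finally show ?thesis .
  qed
  then have "(\<Sum>n. emeasure (glauber_measure k) {\<omega>\<in>space (glauber_measure k). ring_time (fst (snd \<omega>)) x n < t})
      \<le> (\<Sum>n. ennreal (exp t) * (1/2) ^ Suc n)"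
    by (intro suminf_le) auto
  also have "\<dots> = ennreal (exp t) * (\<Sum>n. (1/2) ^ Suc n)" by (rule ennreal_suminf_cmult)
  also have "(\<Sum>n. (1/2 :: ennreal) ^ Suc n) = (\<Sum>n. ennreal ((1/2) ^ Suc n))"
    by (intro suminf_cong, subst ennreal_power[symmetric]) (simp_all add: divide_ennreal_def)
  also have "\<dots> = ennreal 1"
    using sums_mult[OF geometric_sums[of "1/2::real"], of "1/2"] by (intro suminf_ennreal_eq) auto
  finally show ?thesis by simp
qed

lemma (in prob_space) AE_finite_of_suminf:
  assumes A: "\<And>n. A n \<in> events" and fin: "(\<Sum>n. emeasure M (A n)) < \<infinity>"
  shows "AE x in M. finite {n::nat. x \<in> A n}"
proof -
  have "summable (\<lambda>n. prob (A n))"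
    using fin by (intro summable_suminf_not_top) (auto simp: emeasure_eq_measure)
  then have "AE x in M. \<forall>\<^sub>F n in sequentially. x \<in> space M - A n"
    by (intro borel_cantelli_AE1 A) (auto simp: emeasure_eq_measure)
  then show ?thesis
  proof eventually_elim
    case (elim x)
    then obtain N where "\<And>n. n \<ge> N \<Longrightarrow> x \<notin> A n" by (auto simp: eventually_sequentially)
    then have "{n. x \<in> A n} \<subseteq> {..<N}" by (auto simp: not_le[symmetric])
    then show ?case by (rule finite_subset) simp
  qed
qed

lemma AE_regular_clock:
  assumes x: "x \<in> slab k"
  shows "AE \<omega> in glauber_measure k. regular_clock (fst (snd \<omega>)) x"
proof -
  note [measurable] = x
  interpret prob_space "glauber_measure k" by (rule prob_space_glauber_measure)
  have "AE \<omega> in glauber_measure k. fst (snd \<omega>) (x, n) > 0" for n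
  proof -
    have m: "{\<omega>\<in>space (glauber_measure k). \<not> fst (snd \<omega>) (x, n) > 0} \<in> sets (glauber_measure k)" by measurable
    have "emeasure exp_measure {u. \<not> u > 0} = 0"
      using AE_exp_measure_pos by (subst (asm) AE_iff_measurable[OF _ refl]) auto
    then have "emeasure exp_measure {u \<in> space exp_measure. (case \<omega> of (s, w, c) \<Rightarrow> \<lambda>u. (s, w((x, n) := u), c)) u
        \<in> {\<omega>\<in>space (glauber_measure k). \<not> fst (snd \<omega>) (x, n) > 0}} = 0" for \<omega> :: sample
      by (rule emeasure_eq_0[rotated]) (auto simp: case_prod_beta')
    then have "emeasure (glauber_measure k) {\<omega>\<in>space (glauber_measure k). \<not> fst (snd \<omega>) (x, n) > 0} = 0"
      by (subst emeasure_resampling[OF resampling_clock[OF x, of n] m sigma_finite_factors(5)]) simp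
    then show ?thesis by (subst AE_iff_measurable[OF m]) auto
  qed
  \<comment> \<open>Integer horizons keep the number of exceptional null sets countable.\<close>
  moreover have "AE \<omega> in glauber_measure k. finite {n. ring_time (fst (snd \<omega>)) x n < real j}" for j
  proof -
    have "AE \<omega> in glauber_measure k. finite {n. \<omega> \<in> {\<omega>\<in>space (glauber_measure k). ring_time (fst (snd \<omega>)) x n < real j}}"
      using suminf_emeasure_ring_less[OF x, of "real j"]
      by (intro AE_finite_of_suminf) (auto intro: le_less_trans)
    then show ?thesis using AE_space by eventually_elim simp
  qed
  ultimately have "AE \<omega> in glauber_measure k. (\<forall>n. fst (snd \<omega>) (x, n) > 0) \<and> (\<forall>j. finite {n. ring_time (fst (snd \<omega>)) x n < real j})"
    by (simp add: AE_all_countable)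
  then show ?thesis
  proof eventually_elim
    case (elim \<omega>)
    have "finite {n. ring_time (fst (snd \<omega>)) x n < t}" for t
    proof -
      obtain j where "t < real j" using reals_Archimedean2 by blast
      then show ?thesis
        by (intro rev_finite_subset[OF elim[THEN conjunct2, rule_format, of j]]) auto
    qed
    with elim show ?case by (simp add: regular_clock_def)
  qed
qed

text \<open>With everything else fixed, the two rings coincide for at most one value of the n-th
  waiting time at x, and the exponential law has no atoms.\<close>

lemma AE_distinct_rings:
  assumes x: "x \<in> slab k" and y: "y \<in> slab k" and ne: "x \<noteq> y"
  shows "AE \<omega> in glauber_measure k. ring_time (fst (snd \<omega>)) x n \<noteq> ring_time (fst (snd \<omega>)) y m"
proof -
  note [measurable] = x y
  let ?S = "{\<omega>\<in>space (glauber_measure k). \<not> ring_time (fst (snd \<omega>)) x n \<noteq> ring_time (fst (snd \<omega>)) y m}"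
  have m: "?S \<in> sets (glauber_measure k)" by measurable
  have "emeasure exp_measure {u \<in> space exp_measure. (case \<omega> of (s, w, c) \<Rightarrow> \<lambda>u. (s, w((x, n) := u), c)) u \<in> ?S} = 0" for \<omega> :: sample
  proof -
    obtain s w c where \<omega>: "\<omega> = (s, w, c)" by (metis prod_cases3)
    have "emeasure exp_measure {u \<in> space exp_measure. (case \<omega> of (s, w, c) \<Rightarrow> \<lambda>u. (s, w((x, n) := u), c)) u \<in> ?S}
        \<le> emeasure exp_measure {ring_time w y m - (\<Sum>i<n. w (x, i))}"
      using ne by (intro emeasure_mono) (auto simp: \<omega> ring_time_upd ring_time_upd_other)
    then show ?thesis by (simp add: emeasure_exp_measure_singleton)
  qed
  then have "emeasure (glauber_measure k) ?S = 0"
    by (subst emeasure_resampling[OF resampling_clock[OF x, of n] m sigma_finite_factors(5)]) simp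
  then show ?thesis by (subst AE_iff_measurable[OF m]) auto
qed

section \<open>Fresh waiting times, coins and initial spins\<close>

definition quiet :: "(site \<times> nat \<Rightarrow> real) \<Rightarrow> site \<Rightarrow> real \<Rightarrow> real \<Rightarrow> bool" where
  "quiet w z t \<delta> \<longleftrightarrow> (\<forall>m. ring_time w z m \<notin> {t<..t + \<delta>})"

text \<open>The memoryless property. The hypothesis \<open>inv\<close> says that the event and the random time \<open>\<tau>\<close> do not
  depend on the first waiting time at \<open>z\<close> that ends after \<open>\<tau>\<close>.\<close>

lemma emeasure_quiet:
  fixes \<tau> :: "sample \<Rightarrow> real"
  assumes z: "z \<in> slab k" and A[measurable]: "A \<in> sets (glauber_measure k)"
    and tau[measurable]: "\<tau> \<in> borel_measurable (glauber_measure k)" and \<delta>: "\<delta> \<ge> 0"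
    and tau0: "\<And>\<omega>. \<omega> \<in> A \<Longrightarrow> \<tau> \<omega> \<ge> 0"
    and inv: "\<And>s w c m u. (s, w, c) \<in> A \<Longrightarrow> (\<And>n. w (z, n) > 0) \<Longrightarrow> u > 0 \<Longrightarrow>
      (\<And>j. j < m \<Longrightarrow> ring_time w z j \<le> \<tau> (s, w, c)) \<Longrightarrow> \<tau> (s, w, c) < ring_time w z m \<Longrightarrow>
      \<tau> (s, w, c) < ring_time (w((z, m) := u)) z m \<Longrightarrow>
      (s, w((z, m) := u), c) \<in> A \<and> \<tau> (s, w((z, m) := u), c) = \<tau> (s, w, c)"
  shows "emeasure (glauber_measure k) {\<omega>\<in>A. quiet (fst (snd \<omega>)) z (\<tau> \<omega>) \<delta>} = ennreal (exp (-\<delta>)) * emeasure (glauber_measure k) A"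
proof -
  note [measurable] = z
  let ?M = "glauber_measure k"
  interpret prob_space ?M by (rule prob_space_glauber_measure)
  have Asp: "\<omega> \<in> space ?M" if "\<omega> \<in> A" for \<omega> using that sets.sets_into_space[OF A] by blast
  \<comment> \<open>The event is split by the index m of the first ring of z after \<tau>. For d = 0
    the pieces make up A up to a null set, for d = \<delta> its quiet part.\<close>
  define F where "F d m = {\<omega>\<in>space ?M. \<omega> \<in> A \<and> (\<forall>n. fst (snd \<omega>) (z, n) > 0) \<and> (\<forall>j<m. ring_time (fst (snd \<omega>)) z j \<le> \<tau> \<omega>)
    \<and> \<tau> \<omega> < ring_time (fst (snd \<omega>)) z m \<and> \<tau> \<omega> + d < ring_time (fst (snd \<omega>)) z m}" for d m
  have F_sets[measurable]: "F d m \<in> sets ?M" for d m unfolding F_def by measurable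
  have disj: "disjoint_family (F d)" for d
    unfolding disjoint_family_on_def
  proof (intro ballI impI)
    fix m m' :: nat assume "m \<noteq> m'"
    then consider "m < m'" | "m' < m" by linarith
    then show "F d m \<inter> F d m' = {}" by cases (force simp: F_def)+
  qed
  have un: "emeasure ?M {\<omega>\<in>A. quiet (fst (snd \<omega>)) z (\<tau> \<omega>) d} = emeasure ?M (\<Union>m. F d m)" if d: "d \<ge> 0" for d
  proof (rule emeasure_eq_AE)
    show "AE \<omega> in ?M. (\<omega> \<in> {\<omega>\<in>A. quiet (fst (snd \<omega>)) z (\<tau> \<omega>) d}) = (\<omega> \<in> (\<Union>m. F d m))"
      using AE_regular_clock[OF z] AE_space
    proof eventually_elim
      case (elim \<omega>)
      let ?T = "ring_time (fst (snd \<omega>)) z"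
      have mono: "strict_mono ?T" using elim by (intro ring_time_strict_mono) (simp add: regular_clock_def)
      have quiet_iff: "quiet (fst (snd \<omega>)) z (\<tau> \<omega>) d \<longleftrightarrow> \<tau> \<omega> + d < ?T m"
        if m: "\<forall>j<m. ?T j \<le> \<tau> \<omega>" "\<tau> \<omega> < ?T m" for m
      proof
        assume "\<tau> \<omega> + d < ?T m"
        moreover have "?T j \<le> \<tau> \<omega> \<or> ?T m \<le> ?T j" for j
          using m(1) strict_mono_less_eq[OF mono] by (cases "j < m") auto
        ultimately have "?T j \<notin> {\<tau> \<omega><..\<tau> \<omega> + d}" for j
          by (smt (verit) greaterThanAtMost_iff)
        then show "quiet (fst (snd \<omega>)) z (\<tau> \<omega>) d" unfolding quiet_def by blast
      next
        assume "quiet (fst (snd \<omega>)) z (\<tau> \<omega>) d"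
        then have "?T m \<notin> {\<tau> \<omega><..\<tau> \<omega> + d}" unfolding quiet_def by blast
        then show "\<tau> \<omega> + d < ?T m" using m(2) by simp
      qed
      have "\<exists>m. (\<forall>j<m. ?T j \<le> \<tau> \<omega>) \<and> \<tau> \<omega> < ?T m"
      proof -
        have "{n. ?T n < \<tau> \<omega> + 1} \<noteq> UNIV" using elim by (metis infinite_UNIV_nat regular_clock_def)
        then obtain n where "\<not> ?T n < \<tau> \<omega> + 1" by blast
        then have ex: "\<exists>n. \<tau> \<omega> < ?T n" by (intro exI[of _ n]) simp
        have "?T j \<le> \<tau> \<omega>" if "j < (LEAST n. \<tau> \<omega> < ?T n)" for j
          using not_less_Least[OF that] by simp
        with LeastI_ex[OF ex] show ?thesis by blast
      qed
      then show ?case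
        using quiet_iff elim by (auto simp: F_def regular_clock_def)
    qed
    show "{\<omega>\<in>A. quiet (fst (snd \<omega>)) z (\<tau> \<omega>) d} \<in> sets ?M"
    proof -
      have "{\<omega>\<in>A. quiet (fst (snd \<omega>)) z (\<tau> \<omega>) d} = {\<omega>\<in>space ?M. \<omega> \<in> A \<and> (\<forall>m. \<not> (\<tau> \<omega> < ring_time (fst (snd \<omega>)) z m \<and> ring_time (fst (snd \<omega>)) z m \<le> \<tau> \<omega> + d))}"
        using Asp by (auto simp: quiet_def)
      also have "\<dots> \<in> sets ?M" by measurable
      finally show ?thesis .
    qed
  qed simp
  have ratio: "emeasure ?M (F \<delta> m) = ennreal (exp (-\<delta>)) * emeasure ?M (F 0 m)" for m
  proof (rule emeasure_fiber_ratio[OF resampling_clock[OF z, of m] F_sets F_sets sigma_finite_factors(5)])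
    show "AE \<omega> in ?M. emeasure exp_measure {u \<in> space exp_measure. (case \<omega> of (s, w, c) \<Rightarrow> \<lambda>u. (s, w((z, m) := u), c)) u \<in> F \<delta> m} =
        ennreal (exp (-\<delta>)) * emeasure exp_measure {u \<in> space exp_measure. (case \<omega> of (s, w, c) \<Rightarrow> \<lambda>u. (s, w((z, m) := u), c)) u \<in> F 0 m}"
    proof (rule AE_I2)
      fix \<omega> :: sample
      obtain s w c where \<omega>: "\<omega> = (s, w, c)" by (metis prod_cases3)
      let ?G = "\<lambda>d. {u. (s, w((z, m) := u), c) \<in> F d m}"
      \<comment> \<open>With all but the waiting time u fixed, both pieces are rays in u, and the
        shift of the end point by \<delta> costs the factor \<open>exp (- \<delta>)\<close>.\<close>
      have "?G \<delta> = {} \<and> ?G 0 = {} \<or> (\<exists>r\<ge>0. ?G \<delta> = {r + \<delta><..} \<and> ?G 0 = {r<..})"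
      proof (cases "?G 0 = {}")
        case True
        moreover have "F \<delta> m \<subseteq> F 0 m" using \<delta> by (auto simp: F_def)
        ultimately show ?thesis by blast
      next
        case False
        then obtain v where v: "(s, w((z, m) := v), c) \<in> F 0 m" by auto
        \<comment> \<open>S is the time of the ring of z before the m-th one, or 0 if m = 0, so that
          the m-th ring occurs at S + u.\<close>
        define S where "S = (\<Sum>i<m. w (z, i))"
        define t where "t = \<tau> (s, w((z, m) := v), c)"
        have vA: "(s, w((z, m) := v), c) \<in> A" and vpos: "\<And>n. (w((z, m) := v)) (z, n) > 0"
          and vj: "\<And>j. j < m \<Longrightarrow> ring_time (w((z, m) := v)) z j \<le> t" and vm: "t < ring_time (w((z, m) := v)) z m"
          using v by (auto simp: F_def t_def)
        have r: "t - S \<ge> 0"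
        proof (cases m)
          case 0 then show ?thesis using tau0[OF vA] by (simp add: S_def t_def)
        next
          case (Suc m')
          then show ?thesis using vj[of m'] ring_time_upd_less[of m' m w z v]
            by (simp add: S_def ring_time_def lessThan_Suc_atMost)
        qed
        have up: "(s, w((z, m) := u), c) \<in> A \<and> \<tau> (s, w((z, m) := u), c) = t" if "u > t - S" for u
        proof -
          have pos: "u > 0" using that r by simp
          have "\<tau> (s, w((z, m) := v), c) < ring_time ((w((z, m) := v))((z, m) := u)) z m"
            using that unfolding fun_upd_upd ring_time_upd S_def t_def by simp
          from inv[OF vA vpos pos _ _ this] vj vm show ?thesis by (simp add: t_def)
        qed
        have 1: "(s, w((z, m) := u), c) \<in> F d m" if "u > t - S + d" "d \<ge> 0" for u d
        proof -
          have u: "u > t - S" "u > 0" using that r by auto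
          have "(w((z, m) := u)) (z, n) > 0" for n using vpos[of n] u by (auto split: if_splits)
          then show ?thesis
            using up[OF u(1)] that vj Asp by (auto simp: F_def ring_time_upd ring_time_upd_less S_def)
        qed
        have 2: "u > t - S + d" if u: "(s, w((z, m) := u), c) \<in> F d m" for u d
        proof -
          \<comment> \<open>If u were smaller, \<open>inv\<close> could be applied to pass from u
            back to v, and both samples would have the same \<tau>, namely t. But membership of u
            puts the ring at S + u after its own \<tau>.\<close>
          have "u > t - S"
          proof (rule ccontr)
            assume le: "\<not> u > t - S"
            have "\<tau> (s, w((z, m) := u), c) < S + u" using u by (simp add: F_def ring_time_upd S_def)
            moreover have "t < S + v" using vm by (simp add: ring_time_upd S_def)
            ultimately have "t = \<tau> (s, w((z, m) := u), c)"
              using inv[of s "w((z, m) := u)" c v m] u le vpos[of m] r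
              by (auto simp: F_def t_def ring_time_upd S_def)
            then show False using le \<open>\<tau> (s, w((z, m) := u), c) < S + u\<close> by simp
          qed
          from up[OF this] show ?thesis using u by (simp add: F_def ring_time_upd S_def)
        qed
        show ?thesis
          using 1[of 0] 1[of \<delta>] 2[of _ 0] 2[of _ \<delta>] r \<delta> by (intro disjI2 exI[of _ "t - S"]) auto
      qed
      then show "emeasure exp_measure {u \<in> space exp_measure. (case \<omega> of (s, w, c) \<Rightarrow> \<lambda>u. (s, w((z, m) := u), c)) u \<in> F \<delta> m} =
        ennreal (exp (-\<delta>)) * emeasure exp_measure {u \<in> space exp_measure. (case \<omega> of (s, w, c) \<Rightarrow> \<lambda>u. (s, w((z, m) := u), c)) u \<in> F 0 m}"
        using \<delta> by (auto simp: \<omega> emeasure_exp_measure_greater ennreal_mult'[symmetric] exp_add[symmetric])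
    qed
  qed
  have "emeasure ?M A = emeasure ?M {\<omega>\<in>A. quiet (fst (snd \<omega>)) z (\<tau> \<omega>) 0}"
    by (rule arg_cong[where f = "emeasure ?M"]) (auto simp: quiet_def)
  also have "\<dots> = (\<Sum>m. emeasure ?M (F 0 m))"
    unfolding un[OF order_refl] by (rule suminf_emeasure[symmetric]) (use disj in auto)
  finally have A_eq: "emeasure ?M A = (\<Sum>m. emeasure ?M (F 0 m))" .
  have "emeasure ?M {\<omega>\<in>A. quiet (fst (snd \<omega>)) z (\<tau> \<omega>) \<delta>} = (\<Sum>m. emeasure ?M (F \<delta> m))"
    unfolding un[OF \<delta>] by (rule suminf_emeasure[symmetric]) (use disj in auto)
  also have "\<dots> = ennreal (exp (-\<delta>)) * emeasure ?M A"
    unfolding ratio A_eq by (rule ennreal_suminf_cmult)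
  finally show ?thesis .
qed

lemma emeasure_spin_measure_singleton: "d \<in> {-1, 1} \<Longrightarrow> emeasure spin_measure {d} = 1 / 2"
  by (auto simp: spin_measure_def emeasure_pmf_of_set divide_ennreal_def)

text \<open>The index of the coin may be random as long as redrawing that coin changes neither the
  event nor the index: on each set of constant index the coin is one fixed coordinate.\<close>

lemma emeasure_fresh_coin:
  fixes N :: "sample \<Rightarrow> nat"
  assumes z: "z \<in> slab k" and A[measurable]: "A \<in> sets (glauber_measure k)"
    and N[measurable]: "N \<in> glauber_measure k \<rightarrow>\<^sub>M count_space UNIV" and d: "d \<in> {-1, 1}"
    and inv: "\<And>s w c u. (s, w, c) \<in> A \<Longrightarrow>
      (s, w, c((z, N (s, w, c)) := u)) \<in> A \<and> N (s, w, c((z, N (s, w, c)) := u)) = N (s, w, c)"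
  shows "emeasure (glauber_measure k) {\<omega>\<in>A. snd (snd \<omega>) (z, N \<omega>) = d} = 1/2 * emeasure (glauber_measure k) A"
proof -
  note [measurable] = z
  let ?M = "glauber_measure k"
  have Asp: "\<omega> \<in> space ?M" if "\<omega> \<in> A" for \<omega> using that sets.sets_into_space[OF A] by blast
  define F where "F m = {\<omega>\<in>space ?M. \<omega> \<in> A \<and> N \<omega> = m}" for m
  define F' where "F' m = {\<omega>\<in>space ?M. \<omega> \<in> A \<and> N \<omega> = m \<and> snd (snd \<omega>) (z, m) = d}" for m
  have [measurable]: "F m \<in> sets ?M" "F' m \<in> sets ?M" for m unfolding F_def F'_def by measurable
  have "emeasure ?M (F' m) = 1/2 * emeasure ?M (F m)" for m
  proof (rule emeasure_fiber_ratio[OF resampling_coin[OF z, of m] _ _ sigma_finite_factors(6)])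
    show "AE \<omega> in ?M. emeasure spin_measure {u \<in> space spin_measure. (case \<omega> of (s, w, c) \<Rightarrow> \<lambda>u. (s, w, c((z, m) := u))) u \<in> F' m} =
        1/2 * emeasure spin_measure {u \<in> space spin_measure. (case \<omega> of (s, w, c) \<Rightarrow> \<lambda>u. (s, w, c((z, m) := u))) u \<in> F m}"
    proof (rule AE_I2)
      fix \<omega> :: sample
      obtain s w c where \<omega>: "\<omega> = (s, w, c)" by (metis prod_cases3)
      have sp: "space spin_measure = UNIV" by (simp add: spin_measure_def)
      interpret P: prob_space spin_measure by (rule prob_space_spin_measure)
      let ?G = "{u. (s, w, c((z, m) := u)) \<in> F m}" and ?G' = "{u. (s, w, c((z, m) := u)) \<in> F' m}"
      have "?G = {} \<and> ?G' = {} \<or> ?G = UNIV \<and> ?G' = {d}"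
      proof (cases "?G = {}")
        case True then show ?thesis by (auto simp: F_def F'_def)
      next
        case False
        then obtain v where v: "(s, w, c((z, m) := v)) \<in> F m" by auto
        then have "(s, w, c((z, m) := u)) \<in> F m" for u
          using inv[of s w "c((z, m) := v)" u] Asp by (auto simp: F_def)
        then show ?thesis by (auto simp: F_def F'_def)
      qed
      then show "emeasure spin_measure {u \<in> space spin_measure. (case \<omega> of (s, w, c) \<Rightarrow> \<lambda>u. (s, w, c((z, m) := u))) u \<in> F' m} =
        1/2 * emeasure spin_measure {u \<in> space spin_measure. (case \<omega> of (s, w, c) \<Rightarrow> \<lambda>u. (s, w, c((z, m) := u))) u \<in> F m}"
        using P.emeasure_space_1 d by (auto simp: \<omega> sp emeasure_spin_measure_singleton)
    qed
  qed auto
  then have "(\<Sum>m. emeasure ?M (F' m)) = 1/2 * (\<Sum>m. emeasure ?M (F m))"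
    by (simp add: ennreal_suminf_cmult)
  moreover have "(\<Sum>m. emeasure ?M (F' m)) = emeasure ?M {\<omega>\<in>A. snd (snd \<omega>) (z, N \<omega>) = d}"
    using Asp by (subst suminf_emeasure) (auto simp: disjoint_family_on_def F'_def intro!: arg_cong[where f = "emeasure ?M"])
  moreover have "(\<Sum>m. emeasure ?M (F m)) = emeasure ?M A"
    using Asp by (subst suminf_emeasure) (auto simp: disjoint_family_on_def F_def intro!: arg_cong[where f = "emeasure ?M"])
  ultimately show ?thesis by simp
qed

lemma emeasure_fresh_initial:
  assumes z: "z \<in> slab k" and A[measurable]: "A \<in> sets (glauber_measure k)" and d: "d \<in> {-1, 1}"
    and inv: "\<And>s w c u. (s, w, c) \<in> A \<Longrightarrow> (s(z := u), w, c) \<in> A"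
  shows "emeasure (glauber_measure k) {\<omega>\<in>A. fst \<omega> z = d} = 1/2 * emeasure (glauber_measure k) A"
proof -
  note [measurable] = z
  let ?M = "glauber_measure k"
  have Asp: "\<omega> \<in> space ?M" if "\<omega> \<in> A" for \<omega> using that sets.sets_into_space[OF A] by blast
  have m: "{\<omega>\<in>A. fst \<omega> z = d} \<in> sets ?M"
  proof -
    have "{\<omega>\<in>A. fst \<omega> z = d} = {\<omega>\<in>space ?M. \<omega> \<in> A \<and> fst \<omega> z = d}" using Asp by auto
    also have "\<dots> \<in> sets ?M" by measurable
    finally show ?thesis .
  qed
  show ?thesis
  proof (rule emeasure_fiber_ratio[OF resampling_initial[OF z] A m sigma_finite_factors(6)], rule AE_I2)
    fix \<omega> :: sample
    obtain s w c where \<omega>: "\<omega> = (s, w, c)" by (metis prod_cases3)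
    have sp: "space spin_measure = UNIV" by (simp add: spin_measure_def)
    interpret P: prob_space spin_measure by (rule prob_space_spin_measure)
    have "(\<forall>u. (s(z := u), w, c) \<notin> A) \<or> (\<forall>u. (s(z := u), w, c) \<in> A)"
      using inv[of "s(z := _)" w c] by (metis fun_upd_upd)
    then show "emeasure spin_measure {u \<in> space spin_measure. (case \<omega> of (s, w, c) \<Rightarrow> \<lambda>u. (s(z := u), w, c)) u \<in> {\<omega>\<in>A. fst \<omega> z = d}} =
        1/2 * emeasure spin_measure {u \<in> space spin_measure. (case \<omega> of (s, w, c) \<Rightarrow> \<lambda>u. (s(z := u), w, c)) u \<in> A}"
      using P.emeasure_space_1 d by (auto simp: \<omega> sp emeasure_spin_measure_singleton)
  qed
qed

section \<open>Well-foundedness of the influence relation\<close>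

lemma measurable_quiet[measurable]:
  assumes [measurable]: "z \<in> slab k" "\<tau> \<in> borel_measurable (glauber_measure k)"
  shows "Measurable.pred (glauber_measure k) (\<lambda>\<omega>. quiet (fst (snd \<omega>)) z (\<tau> \<omega>) \<delta>)"
  unfolding quiet_def greaterThanAtMost_iff by measurable

lemma quiet_upd_other: "y \<noteq> z \<Longrightarrow> quiet (w((z, m) := u)) y t \<delta> = quiet w y t \<delta>"
  by (simp add: quiet_def ring_time_upd_other)

lemma emeasure_not_quiet:
  fixes \<tau> :: "sample \<Rightarrow> real"
  assumes z: "z \<in> slab k" and A[measurable]: "A \<in> sets (glauber_measure k)"
    and tau[measurable]: "\<tau> \<in> borel_measurable (glauber_measure k)" and \<delta>: "\<delta> \<ge> 0"
    and tau0: "\<And>\<omega>. \<omega> \<in> A \<Longrightarrow> \<tau> \<omega> \<ge> 0"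
    and inv: "\<And>s w c m u. (s, w, c) \<in> A \<Longrightarrow> (\<And>n. w (z, n) > 0) \<Longrightarrow> u > 0 \<Longrightarrow>
      (\<And>j. j < m \<Longrightarrow> ring_time w z j \<le> \<tau> (s, w, c)) \<Longrightarrow> \<tau> (s, w, c) < ring_time w z m \<Longrightarrow>
      \<tau> (s, w, c) < ring_time (w((z, m) := u)) z m \<Longrightarrow>
      (s, w((z, m) := u), c) \<in> A \<and> \<tau> (s, w((z, m) := u), c) = \<tau> (s, w, c)"
  shows "emeasure (glauber_measure k) {\<omega>\<in>A. \<not> quiet (fst (snd \<omega>)) z (\<tau> \<omega>) \<delta>} = ennreal (1 - exp (-\<delta>)) * emeasure (glauber_measure k) A"
proof -
  interpret prob_space "glauber_measure k" by (rule prob_space_glauber_measure)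
  have Asp: "\<omega> \<in> space (glauber_measure k)" if "\<omega> \<in> A" for \<omega>
    using that sets.sets_into_space[OF A] by blast
  have "{\<omega>\<in>A. quiet (fst (snd \<omega>)) z (\<tau> \<omega>) \<delta>} = {\<omega>\<in>space (glauber_measure k). \<omega> \<in> A \<and> quiet (fst (snd \<omega>)) z (\<tau> \<omega>) \<delta>}"
    using Asp by auto
  then have q: "{\<omega>\<in>A. quiet (fst (snd \<omega>)) z (\<tau> \<omega>) \<delta>} \<in> sets (glauber_measure k)"
    using z by simp
  have "{\<omega>\<in>A. \<not> quiet (fst (snd \<omega>)) z (\<tau> \<omega>) \<delta>} = A - {\<omega>\<in>A. quiet (fst (snd \<omega>)) z (\<tau> \<omega>) \<delta>}" by blast
  then have "emeasure (glauber_measure k) {\<omega>\<in>A. \<not> quiet (fst (snd \<omega>)) z (\<tau> \<omega>) \<delta>}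
      = emeasure (glauber_measure k) A - ennreal (exp (-\<delta>)) * emeasure (glauber_measure k) A"
    using emeasure_Diff[OF _ A q] by (subst emeasure_quiet[OF z A tau \<delta> tau0 inv, symmetric]) auto
  also have "\<dots> = ennreal (1 - exp (-\<delta>)) * emeasure (glauber_measure k) A"
    using \<delta> by (simp add: emeasure_eq_measure ennreal_mult'[symmetric] ennreal_minus left_diff_distrib)
  finally show ?thesis .
qed

text \<open>Walks are listed backwards: the last entry is the starting point.\<close>

primrec walks :: "('a \<Rightarrow> 'a set) \<Rightarrow> nat \<Rightarrow> 'a \<Rightarrow> 'a list set" where
  "walks nb 0 x = {[x]}"
| "walks nb (Suc m) x = (\<Union>xs\<in>walks nb m x. (\<lambda>y. y # xs) ` nb (hd xs))"

lemma finite_walks: "(\<And>x. finite (nb x)) \<Longrightarrow> finite (walks nb m x)"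
  by (induction m) auto

lemma card_walks:
  assumes "\<And>x. finite (nb x)" "\<And>x. card (nb x) \<le> D"
  shows "card (walks nb m x) \<le> D ^ m"
proof (induction m)
  case (Suc m)
  have "card (walks nb (Suc m) x) \<le> (\<Sum>xs\<in>walks nb m x. card ((\<lambda>y. y # xs) ` nb (hd xs)))"
    using finite_walks[of nb m x] assms(1) by (simp add: card_UN_le)
  also have "\<dots> \<le> (\<Sum>xs\<in>walks nb m x. D)"
    using assms card_image_le order_trans by (intro sum_mono) blast
  also have "\<dots> \<le> D ^ Suc m" using Suc by (simp add: mult.commute)
  finally show ?case .
qed simp

lemma walks_length: "xs \<in> walks nb m x \<Longrightarrow> length xs = Suc m"
  by (induction m arbitrary: xs) auto

lemma walks_subset:
  assumes "xs \<in> walks nb m x" "x \<in> S" "\<And>y. nb y \<subseteq> S"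
  shows "set xs \<subseteq> S"
  using assms(1)
proof (induction m arbitrary: xs)
  case (Suc m)
  then obtain ys y where xs: "xs = y # ys" "ys \<in> walks nb m x" "y \<in> nb (hd ys)" by auto
  then show ?case using Suc.IH[OF xs(2)] assms(3) by auto
qed (use assms in auto)

lemma walks_drop: "xs \<in> walks nb m x \<Longrightarrow> i \<le> m \<Longrightarrow> drop i xs \<in> walks nb (m - i) x"
proof (induction m arbitrary: xs i)
  case (Suc m)
  then obtain ys y where xs: "xs = y # ys" "ys \<in> walks nb m x" by auto
  then show ?case using Suc by (cases i) auto
qed auto

text \<open>Loop erasure: whenever the path returns to a listed site, the loop is cut off. A path
  with infinitely many sites reaches one that no walk of fewer than m steps can reach; the
  loop-erased walk to it has at least m steps and is shortened to m.\<close>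

lemma distinct_walk_of_infinite_walk:
  assumes step: "\<And>i. y (Suc i) \<in> insert (y i) (nb (y i))" and fin: "\<And>x. finite (nb x)"
    and inf: "infinite (range y)"
  shows "\<exists>xs\<in>walks nb m (y (0::nat)). distinct xs \<and> set xs \<subseteq> range y"
proof -
  have *: "\<exists>m. \<exists>xs\<in>walks nb m (y 0). distinct xs \<and> set xs \<subseteq> range y \<and> hd xs = y n" for n
  proof (induction n)
    case 0
    show ?case by (rule exI[of _ 0]) auto
  next
    case (Suc n)
    then obtain m xs where xs: "xs \<in> walks nb m (y 0)" "distinct xs" "set xs \<subseteq> range y" "hd xs = y n" by blast
    show ?case
    proof (cases "y (Suc n) \<in> set xs")
      case True
      then obtain i where i: "i < length xs" "xs ! i = y (Suc n)" by (auto simp: in_set_conv_nth)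
      then have "drop i xs \<in> walks nb (m - i) (y 0)"
        using walks_drop[OF xs(1)] walks_length[OF xs(1)] by simp
      then show ?thesis using xs i hd_drop_conv_nth[OF i(1)] set_drop_subset[of i xs]
        by (intro exI[of _ "m - i"] bexI[of _ "drop i xs"]) auto
    next
      case False
      moreover have "hd xs \<in> set xs" using walks_length[OF xs(1)] by (intro hd_in_set) auto
      ultimately have "y (Suc n) \<in> nb (hd xs)" using step[of n] xs by auto
      then have "y (Suc n) # xs \<in> walks nb (Suc m) (y 0)"
        unfolding walks.simps(2) using xs(1) by (intro UN_I[of xs] imageI)
      then show ?thesis using xs False by (intro exI[of _ "Suc m"] bexI[of _ "y (Suc n) # xs"]) auto
    qed
  qed
  have "finite (\<Union>j<m. hd ` walks nb j (y 0))" using finite_walks[of nb] fin by auto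
  then have "\<not> range y \<subseteq> (\<Union>j<m. hd ` walks nb j (y 0))" using inf finite_subset by blast
  then obtain n where n: "y n \<notin> (\<Union>j<m. hd ` walks nb j (y 0))" by blast
  obtain m' xs where xs: "xs \<in> walks nb m' (y 0)" "distinct xs" "set xs \<subseteq> range y" "hd xs = y n"
    using * by blast
  have "m \<le> m'" using n xs by (metis UN_I image_eqI lessThan_iff not_le)
  \<comment> \<open>Walks are listed backwards, so dropping from the front keeps the first m steps
    from the starting point.\<close>
  then have "drop (m' - m) xs \<in> walks nb m (y 0)" using walks_drop[OF xs(1), of "m' - m"] by simp
  then show ?thesis using xs set_drop_subset[of "m' - m" xs] by (intro bexI[of _ "drop (m' - m) xs"]) auto
qed

section \<open>Chains of ringing neighbours in a short time slot\<close>

lemma card_neighbours: "card (neighbours k b u) \<le> 9 * k"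
proof -
  obtain x y z where u: "u = (x, y, z)" by (metis prod_cases3)
  have "neighbours k b u \<subseteq> {x-1..x+1} \<times> {y-1..y+1} \<times> {0..<int k}"
    unfolding neighbours_def slab_def u edge_mult_def by (auto split: if_splits)
  from card_mono[OF _ this] show ?thesis by (simp add: card_cartesian_product)
qed

text \<open>Chosen so that \<open>9 * k\<close>, the bound on the number of neighbours, times the
  probability of a ring within one slot is at most 1/2. This makes the union bound over walks
  summable in their length.\<close>

definition slot_length :: "nat \<Rightarrow> real" where
  "slot_length k = 1 / (2 * real (9 * k + 1))"

lemma slot_length_pos: "slot_length k > 0"
  by (simp add: slot_length_def)

text \<open>From some length on, no self-avoiding walk from x can have all its sites ringing during
  the j-th slot. This is the subcritical percolation behind Harris's graphical construction.\<close>

definition sparse_slot :: "nat \<Rightarrow> boundary \<Rightarrow> (site \<times> nat \<Rightarrow> real) \<Rightarrow> site \<Rightarrow> nat \<Rightarrow> bool" where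
  "sparse_slot k b w x j \<longleftrightarrow> (\<exists>m. \<forall>xs\<in>walks (neighbours k b) m x. distinct xs \<longrightarrow>
     (\<exists>y\<in>set xs. quiet w y (real j * slot_length k) (slot_length k)))"

lemma emeasure_all_ringing:
  assumes Y: "finite Y" "Y \<subseteq> slab k" and a: "a \<ge> 0" and \<delta>: "\<delta> \<ge> 0"
  shows "emeasure (glauber_measure k) {\<omega>\<in>space (glauber_measure k). \<forall>y\<in>Y. \<not> quiet (fst (snd \<omega>)) y a \<delta>}
    = ennreal (1 - exp (-\<delta>)) ^ card Y"
  using Y
proof (induction Y rule: finite_induct)
  case empty
  interpret prob_space "glauber_measure k" by (rule prob_space_glauber_measure)
  show ?case by (simp add: emeasure_space_1)
next
  case (insert z Y)
  let ?A = "{\<omega>\<in>space (glauber_measure k). \<forall>y\<in>Y. \<not> quiet (fst (snd \<omega>)) y a \<delta>}"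
  have z: "z \<in> slab k" using insert by simp
  have A: "?A \<in> sets (glauber_measure k)"
    using insert by (intro sets.sets_Collect_finite_All' measurable) auto
  have "{\<omega>\<in>space (glauber_measure k). \<forall>y\<in>insert z Y. \<not> quiet (fst (snd \<omega>)) y a \<delta>}
      = {\<omega>\<in>?A. \<not> quiet (fst (snd \<omega>)) z ((\<lambda>_. a) \<omega>) \<delta>}" by auto
  also have "emeasure (glauber_measure k) \<dots> = ennreal (1 - exp (-\<delta>)) * emeasure (glauber_measure k) ?A"
  proof (rule emeasure_not_quiet[OF z A _ \<delta>])
    fix s w c m u assume A: "(s, w, c) \<in> ?A"
    have "(s, w((z, m) := u), c) \<in> space (glauber_measure k)"
      using A z by (auto simp: space_glauber_measure PiE_iff extensional_def)
    moreover have "quiet (w((z, m) := u)) y a \<delta> = quiet w y a \<delta>" if "y \<in> Y" for y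
      using that insert by (intro quiet_upd_other) auto
    ultimately show "(s, w((z, m) := u), c) \<in> ?A \<and> a = a" using A by auto
  qed (use a in auto)
  finally show ?case using insert by simp
qed

text \<open>Distinct sites ring independently, so a given self-avoiding walk with m steps rings at
  all its sites with probability q^(m+1), and there are at most (9k)^m such walks. These bounds sum
  over m, and Borel-Cantelli leaves some m without any such walk.\<close>

lemma AE_sparse_slot:
  assumes x: "x \<in> slab k"
  shows "AE \<omega> in glauber_measure k. sparse_slot k b (fst (snd \<omega>)) x j"
proof -
  interpret prob_space "glauber_measure k" by (rule prob_space_glauber_measure)
  let ?\<delta> = "slot_length k" and ?nb = "neighbours k b"
  define q where "q = 1 - exp (- ?\<delta>)"
  have q: "0 \<le> q" "real (9 * k) * q \<le> 1/2" "q \<le> 1"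
  proof -
    show "0 \<le> q" "q \<le> 1" using slot_length_pos[of k] by (auto simp: q_def)
    have "q \<le> ?\<delta>" using exp_ge_add_one_self[of "- ?\<delta>"] by (simp add: q_def)
    then have "real (9 * k) * q \<le> real (9 * k) * ?\<delta>" by (intro mult_left_mono) auto
    also have "\<dots> \<le> 1/2" by (simp add: slot_length_def field_simps)
    finally show "real (9 * k) * q \<le> 1/2" .
  qed
  define E where "E xs = {\<omega>\<in>space (glauber_measure k). \<forall>y\<in>set xs. \<not> quiet (fst (snd \<omega>)) y (real j * ?\<delta>) ?\<delta>}" for xs
  define B where "B m = (\<Union>xs\<in>{xs\<in>walks ?nb m x. distinct xs}. E xs)" for m
  have fin: "finite {xs\<in>walks ?nb m x. distinct xs}" for m
    using finite_walks[OF finite_neighbours] by simp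
  have sub: "set xs \<subseteq> slab k" if "xs \<in> walks ?nb m x" for xs m
    using walks_subset[OF that x neighbours_slab] .
  have E_sets: "E xs \<in> events" if "xs \<in> walks ?nb m x" for xs m
    unfolding E_def using sub[OF that] by (intro sets.sets_Collect_finite_All' measurable) auto
  have B_sets: "B m \<in> events" for m
    unfolding B_def using E_sets fin by (intro sets.finite_UN) auto
  have "emeasure (glauber_measure k) (B m) \<le> ennreal ((1/2) ^ m)" for m
  proof -
    have "emeasure (glauber_measure k) (B m) \<le> (\<Sum>xs\<in>{xs\<in>walks ?nb m x. distinct xs}. emeasure (glauber_measure k) (E xs))"
      unfolding B_def using E_sets fin by (intro emeasure_subadditive_finite) auto
    also have "\<dots> = (\<Sum>xs\<in>{xs\<in>walks ?nb m x. distinct xs}. ennreal q ^ Suc m)"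
    proof (intro sum.cong refl)
      fix xs assume xs: "xs \<in> {xs\<in>walks ?nb m x. distinct xs}"
      then have "card (set xs) = Suc m" using walks_length[of xs ?nb m x] by (simp add: distinct_card)
      with xs show "emeasure (glauber_measure k) (E xs) = ennreal q ^ Suc m"
        unfolding E_def q_def using sub[of xs m] slot_length_pos[of k]
        by (subst emeasure_all_ringing) auto
    qed
    also have "\<dots> = ennreal (real (card {xs\<in>walks ?nb m x. distinct xs}) * q ^ Suc m)"
      using q by (simp add: ennreal_power ennreal_mult' ennreal_of_nat_eq_real_of_nat del: power_Suc)
    also have "\<dots> \<le> ennreal ((1/2) ^ m)"
    proof (rule ennreal_leI)
      have "card {xs\<in>walks ?nb m x. distinct xs} \<le> card (walks ?nb m x)"
        using finite_walks[OF finite_neighbours] by (intro card_mono) auto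
      also have "\<dots> \<le> (9 * k) ^ m" by (rule card_walks[OF finite_neighbours card_neighbours])
      finally have "real (card {xs\<in>walks ?nb m x. distinct xs}) \<le> real ((9 * k) ^ m)"
        by (rule of_nat_mono)
      then have "real (card {xs\<in>walks ?nb m x. distinct xs}) \<le> real (9 * k) ^ m"
        by (simp only: of_nat_power)
      then have "real (card {xs\<in>walks ?nb m x. distinct xs}) * q ^ Suc m \<le> real (9 * k) ^ m * q ^ m"
        using q by (intro mult_mono) (auto intro: mult_left_le_one_le)
      also have "\<dots> = (real (9 * k) * q) ^ m" by (simp add: power_mult_distrib)
      also have "\<dots> \<le> (1/2) ^ m" using q by (intro power_mono) auto
      finally show "real (card {xs\<in>walks ?nb m x. distinct xs}) * q ^ Suc m \<le> (1/2) ^ m" .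
    qed
    finally show ?thesis .
  qed
  then have "(\<Sum>m. emeasure (glauber_measure k) (B m)) \<le> (\<Sum>m. ennreal ((1/2) ^ m))"
    by (intro suminf_le) auto
  also have "\<dots> = ennreal 2"
    using geometric_sums[of "1/2::real"] by (intro suminf_ennreal_eq) auto
  finally have "AE \<omega> in glauber_measure k. finite {m. \<omega> \<in> B m}"
    by (intro AE_finite_of_suminf B_sets) (auto intro: le_less_trans)
  then show ?thesis using AE_space
  proof eventually_elim
    case (elim \<omega>)
    then obtain m where "\<omega> \<notin> B m" by (metis (mono_tags, lifting) UNIV_eq_I infinite_UNIV_nat mem_Collect_eq)
    then show ?case using elim unfolding sparse_slot_def B_def E_def by (intro exI[of _ m]) auto
  qed
qed

context slab_dynamics
begin

text \<open>Ring times decrease along an infinite descending chain, so it eventually stays in one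
  slot. On finitely many sites it would use infinitely many rings in bounded time; on infinitely
  many sites, loop erasure would give walks of every length that ring throughout the slot.\<close>

lemma wf_influenceI:
  assumes clocks: "\<And>x. x \<in> slab k \<Longrightarrow> regular_clock w x"
    and sparse: "\<And>x j. x \<in> slab k \<Longrightarrow> sparse_slot k b w x j"
  shows "wf (influence w)"
  unfolding wf_iff_no_infinite_down_chain
proof
  assume "\<exists>f. \<forall>i. (f (Suc i), f i) \<in> influence w"
  then obtain f where f: "\<And>i. (f (Suc i), f i) \<in> influence w" by blast
  define y where "y i = fst (f i)" for i
  define t where "t i = ring_time w (y i) (snd (f i))" for i
  let ?\<delta> = "slot_length k"
  have \<delta>: "?\<delta> > 0" by (rule slot_length_pos)
  have ys: "y i \<in> slab k" and step: "y (Suc i) \<in> insert (y i) (neighbours k b (y i))" and dec: "t (Suc i) < t i" for i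
    using f[of i] unfolding influence_def y_def t_def by (auto simp: split_beta)
  have tpos: "t i > 0" for i
    unfolding t_def using clocks[OF ys] by (intro ring_time_pos) (simp add: regular_clock_def)
  have dec': "t j < t i" if "i < j" for i j
    using that by (rule strict_monoD[of "\<lambda>i. - t i", simplified, rotated]) (simp add: strict_mono_Suc_iff dec)
  \<comment> \<open>Slots are open on the left and closed on the right, as in \<open>quiet\<close>;
    hence the ceiling minus one.\<close>
  define J where "J i = nat (\<lceil>t i / ?\<delta>\<rceil> - 1)" for i
  have slot: "real (J i) * ?\<delta> < t i" "t i \<le> real (J i) * ?\<delta> + ?\<delta>" for i
  proof -
    have "0 < t i / ?\<delta>" using tpos \<delta> by simp
    then have "0 < \<lceil>t i / ?\<delta>\<rceil>" by simp
    then have "real (J i) = of_int \<lceil>t i / ?\<delta>\<rceil> - 1" by (simp add: J_def of_nat_nat)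
    then have "real (J i) < t i / ?\<delta>" "t i / ?\<delta> \<le> real (J i) + 1" by linarith+
    then show "real (J i) * ?\<delta> < t i" "t i \<le> real (J i) * ?\<delta> + ?\<delta>" using \<delta> by (simp_all add: field_simps)
  qed
  have Jdec: "J j \<le> J i" if "i \<le> j" for i j
  proof (cases "i = j")
    case False
    then have "t j / ?\<delta> \<le> t i / ?\<delta>" using dec'[of i j] that \<delta> by (simp add: divide_right_mono)
    then have "\<lceil>t j / ?\<delta>\<rceil> \<le> \<lceil>t i / ?\<delta>\<rceil>" by (rule ceiling_mono)
    then show ?thesis by (simp add: J_def)
  qed simp
  \<comment> \<open>A nonincreasing sequence of naturals is constant from the place where it attains
    its minimum.\<close>
  obtain I where I: "\<And>i. J I \<le> J i" using ex_has_least_nat[of "\<lambda>_. True" _ J] by blast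
  have JI: "J (I + i) = J I" for i using I[of "I + i"] Jdec[of I "I + i"] by simp
  define y' where "y' i = y (I + i)" for i
  have nq: "\<not> quiet w (y' i) (real (J I) * ?\<delta>) ?\<delta>" for i
    using slot[of "I + i"] unfolding JI quiet_def y'_def t_def by auto
  show False
  proof (cases "finite (range y')")
    case True
    have "finite (Sigma (range y') (\<lambda>x. {n. ring_time w x n < t I + 1}))"
    proof (intro finite_SigmaI True)
      fix a assume "a \<in> range y'"
      then have "a \<in> slab k" using ys unfolding y'_def by blast
      then show "finite {n. ring_time w a n < t I + 1}" using clocks by (simp add: regular_clock_def)
    qed
    moreover have "range (\<lambda>i. f (I + i)) \<subseteq> Sigma (range y') (\<lambda>x. {n. ring_time w x n < t I + 1})"
    proof (rule image_subsetI)
      fix i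
      have "t (I + i) \<le> t I" using dec'[of I "I + i"] by (cases "i = 0") auto
      moreover obtain x n where xn: "f (I + i) = (x, n)" by (rule prod.exhaust)
      moreover have "x = y' i" "ring_time w x n = t (I + i)" using xn by (simp_all add: y'_def y_def t_def)
      ultimately show "f (I + i) \<in> Sigma (range y') (\<lambda>x. {n. ring_time w x n < t I + 1})"
        by (simp only: mem_Sigma_iff) simp
    qed
    ultimately have "finite (range (\<lambda>i. f (I + i)))" by (rule finite_subset[rotated])
    moreover have "inj (\<lambda>i. f (I + i))"
    proof (rule injI)
      fix i j assume "f (I + i) = f (I + j)"
      then have "t (I + i) = t (I + j)" by (simp add: t_def y_def)
      then show "i = j" using dec'[of "I + i" "I + j"] dec'[of "I + j" "I + i"] by (cases i j rule: linorder_cases) auto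
    qed
    ultimately show False using finite_imageD infinite_UNIV_nat by blast
  next
    case False
    obtain m where m: "\<And>xs. xs \<in> walks (neighbours k b) m (y' 0) \<Longrightarrow> distinct xs \<Longrightarrow>
        \<exists>y\<in>set xs. quiet w y (real (J I) * ?\<delta>) ?\<delta>"
      using sparse[of "y' 0" "J I"] ys unfolding sparse_slot_def y'_def by blast
    obtain xs where "xs \<in> walks (neighbours k b) m (y' 0)" "distinct xs" "set xs \<subseteq> range y'"
      using distinct_walk_of_infinite_walk[of y' "neighbours k b" m, OF _ finite_neighbours False] step
      unfolding y'_def by auto
    then show False using m nq by blast
  qed
qed

lemma AE_good_sample:
  "AE \<omega> in glauber_measure k. good_sample k b (fst \<omega>) (fst (snd \<omega>)) (snd (snd \<omega>))"
proof -
  have spin0: "emeasure spin_measure (- {-1, 1}) = 0"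
    by (simp add: spin_measure_def emeasure_pmf_of_set)
  have spin: "AE \<omega> in glauber_measure k. fst \<omega> x \<in> {-1, 1}" if x: "x \<in> slab k" for x
  proof -
    note [measurable] = x
    let ?S = "{\<omega>\<in>space (glauber_measure k). \<not> fst \<omega> x \<in> {-1, 1}}"
    have m: "?S \<in> sets (glauber_measure k)"
      using measurable_sets[OF measurable_initial[OF x], of "- {-1, 1}"]
      by (simp add: vimage_def Int_def conj_commute)
    have "emeasure spin_measure {u \<in> space spin_measure. (case \<omega> of (s, w, c) \<Rightarrow> \<lambda>u. (s(x := u), w, c)) u \<in> ?S} = 0" for \<omega> :: sample
      by (rule emeasure_eq_0[OF _ spin0]) (auto simp: case_prod_beta' spin_measure_def)
    then have "emeasure (glauber_measure k) ?S = 0"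
      unfolding emeasure_resampling[OF resampling_initial[OF x] m sigma_finite_factors(6)]
      by (simp only: nn_integral_const mult_zero_left)
    then show ?thesis by (subst AE_iff_measurable[OF m]) auto
  qed
  have coin: "AE \<omega> in glauber_measure k. snd (snd \<omega>) (x, n) \<in> {-1, 1}" if x: "x \<in> slab k" for x n
  proof -
    note [measurable] = x
    let ?S = "{\<omega>\<in>space (glauber_measure k). \<not> snd (snd \<omega>) (x, n) \<in> {-1, 1}}"
    have m: "?S \<in> sets (glauber_measure k)"
      using measurable_sets[OF measurable_coin[OF x], of "- {-1, 1}"]
      by (simp add: vimage_def Int_def conj_commute)
    have "emeasure spin_measure {u \<in> space spin_measure. (case \<omega> of (s, w, c) \<Rightarrow> \<lambda>u. (s, w, c((x, n) := u))) u \<in> ?S} = 0" for \<omega> :: sample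
      by (rule emeasure_eq_0[OF _ spin0]) (auto simp: case_prod_beta' spin_measure_def)
    then have "emeasure (glauber_measure k) ?S = 0"
      unfolding emeasure_resampling[OF resampling_coin[OF x, of n] m sigma_finite_factors(6)]
      by (simp only: nn_integral_const mult_zero_left)
    then show ?thesis by (subst AE_iff_measurable[OF m]) auto
  qed
  have "AE \<omega> in glauber_measure k. (\<forall>x\<in>slab k. regular_clock (fst (snd \<omega>)) x)"
    by (intro AE_ball_countable' countable_slab AE_regular_clock)
  moreover have "AE \<omega> in glauber_measure k. \<forall>x\<in>slab k. \<forall>j. sparse_slot k b (fst (snd \<omega>)) x j"
    by (intro AE_ball_countable' countable_slab AE_all_countable[THEN iffD2] allI AE_sparse_slot)
  moreover have "AE \<omega> in glauber_measure k. \<forall>x\<in>slab k. \<forall>y\<in>slab k. x \<noteq> y \<longrightarrow> (\<forall>n m. ring_time (fst (snd \<omega>)) x n \<noteq> ring_time (fst (snd \<omega>)) y m)"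
    by (intro AE_ball_countable' countable_slab AE_impI AE_all_countable[THEN iffD2] allI AE_distinct_rings)
  moreover have "AE \<omega> in glauber_measure k. \<forall>x\<in>slab k. fst \<omega> x \<in> {-1, 1}"
    by (intro AE_ball_countable' countable_slab spin)
  moreover have "AE \<omega> in glauber_measure k. \<forall>x\<in>slab k. \<forall>n. snd (snd \<omega>) (x, n) \<in> {-1, 1}"
    by (intro AE_ball_countable' countable_slab AE_all_countable[THEN iffD2] allI coin)
  ultimately show ?thesis
    by eventually_elim (unfold_locales; use wf_influenceI in blast)
qed

end

section \<open>Finitely many lowering flips\<close>

lemma measurable_count_space_op2:
  fixes f :: "'a \<Rightarrow> 'b::countable" and g :: "'a \<Rightarrow> 'c::countable"
  assumes [measurable]: "f \<in> M \<rightarrow>\<^sub>M count_space UNIV" "g \<in> M \<rightarrow>\<^sub>M count_space UNIV"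
  shows "(\<lambda>\<omega>. h (f \<omega>) (g \<omega>)) \<in> M \<rightarrow>\<^sub>M count_space UNIV"
proof -
  have "(\<lambda>\<omega>. h i (g \<omega>)) \<in> M \<rightarrow>\<^sub>M count_space UNIV" for i by measurable
  from measurable_compose_countable[of "\<lambda>i \<omega>. h i (g \<omega>)", OF this assms(1)] show ?thesis .
qed

lemma measurable_count_space_sum:
  fixes f :: "'i \<Rightarrow> 'a \<Rightarrow> int"
  assumes "finite S" "\<And>i. i \<in> S \<Longrightarrow> f i \<in> M \<rightarrow>\<^sub>M count_space UNIV"
  shows "(\<lambda>\<omega>. \<Sum>i\<in>S. f i \<omega>) \<in> M \<rightarrow>\<^sub>M count_space UNIV"
  using assms
proof (induction S rule: finite_induct)
  case (insert i S)
  then show ?case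
    using measurable_count_space_op2[of "f i" M "\<lambda>\<omega>. \<Sum>i\<in>S. f i \<omega>" "(+)"] by simp
qed simp

lemma measurable_energy:
  assumes x: "x \<in> slab k" and f: "\<And>y. y \<in> slab k \<Longrightarrow> (\<lambda>\<omega>. \<eta> \<omega> y) \<in> M \<rightarrow>\<^sub>M count_space UNIV"
  shows "(\<lambda>\<omega>. energy k b (\<eta> \<omega>) x) \<in> M \<rightarrow>\<^sub>M count_space UNIV"
proof -
  have "(\<lambda>\<omega>. int (edge_mult k b x v) * (\<eta> \<omega> x * \<eta> \<omega> v)) \<in> M \<rightarrow>\<^sub>M count_space UNIV" if "v \<in> neighbours k b x" for v
    using measurable_count_space_op2[of "\<lambda>\<omega>. \<eta> \<omega> x" M "\<lambda>\<omega>. \<eta> \<omega> v" "\<lambda>p q. int (edge_mult k b x v) * (p * q)"]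
      f x that neighbours_slab by blast
  from measurable_count_space_sum[OF finite_neighbours this]
  have "(\<lambda>\<omega>. \<Sum>v\<in>neighbours k b x. int (edge_mult k b x v) * (\<eta> \<omega> x * \<eta> \<omega> v)) \<in> M \<rightarrow>\<^sub>M count_space UNIV" by simp
  then show ?thesis
    unfolding energy_def by (rule measurable_compose) simp
qed

lemma
  assumes x: "x \<in> slab k" and [measurable]: "\<tau> \<in> borel_measurable (glauber_measure k)"
  shows measurable_rings_before[measurable]:
      "(\<lambda>\<omega>. rings_before (fst (snd \<omega>)) x (\<tau> \<omega>)) \<in> glauber_measure k \<rightarrow>\<^sub>M count_space UNIV"
    and measurable_rings_upto[measurable]:
      "(\<lambda>\<omega>. rings_upto (fst (snd \<omega>)) x (\<tau> \<omega>)) \<in> glauber_measure k \<rightarrow>\<^sub>M count_space UNIV"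
proof -
  note [measurable] = x
  show "(\<lambda>\<omega>. rings_before (fst (snd \<omega>)) x (\<tau> \<omega>)) \<in> glauber_measure k \<rightarrow>\<^sub>M count_space UNIV"
    unfolding rings_before_def by (rule measurable_card) measurable
  show "(\<lambda>\<omega>. rings_upto (fst (snd \<omega>)) x (\<tau> \<omega>)) \<in> glauber_measure k \<rightarrow>\<^sub>M count_space UNIV"
    unfolding rings_upto_def by (rule measurable_card) measurable
qed

section \<open>Invariance of the sample under horizontal translations\<close>

definition shift :: "int \<times> int \<Rightarrow> site \<Rightarrow> site" where
  "shift p u = (fst u + fst p, fst (snd u) + snd p, snd (snd u))"

lemma shift_in_slab: "shift p u \<in> slab k \<longleftrightarrow> u \<in> slab k"
  by (cases u) (simp add: shift_def slab_def)

lemma inj_shift: "inj (shift p)"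
  by (rule injI) (simp add: shift_def prod_eq_iff)

lemma edge_mult_shift: "edge_mult k b (shift p u) (shift p v) = edge_mult k b u v"
  by (cases u; cases v) (simp add: edge_mult_def shift_def)

lemma neighbours_shift: "neighbours k b (shift p u) = shift p ` neighbours k b u"
proof -
  have "v \<in> shift p ` neighbours k b u" if "v \<in> neighbours k b (shift p u)" for v
  proof -
    have v: "v = shift p (shift (- fst p, - snd p) v)" by (simp add: shift_def)
    then have "shift (- fst p, - snd p) v \<in> neighbours k b u"
      using that edge_mult_shift[of k b p u "shift (- fst p, - snd p) v"]
      by (simp add: neighbours_def shift_in_slab)
    then show ?thesis using v by blast
  qed
  then show ?thesis by (auto simp: neighbours_def shift_in_slab edge_mult_shift)
qed

lemma energy_shift: "energy k b \<eta> (shift p u) = energy k b (\<lambda>v. \<eta> (shift p v)) u"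
  unfolding energy_def neighbours_shift
  by (subst sum.reindex[OF inj_on_subset[OF inj_shift subset_UNIV]]) (simp add: edge_mult_shift)

text \<open>The restrictions keep the components inside their product spaces, whose points are
  undefined off the index set.\<close>

definition shift_sample :: "nat \<Rightarrow> int \<times> int \<Rightarrow> sample \<Rightarrow> sample" where
  "shift_sample k p = (\<lambda>(s, w, c). (\<lambda>x\<in>slab k. s (shift p x),
     \<lambda>i\<in>slab k \<times> UNIV. w (shift p (fst i), snd i), \<lambda>i\<in>slab k \<times> UNIV. c (shift p (fst i), snd i)))"

lemma
  shows distr_shift_sample: "distr (glauber_measure k) (glauber_measure k) (shift_sample k p) = glauber_measure k"
    and measurable_shift_sample: "shift_sample k p \<in> glauber_measure k \<rightarrow>\<^sub>M glauber_measure k"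
proof -
  let ?f = "\<lambda>s. \<lambda>x\<in>slab k. s (shift p x)"
  let ?g = "\<lambda>w. \<lambda>i\<in>slab k \<times> (UNIV::nat set). w (shift p (fst i), snd i)"
  have f: "?f \<in> initial_measure k \<rightarrow>\<^sub>M initial_measure k"
    by (intro measurable_restrict measurable_component_singleton) (simp add: shift_in_slab)
  have g: "?g \<in> clock_measure k \<rightarrow>\<^sub>M clock_measure k"
    by (intro measurable_restrict measurable_component_singleton) (auto simp: shift_in_slab)
  have h: "?g \<in> coin_measure k \<rightarrow>\<^sub>M coin_measure k"
    by (intro measurable_restrict measurable_component_singleton) (auto simp: shift_in_slab)
  have inj: "inj_on (shift p) (slab k)" "inj_on (\<lambda>i::site \<times> nat. (shift p (fst i), snd i)) (slab k \<times> UNIV)"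
    by (rule inj_on_subset[OF inj_shift subset_UNIV], rule inj_onI) (metis injD[OF inj_shift] prod.collapse prod.inject)
  have df: "distr (initial_measure k) (initial_measure k) ?f = initial_measure k"
    using distr_PiM_reindex[of "slab k" "\<lambda>_. spin_measure" "shift p" "slab k", OF prob_space_spin_measure inj(1)]
    by (simp add: shift_in_slab Pi_iff)
  have dg: "distr (clock_measure k) (clock_measure k) ?g = clock_measure k"
    using distr_PiM_reindex[of "slab k \<times> UNIV" "\<lambda>_. exp_measure" "\<lambda>i. (shift p (fst i), snd i)" "slab k \<times> UNIV", OF prob_space_exp_measure inj(2)]
    by (simp add: shift_in_slab Pi_iff)
  have dh: "distr (coin_measure k) (coin_measure k) ?g = coin_measure k"
    using distr_PiM_reindex[of "slab k \<times> UNIV" "\<lambda>_. spin_measure" "\<lambda>i. (shift p (fst i), snd i)" "slab k \<times> UNIV", OF prob_space_spin_measure inj(2)]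
    by (simp add: shift_in_slab Pi_iff)
  have gh: "distr (clock_measure k \<Otimes>\<^sub>M coin_measure k) (clock_measure k \<Otimes>\<^sub>M coin_measure k) (\<lambda>(w, c). (?g w, ?g c)) = clock_measure k \<Otimes>\<^sub>M coin_measure k"
    using pair_measure_distr[OF g h] sigma_finite_factors(3)[of k] by (simp add: dg dh)
  have gh': "(\<lambda>(w, c). (?g w, ?g c)) \<in> clock_measure k \<Otimes>\<^sub>M coin_measure k \<rightarrow>\<^sub>M clock_measure k \<Otimes>\<^sub>M coin_measure k"
    using g h by measurable
  have "(\<lambda>(s, wc). (?f s, (\<lambda>(w, c). (?g w, ?g c)) wc)) = shift_sample k p"
    by (simp add: shift_sample_def fun_eq_iff)
  with pair_measure_distr[OF f gh'] sigma_finite_factors(4)[of k] gh df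
  show "distr (glauber_measure k) (glauber_measure k) (shift_sample k p) = glauber_measure k"
    by (simp add: glauber_measure_def)
  have "(\<lambda>(s, wc). (?f s, (\<lambda>(w, c). (?g w, ?g c)) wc)) \<in> glauber_measure k \<rightarrow>\<^sub>M glauber_measure k"
    unfolding glauber_measure_def using f gh' by measurable
  then show "shift_sample k p \<in> glauber_measure k \<rightarrow>\<^sub>M glauber_measure k"
    using \<open>(\<lambda>(s, wc). (?f s, (\<lambda>(w, c). (?g w, ?g c)) wc)) = shift_sample k p\<close> by simp
qed

lemma emeasure_shift_sample:
  assumes "E \<in> sets (glauber_measure k)"
  shows "emeasure (glauber_measure k) {\<omega>\<in>space (glauber_measure k). shift_sample k p \<omega> \<in> E} = emeasure (glauber_measure k) E"
proof -
  have "emeasure (glauber_measure k) E = emeasure (distr (glauber_measure k) (glauber_measure k) (shift_sample k p)) E"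
    by (simp add: distr_shift_sample)
  also have "\<dots> = emeasure (glauber_measure k) {\<omega>\<in>space (glauber_measure k). shift_sample k p \<omega> \<in> E}"
    using assms by (subst emeasure_distr[OF measurable_shift_sample]) (auto intro!: arg_cong[where f = "emeasure (glauber_measure k)"])
  finally show ?thesis by simp
qed

section \<open>The effect of one flip on the energy\<close>

lemma edge_mult_sym: "edge_mult k b u v = edge_mult k b v u"
proof -
  have "l1_dist u v = l1_dist v u" by (cases u; cases v) (simp add: abs_minus_commute)
  moreover have "wrap_edge k u v = wrap_edge k v u" by (cases u; cases v) (auto simp: insert_commute)
  ultimately show ?thesis by (simp add: edge_mult_def)
qed

lemma edge_mult_self: "k \<ge> 2 \<Longrightarrow> edge_mult k b u u = 0"
  by (cases u) (auto simp: edge_mult_def)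

lemma edge_mult_le_2: "edge_mult k b u v \<le> 2"
  by (simp add: edge_mult_def)

lemma sum_edge_mult_le: "(\<Sum>v\<in>neighbours k b u. int (edge_mult k b u v)) \<le> 18 * int k"
proof -
  have "(\<Sum>v\<in>neighbours k b u. int (edge_mult k b u v)) \<le> (\<Sum>v\<in>neighbours k b u. 2)"
    using edge_mult_le_2 by (intro sum_mono) (metis of_nat_le_iff of_nat_numeral)
  also have "\<dots> \<le> 18 * int k" using card_neighbours[of k b u] by simp
  finally show ?thesis .
qed

lemma abs_energy_le:
  assumes "\<And>v. v \<in> insert u (neighbours k b u) \<Longrightarrow> \<eta> v \<in> {-1, 1}"
  shows "\<bar>energy k b \<eta> u\<bar> \<le> 18 * int k"
proof -
  have "\<bar>energy k b \<eta> u\<bar> \<le> (\<Sum>v\<in>neighbours k b u. \<bar>int (edge_mult k b u v) * (\<eta> u * \<eta> v)\<bar>)"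
    unfolding energy_def abs_minus_cancel by (rule sum_abs)
  also have "\<dots> = (\<Sum>v\<in>neighbours k b u. int (edge_mult k b u v))"
  proof (intro sum.cong refl)
    fix v assume "v \<in> neighbours k b u"
    then have "\<eta> u \<in> {-1, 1}" "\<eta> v \<in> {-1, 1}" using assms by blast+
    then show "\<bar>int (edge_mult k b u v) * (\<eta> u * \<eta> v)\<bar> = int (edge_mult k b u v)" by auto
  qed
  also have "\<dots> \<le> 18 * int k" by (rule sum_edge_mult_le)
  finally show ?thesis .
qed

lemma energy_flip_self:
  assumes "k \<ge> 2" shows "energy k b (\<eta>(x := - \<eta> x)) x = - energy k b \<eta> x"
proof -
  have "x \<notin> neighbours k b x" using edge_mult_self[OF assms] by (simp add: neighbours_def)
  then have "(\<Sum>v\<in>neighbours k b x. int (edge_mult k b x v) * ((\<eta>(x := - \<eta> x)) x * (\<eta>(x := - \<eta> x)) v))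
      = (\<Sum>v\<in>neighbours k b x. - (int (edge_mult k b x v) * (\<eta> x * \<eta> v)))"
    by (intro sum.cong refl) auto
  then show ?thesis by (simp add: energy_def sum_negf)
qed

lemma energy_flip_other:
  assumes "x \<in> slab k" "y \<noteq> x"
  shows "energy k b (\<eta>(x := - \<eta> x)) y = energy k b \<eta> y + 2 * int (edge_mult k b y x) * (\<eta> y * \<eta> x)"
proof -
  have "(\<Sum>v\<in>neighbours k b y. int (edge_mult k b y v) * ((\<eta>(x := - \<eta> x)) y * (\<eta>(x := - \<eta> x)) v))
      = (\<Sum>v\<in>neighbours k b y. int (edge_mult k b y v) * (\<eta> y * \<eta> v)
          - (if v = x then 2 * int (edge_mult k b y x) * (\<eta> y * \<eta> x) else 0))"
    using assms by (intro sum.cong refl) auto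
  also have "\<dots> = (\<Sum>v\<in>neighbours k b y. int (edge_mult k b y v) * (\<eta> y * \<eta> v))
          - (if x \<in> neighbours k b y then 2 * int (edge_mult k b y x) * (\<eta> y * \<eta> x) else 0)"
    using finite_neighbours by (simp add: sum_subtractf)
  also have "(if x \<in> neighbours k b y then 2 * int (edge_mult k b y x) * (\<eta> y * \<eta> x) else 0) = 2 * int (edge_mult k b y x) * (\<eta> y * \<eta> x)"
    using assms by (auto simp: neighbours_def)
  finally show ?thesis by (simp add: energy_def)
qed

text \<open>Summing site energies counts an edge inside the box twice and an edge leaving it once.
  Hence flipping a site whose neighbours all lie in the box subtracts four, not two, times its
  energy.\<close>

definition box_energy :: "nat \<Rightarrow> boundary \<Rightarrow> site set \<Rightarrow> (site \<Rightarrow> int) \<Rightarrow> int" where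
  "box_energy k b \<Lambda> \<eta> = (\<Sum>y\<in>\<Lambda>. energy k b \<eta> y)"

text \<open>For an arbitrary site a crude bound suffices: the flipped site itself and all its
  neighbours together each raise the sum by at most 36 k.\<close>

lemma box_energy_flip:
  assumes k: "k \<ge> 2" and x: "x \<in> slab k" and \<Lambda>: "finite \<Lambda>" "\<Lambda> \<subseteq> slab k"
  shows box_energy_flip_interior: "x \<in> \<Lambda> \<Longrightarrow> neighbours k b x \<subseteq> \<Lambda> \<Longrightarrow>
      box_energy k b \<Lambda> (\<eta>(x := - \<eta> x)) = box_energy k b \<Lambda> \<eta> - 4 * energy k b \<eta> x"
    and box_energy_flip_le: "(\<And>v. v \<in> slab k \<Longrightarrow> \<eta> v \<in> {-1, 1}) \<Longrightarrow>
      box_energy k b \<Lambda> (\<eta>(x := - \<eta> x)) \<le> box_energy k b \<Lambda> \<eta> + 72 * int k"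
proof -
  let ?\<eta>' = "\<eta>(x := - \<eta> x)"
  have other: "(\<Sum>y\<in>\<Lambda>-{x}. energy k b ?\<eta>' y)
      = (\<Sum>y\<in>\<Lambda>-{x}. energy k b \<eta> y) + 2 * (\<Sum>y\<in>\<Lambda>-{x}. int (edge_mult k b x y) * (\<eta> x * \<eta> y))"
  proof -
    have "(\<Sum>y\<in>\<Lambda>-{x}. energy k b ?\<eta>' y) = (\<Sum>y\<in>\<Lambda>-{x}. energy k b \<eta> y + 2 * (int (edge_mult k b x y) * (\<eta> x * \<eta> y)))"
      using energy_flip_other[OF x] by (intro sum.cong refl) (simp add: edge_mult_sym[of k b x] mult_ac)
    then show ?thesis by (simp add: sum.distrib sum_distrib_left)
  qed
  have restrict: "(\<Sum>y\<in>\<Lambda>-{x}. int (edge_mult k b x y) * g y) = (\<Sum>y\<in>\<Lambda> \<inter> neighbours k b x. int (edge_mult k b x y) * g y)" for g :: "site \<Rightarrow> int"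
    using \<Lambda> edge_mult_self[OF k, of b x] by (intro sum.mono_neutral_right) (auto simp: neighbours_def)
  {
    assume "x \<in> \<Lambda>" "neighbours k b x \<subseteq> \<Lambda>"
    then have "\<Lambda> \<inter> neighbours k b x = neighbours k b x" by blast
    then have "2 * (\<Sum>y\<in>\<Lambda>-{x}. int (edge_mult k b x y) * (\<eta> x * \<eta> y)) = - 2 * energy k b \<eta> x"
      unfolding restrict by (simp add: energy_def)
    then show "box_energy k b \<Lambda> ?\<eta>' = box_energy k b \<Lambda> \<eta> - 4 * energy k b \<eta> x"
      unfolding box_energy_def sum.remove[OF \<Lambda>(1) \<open>x \<in> \<Lambda>\<close>] other energy_flip_self[OF k] by simp
  next
    assume pm: "\<And>v. v \<in> slab k \<Longrightarrow> \<eta> v \<in> {-1, 1}"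
    have "(\<Sum>y\<in>\<Lambda> \<inter> neighbours k b x. int (edge_mult k b x y) * (\<eta> x * \<eta> y)) \<le> (\<Sum>y\<in>\<Lambda> \<inter> neighbours k b x. int (edge_mult k b x y))"
    proof (rule sum_mono)
      fix y assume "y \<in> \<Lambda> \<inter> neighbours k b x"
      then have "\<eta> x * \<eta> y \<le> 1" using pm[of x] pm[of y] x \<Lambda> by fastforce
      from mult_left_mono[OF this, of "int (edge_mult k b x y)"]
      show "int (edge_mult k b x y) * (\<eta> x * \<eta> y) \<le> int (edge_mult k b x y)" by simp
    qed
    also have "\<dots> \<le> (\<Sum>y\<in>neighbours k b x. int (edge_mult k b x y))"
      using finite_neighbours by (intro sum_mono2) auto
    also have "\<dots> \<le> 18 * int k" by (rule sum_edge_mult_le)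
    finally have o: "(\<Sum>y\<in>\<Lambda>-{x}. energy k b ?\<eta>' y) \<le> (\<Sum>y\<in>\<Lambda>-{x}. energy k b \<eta> y) + 36 * int k"
      unfolding other restrict by simp
    show "box_energy k b \<Lambda> ?\<eta>' \<le> box_energy k b \<Lambda> \<eta> + 72 * int k"
    proof (cases "x \<in> \<Lambda>")
      case True
      have "\<bar>energy k b \<eta> x\<bar> \<le> 18 * int k"
        using pm x neighbours_slab by (intro abs_energy_le) blast
      then show ?thesis
        using o unfolding box_energy_def sum.remove[OF \<Lambda>(1) True] energy_flip_self[OF k] by linarith
    next
      case False
      then show ?thesis using o by (simp add: box_energy_def)
    qed
  }
qed

section \<open>Measurability and translation of the dynamics\<close>

context slab_dynamics
begin

lemma measurable_spin_fuel:
  "x \<in> slab k \<Longrightarrow> (\<lambda>\<omega>. spin_fuel d (fst \<omega>) (fst (snd \<omega>)) (snd (snd \<omega>)) x n) \<in> glauber_measure k \<rightarrow>\<^sub>M count_space UNIV"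
proof (induction d arbitrary: x n)
  case (Suc d)
  note [measurable] = Suc.prems
  show ?case
  proof (cases n)
    case (Suc m)
    define \<eta> where "\<eta> \<omega> = (\<lambda>y. spin_fuel d (fst \<omega>) (fst (snd \<omega>)) (snd (snd \<omega>)) y (rings_before (fst (snd \<omega>)) y (ring_time (fst (snd \<omega>)) x m)))" for \<omega>
    have \<eta>: "(\<lambda>\<omega>. \<eta> \<omega> y) \<in> glauber_measure k \<rightarrow>\<^sub>M count_space UNIV" if [measurable]: "y \<in> slab k" for y
      unfolding \<eta>_def
      by (rule measurable_compose_countable[of "\<lambda>i \<omega>. spin_fuel d (fst \<omega>) (fst (snd \<omega>)) (snd (snd \<omega>)) y i", OF Suc.IH[OF that]]) measurable
    have "(\<lambda>\<omega>. (energy k b (\<eta> \<omega>) x, \<eta> \<omega> x)) \<in> glauber_measure k \<rightarrow>\<^sub>M count_space UNIV"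
      by (rule measurable_count_space_op2[where h = Pair, OF measurable_energy[OF Suc.prems \<eta>] \<eta>[OF Suc.prems]])
    from measurable_count_space_op2[OF this measurable_coin[OF Suc.prems, of m], of "\<lambda>p c. updated_spin (fst p) (snd p) c"]
    show ?thesis unfolding Suc by (simp add: Let_def \<eta>_def)
  qed (use Suc.prems in simp)
qed simp

lemma measurable_spin_after[measurable]:
  assumes x: "x \<in> slab k"
  shows "(\<lambda>\<omega>. spin_after (fst \<omega>) (fst (snd \<omega>)) (snd (snd \<omega>)) x n) \<in> glauber_measure k \<rightarrow>\<^sub>M count_space UNIV"
proof -
  note [measurable] = measurable_spin_fuel[OF x]
  show ?thesis
    unfolding spin_after_def
    by (rule measurable_compose_countable[of "\<lambda>d \<omega>. spin_fuel d (fst \<omega>) (fst (snd \<omega>)) (snd (snd \<omega>)) x n"]) measurable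
qed

lemma
  assumes x: "x \<in> slab k" and [measurable]: "\<tau> \<in> borel_measurable (glauber_measure k)"
  shows measurable_config_before[measurable]: "(\<lambda>\<omega>. config_before (fst \<omega>) (fst (snd \<omega>)) (snd (snd \<omega>)) (\<tau> \<omega>) x)
      \<in> glauber_measure k \<rightarrow>\<^sub>M count_space UNIV"
    and measurable_config_at[measurable]: "(\<lambda>\<omega>. config_at (fst \<omega>) (fst (snd \<omega>)) (snd (snd \<omega>)) (\<tau> \<omega>) x)
      \<in> glauber_measure k \<rightarrow>\<^sub>M count_space UNIV"
proof -
  note [measurable] = x
  show "(\<lambda>\<omega>. config_before (fst \<omega>) (fst (snd \<omega>)) (snd (snd \<omega>)) (\<tau> \<omega>) x) \<in> glauber_measure k \<rightarrow>\<^sub>M count_space UNIV"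
    unfolding config_before_def
    by (rule measurable_compose_countable[of "\<lambda>i \<omega>. spin_after (fst \<omega>) (fst (snd \<omega>)) (snd (snd \<omega>)) x i"]) measurable
  show "(\<lambda>\<omega>. config_at (fst \<omega>) (fst (snd \<omega>)) (snd (snd \<omega>)) (\<tau> \<omega>) x) \<in> glauber_measure k \<rightarrow>\<^sub>M count_space UNIV"
    unfolding config_at_def
    by (rule measurable_compose_countable[of "\<lambda>i \<omega>. spin_after (fst \<omega>) (fst (snd \<omega>)) (snd (snd \<omega>)) x i"]) measurable
qed

text \<open>At such a ring the spin flips without consulting the coin and the energy strictly drops.
  Any other flip happens at energy zero and leaves the energy unchanged, so the balance counts
  exactly these rings.\<close>

definition lowering :: "sample \<Rightarrow> site \<Rightarrow> nat \<Rightarrow> bool" where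
  "lowering = (\<lambda>(s, w, c) x n. energy k b (config_before s w c (ring_time w x n)) x > 0)"

lemma lowering_alt: "lowering \<omega> x n \<longleftrightarrow>
    energy k b (config_before (fst \<omega>) (fst (snd \<omega>)) (snd (snd \<omega>)) (ring_time (fst (snd \<omega>)) x n)) x > 0"
  by (simp add: lowering_def split_beta)

lemma measurable_lowering[measurable]:
  assumes x: "x \<in> slab k" shows "Measurable.pred (glauber_measure k) (\<lambda>\<omega>. lowering \<omega> x n)"
proof -
  have "(\<lambda>\<omega>. energy k b (config_before (fst \<omega>) (fst (snd \<omega>)) (snd (snd \<omega>)) (ring_time (fst (snd \<omega>)) x n)) x) \<in> glauber_measure k \<rightarrow>\<^sub>M count_space UNIV"
    using x by (intro measurable_energy measurable_config_before measurable_ring_time)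
  from measurable_compose[OF this, of "\<lambda>e. e > 0" "count_space UNIV"] show ?thesis
    by (simp add: lowering_alt)
qed

context
  fixes p :: "int \<times> int" and s s' :: "site \<Rightarrow> int" and w w' :: "site \<times> nat \<Rightarrow> real" and c c' :: "site \<times> nat \<Rightarrow> int"
  assumes s': "\<And>x. x \<in> slab k \<Longrightarrow> s' x = s (shift p x)"
    and w': "\<And>x n. x \<in> slab k \<Longrightarrow> w' (x, n) = w (shift p x, n)"
    and c': "\<And>x n. x \<in> slab k \<Longrightarrow> c' (x, n) = c (shift p x, n)"
begin

lemma ring_time_shift: "x \<in> slab k \<Longrightarrow> ring_time w' x n = ring_time w (shift p x) n"
  by (simp add: ring_time_def w')

lemma rings_before_shift: "x \<in> slab k \<Longrightarrow> rings_before w' x t = rings_before w (shift p x) t"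
  by (simp add: rings_before_def ring_time_shift)

lemma spin_fuel_shift: "x \<in> slab k \<Longrightarrow> spin_fuel d s' w' c' x n = spin_fuel d s w c (shift p x) n"
proof (induction d arbitrary: x n)
  case (Suc d)
  show ?case
  proof (cases n)
    case (Suc m)
    have "y \<in> slab k" if "y \<in> insert x (neighbours k b x)" for y
      using that Suc.prems neighbours_slab by blast
    then have "energy k b (\<lambda>y. spin_fuel d s' w' c' y (rings_before w' y (ring_time w' x m))) x =
        energy k b (\<lambda>y. spin_fuel d s w c y (rings_before w y (ring_time w (shift p x) m))) (shift p x)"
      unfolding energy_shift using Suc.prems
      by (intro energy_cong) (simp add: Suc.IH rings_before_shift ring_time_shift)
    then show ?thesis using Suc.prems
      by (simp add: \<open>n = Suc m\<close> Let_def Suc.IH rings_before_shift ring_time_shift c')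
  qed (use Suc.prems in \<open>simp add: s'\<close>)
qed simp

lemma lowering_shift: 
  assumes x: "x \<in> slab k" shows "lowering (s', w', c') x n \<longleftrightarrow> lowering (s, w, c) (shift p x) n"
proof -
  have "y \<in> slab k" if "y \<in> insert x (neighbours k b x)" for y
    using that x neighbours_slab by blast
  then show ?thesis unfolding lowering_alt energy_shift fst_conv snd_conv using x
    by (intro arg_cong[where f = "\<lambda>e. e > 0"] energy_cong)
      (simp add: config_before_def spin_after_def spin_fuel_shift rings_before_shift ring_time_shift)
qed

end

text \<open>The constructed dynamics commutes with translations of the sample, whose law is
  translation invariant.\<close>

lemma emeasure_lowering_shift:
  assumes x: "x \<in> slab k"
  shows "emeasure (glauber_measure k) {\<omega>\<in>space (glauber_measure k). ring_time (fst (snd \<omega>)) (shift p x) n < t \<and> lowering \<omega> (shift p x) n}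
    = emeasure (glauber_measure k) {\<omega>\<in>space (glauber_measure k). ring_time (fst (snd \<omega>)) x n < t \<and> lowering \<omega> x n}"
proof -
  note [measurable] = x
  let ?E = "{\<omega>\<in>space (glauber_measure k). ring_time (fst (snd \<omega>)) x n < t \<and> lowering \<omega> x n}"
  have "?E \<in> sets (glauber_measure k)" by measurable
  from emeasure_shift_sample[OF this, of p, symmetric] show ?thesis
  proof (rule trans[OF _ sym, rotated])
    show "emeasure (glauber_measure k) {\<omega>\<in>space (glauber_measure k). ring_time (fst (snd \<omega>)) (shift p x) n < t \<and> lowering \<omega> (shift p x) n}
      = emeasure (glauber_measure k) {\<omega>\<in>space (glauber_measure k). shift_sample k p \<omega> \<in> ?E}"
    proof (rule arg_cong[where f = "emeasure (glauber_measure k)"], rule Collect_cong)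
      fix \<omega> :: sample
      obtain s w c where \<omega>: "\<omega> = (s, w, c)" by (metis prod_cases3)
      let ?s = "\<lambda>x\<in>slab k. s (shift p x)" and ?w = "\<lambda>i\<in>slab k \<times> UNIV. w (shift p (fst i), snd i)"
        and ?c = "\<lambda>i\<in>slab k \<times> UNIV. c (shift p (fst i), snd i)"
      have "lowering (?s, ?w, ?c) x n = lowering (s, w, c) (shift p x) n"
        by (rule lowering_shift) (use x in auto)
      moreover have "ring_time ?w x n = ring_time w (shift p x) n"
        by (rule ring_time_shift[of ?s s p ?w w ?c c]) (use x in auto)
      moreover have "\<omega> \<in> space (glauber_measure k) \<Longrightarrow> shift_sample k p \<omega> \<in> space (glauber_measure k)"
        using measurable_space[OF measurable_shift_sample] .
      ultimately show "(\<omega> \<in> space (glauber_measure k) \<and> ring_time (fst (snd \<omega>)) (shift p x) n < t \<and> lowering \<omega> (shift p x) n) =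
        (\<omega> \<in> space (glauber_measure k) \<and> shift_sample k p \<omega> \<in> ?E)"
        by (auto simp: \<omega> shift_sample_def)
    qed
  qed
qed

end

lemma suminf_indicator_eq_card:
  assumes "finite {n::nat. \<omega> \<in> A n}"
  shows "(\<Sum>n. indicator (A n) \<omega> :: ennreal) = of_nat (card {n. \<omega> \<in> A n})"
proof -
  have "(\<Sum>n. indicator (A n) \<omega> :: ennreal) = (\<Sum>n\<in>{n. \<omega> \<in> A n}. indicator (A n) \<omega>)"
    by (rule suminf_finite[OF assms]) auto
  also have "\<dots> = (\<Sum>n\<in>{n. \<omega> \<in> A n}. 1)" by (intro sum.cong) auto
  finally show ?thesis by simp
qed

context good_sample
begin

text \<open>A lowering ring in the interior I lowers the box energy by at least 4, a flip at energy
  zero in I does not change it, and a ring in the rim N raises it by at most 72 k. The initial and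
  the final box energy are at most 18 k per site in absolute value, which accounts for 36 k. The
  induction removes the last of the finitely many rings before t that concern the box.\<close>

lemma energy_budget:
  assumes k: "k \<ge> 2" and \<Lambda>: "finite \<Lambda>" "\<Lambda> \<subseteq> slab k"
  defines "I \<equiv> {x\<in>\<Lambda>. neighbours k b x \<subseteq> \<Lambda>}"
    and "N \<equiv> (\<Lambda> \<union> (\<Union>x\<in>\<Lambda>. neighbours k b x)) - {x\<in>\<Lambda>. neighbours k b x \<subseteq> \<Lambda>}"
  shows "4 * card (SIGMA x:I. {n. T x n < t \<and> lowering (s, w, c) x n})
    \<le> 36 * k * card \<Lambda> + 72 * k * card (SIGMA x:N. {n. T x n < t})"
proof -
  define L where "L t = (SIGMA x:I. {n. T x n < t \<and> lowering (s, w, c) x n})" for t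
  define R where "R t = (SIGMA x:N. {n. T x n < t})" for t
  define Ev where "Ev t = (SIGMA x:I \<union> N. {n. T x n < t})" for t
  let ?H = "box_energy k b \<Lambda>"
  have IN_eq: "I \<union> N = \<Lambda> \<union> (\<Union>x\<in>\<Lambda>. neighbours k b x)"
    unfolding I_def N_def by blast
  have IN: "finite (I \<union> N)" "I \<union> N \<subseteq> slab k" "I \<union> N = \<Lambda> \<union> (\<Union>x\<in>\<Lambda>. neighbours k b x)" "I \<inter> N = {}"
  proof -
    show "finite (I \<union> N)" unfolding IN_eq using \<Lambda>(1) finite_neighbours by simp
    show "I \<union> N \<subseteq> slab k" unfolding IN_eq using \<Lambda>(2) neighbours_slab by blast
    show "I \<inter> N = {}" unfolding I_def N_def by blast
  qed (rule IN_eq)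
  have fin_ring: "finite {n. T x n < t}" if "x \<in> I \<union> N" for x t
    using clocks[of x] IN(2) that by (auto simp: regular_clock_def)
  have finEv: "finite (Ev t)" for t unfolding Ev_def using IN fin_ring by (intro finite_SigmaI) auto
  have L_sub: "L t \<subseteq> Ev t" and R_sub: "R t \<subseteq> Ev t" for t unfolding L_def R_def Ev_def by auto
  have H_cong: "?H \<eta> = ?H \<eta>'" if "\<And>y. y \<in> I \<union> N \<Longrightarrow> \<eta> y = \<eta>' y" for \<eta> \<eta>'
    unfolding box_energy_def using that unfolding IN(3) by (intro sum.cong refl energy_cong) blast
  have pm: "before t y \<in> {-1, 1}" if "y \<in> slab k" for t y
    unfolding config_before_def using spin_pm1[OF that] .
  have main: "4 * int (card (L t)) + ?H (before t) \<le> ?H s + 72 * int k * int (card (R t))" for t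
  proof (induction "card (Ev t)" arbitrary: t rule: less_induct)
    case less
    show ?case
    proof (cases "Ev t = {}")
      case True
      have "before t y = s y" if "y \<in> I \<union> N" for y
      proof -
        have "{n. T y n < t} = {}" using True that unfolding Ev_def by auto
        then have "rings_before w y t = 0" unfolding rings_before_def by simp
        then show ?thesis using spin_0[OF subsetD[OF IN(2) that]] unfolding config_before_def by simp
      qed
      then have "?H (before t) = ?H s" by (rule H_cong)
      moreover have "L t = {}" "R t = {}" using True L_sub R_sub by blast+
      ultimately show ?thesis by simp
    next
      case False
      define t' where "t' = Max ((\<lambda>(x, n). T x n) ` Ev t)"
      have "t' \<in> (\<lambda>(x, n). T x n) ` Ev t" unfolding t'_def using False finEv by (intro Max_in) auto
      then obtain x n where xn: "(x, n) \<in> Ev t" "t' = T x n" by auto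
      have max: "T y m \<le> t'" if "(y, m) \<in> Ev t" for y m
        unfolding t'_def using that finEv by (intro Max_ge) force+
      have x: "x \<in> I \<union> N" "T x n < t" "x \<in> slab k" using xn IN(2) unfolding Ev_def by auto
      have less_iff: "T y m < t \<longleftrightarrow> T y m < t' \<or> (y, m) = (x, n)" if y: "y \<in> I \<union> N" for y m
      proof
        assume "T y m < t"
        then have le: "T y m \<le> T x n" using max[of y m] y xn unfolding Ev_def by auto
        show "T y m < t' \<or> (y, m) = (x, n)"
        proof (cases "y = x")
          case True
          then show ?thesis using le strict_mono_less_eq[OF T_mono[OF x(3)], of m n] strict_mono_less[OF T_mono[OF x(3)], of m n] xn by auto
        next
          case False
          then show ?thesis using le distinct_rings[of y x m n] y x IN(2) xn by fastforce
        qed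
      qed (use x xn in auto)
      have Ev_eq: "Ev t = insert (x, n) (Ev t')" unfolding Ev_def using less_iff x by auto
      have xn_notin: "(x, n) \<notin> Ev t'" unfolding Ev_def using xn by auto
      have card_less: "card (Ev t') < card (Ev t)" using finEv xn_notin unfolding Ev_eq by simp
      have rb_other: "rings_before w y t = rings_before w y t'" if "y \<in> I \<union> N" "y \<noteq> x" for y
        unfolding rings_before_def using less_iff[OF that(1)] that(2) by simp
      have rb_x': "rings_before w x t' = n" unfolding xn by (rule rings_before_ring_time[OF clocks[OF x(3)]])
      have rb_x: "rings_before w x t = Suc n"
      proof -
        have "{m. T x m < t} = insert n {m. T x m < t'}" using less_iff[OF x(1)] by auto
        then have "rings_before w x t = Suc (card {m. T x m < t'})"
          unfolding rings_before_def using fin_ring[OF x(1), of t'] xn by simp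
        then show ?thesis using rb_x' unfolding rings_before_def by simp
      qed
      let ?\<eta> = "before t'"
      have eq_other: "before t y = ?\<eta> y" if "y \<in> I \<union> N" "y \<noteq> x" for y
        unfolding config_before_def rb_other[OF that] by simp
      have eq_x: "before t x = updated_spin (energy k b ?\<eta> x) (?\<eta> x) (c (x, n))"
      proof -
        have "before t x = spin x (Suc n)" "?\<eta> x = spin x n"
          by (simp_all only: config_before_def rb_x rb_x')
        then show ?thesis by (simp only: spin_Suc[OF x(3)] xn)
      qed
      have low_iff: "lowering (s, w, c) x n \<longleftrightarrow> energy k b ?\<eta> x > 0" by (simp add: lowering_def xn)
      have \<eta>x: "?\<eta> x \<in> {-1, 1}" using pm x by blast
      \<comment> \<open>The first alternative includes a ring at energy zero whose coin repeats the
        old spin.\<close>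
      have "before t x = ?\<eta> x \<and> \<not> lowering (s, w, c) x n \<or> before t x = - ?\<eta> x \<and> energy k b ?\<eta> x \<ge> 0"
        using \<eta>x coins[OF x(3), of n] unfolding eq_x low_iff by (auto simp: updated_spin_def)
      then have H_eq: "?H (before t) = ?H ?\<eta> \<and> \<not> lowering (s, w, c) x n \<or>
          ?H (before t) = ?H (?\<eta>(x := - ?\<eta> x)) \<and> energy k b ?\<eta> x \<ge> 0"
      proof (elim disjE conjE)
        assume "before t x = ?\<eta> x" "\<not> lowering (s, w, c) x n"
        moreover have "?H (before t) = ?H ?\<eta>"
        proof (rule H_cong)
          fix y assume "y \<in> I \<union> N"
          then show "before t y = ?\<eta> y" using eq_other[of y] \<open>before t x = ?\<eta> x\<close> by blast
        qed
        ultimately show ?thesis by blast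
      next
        assume *: "before t x = - ?\<eta> x" "energy k b ?\<eta> x \<ge> 0"
        have "?H (before t) = ?H (?\<eta>(x := - ?\<eta> x))"
        proof (rule H_cong)
          fix y assume "y \<in> I \<union> N"
          show "before t y = (?\<eta>(x := - ?\<eta> x)) y"
          proof (cases "y = x")
            case True
            show ?thesis unfolding True fun_upd_same by (rule *(1))
          next
            case False
            show ?thesis unfolding fun_upd_other[OF False] by (rule eq_other[OF \<open>y \<in> I \<union> N\<close> False])
          qed
        qed
        with * show ?thesis by blast
      qed
      have IH: "4 * int (card (L t')) + ?H ?\<eta> \<le> ?H s + 72 * int k * int (card (R t'))"
        by (rule less[OF card_less])
      have finL: "finite (L t')" and finR: "finite (R t')"
        using finite_subset[OF L_sub finEv] finite_subset[OF R_sub finEv] .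
      have nL: "(x, n) \<notin> L t'" and nR: "(x, n) \<notin> R t'"
        using contra_subsetD[OF L_sub xn_notin] contra_subsetD[OF R_sub xn_notin] .
      show ?thesis
      proof (cases "x \<in> I")
        case True
        then have "x \<notin> N" using IN by blast
        then have Req: "R t = R t'" unfolding R_def using less_iff by auto
        have Leq: "L t = (if lowering (s, w, c) x n then insert (x, n) (L t') else L t')"
          unfolding L_def using less_iff True by auto
        have cL: "int (card (L t)) = int (card (L t')) + (if lowering (s, w, c) x n then 1 else 0)"
          unfolding Leq using finL nL by simp
        have "?H (?\<eta>(x := - ?\<eta> x)) = ?H ?\<eta> - 4 * energy k b ?\<eta> x"
          using True by (intro box_energy_flip_interior[OF k x(3) \<Lambda>]) (auto simp: I_def)
        then show ?thesis using IH H_eq low_iff unfolding cL Req by (auto split: if_splits)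
      next
        case False
        then have xN: "x \<in> N" using x by blast
        have Leq: "L t = L t'" unfolding L_def using less_iff False by auto
        have Req: "R t = insert (x, n) (R t')" unfolding R_def using less_iff xN by auto
        have cR: "int (card (R t)) = int (card (R t')) + 1" unfolding Req using finR nR by simp
        have "?H (?\<eta>(x := - ?\<eta> x)) \<le> ?H ?\<eta> + 72 * int k"
          by (intro box_energy_flip_le[OF k x(3) \<Lambda>] pm)
        then show ?thesis using IH H_eq unfolding Leq cR by (auto simp: algebra_simps)
      qed
    qed
  qed
  have Hb: "\<bar>?H \<eta>\<bar> \<le> 18 * int k * int (card \<Lambda>)" if "\<And>y. y \<in> slab k \<Longrightarrow> \<eta> y \<in> {-1, 1}" for \<eta>
  proof -
    have "\<bar>?H \<eta>\<bar> \<le> (\<Sum>y\<in>\<Lambda>. \<bar>energy k b \<eta> y\<bar>)" unfolding box_energy_def by (rule sum_abs)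
    also have "\<dots> \<le> (\<Sum>y\<in>\<Lambda>. 18 * int k)"
      using that \<Lambda> neighbours_slab by (intro sum_mono abs_energy_le) blast
    finally show ?thesis by (simp add: mult_ac)
  qed
  have "4 * int (card (L t)) \<le> 36 * int k * int (card \<Lambda>) + 72 * int k * int (card (R t))"
    using main[of t] Hb[of "before t", OF pm] Hb[of s, OF initial_spins] by linarith
  then have "int (4 * card (L t)) \<le> int (36 * k * card \<Lambda> + 72 * k * card (R t))" by simp
  then have "4 * card (L t) \<le> 36 * k * card \<Lambda> + 72 * k * card (R t)" unfolding of_nat_le_iff .
  then show ?thesis by (simp add: L_def R_def)
qed

end

section \<open>The expected number of lowering rings per site\<close>

definition site_box :: "nat \<Rightarrow> nat \<Rightarrow> site set" where
  "site_box k L = {- int L..int L} \<times> {- int L..int L} \<times> {0..<int k}"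

lemma finite_site_box: "finite (site_box k L)"
  by (simp add: site_box_def)

lemma site_box_subset_slab: "site_box k L \<subseteq> slab k"
  by (auto simp: site_box_def slab_def)

lemma card_site_box: "card (site_box k L) = k * (2 * L + 1)\<^sup>2"
proof -
  have "nat (2 * int L + 1) = 2 * L + 1" by simp
  then show ?thesis by (simp add: site_box_def card_cartesian_product power2_eq_square algebra_simps)
qed

lemma site_box_mono: "L \<le> L' \<Longrightarrow> site_box k L \<subseteq> site_box k L'"
  by (auto simp: site_box_def)

lemma neighbours_site_box:
  assumes "u \<in> site_box k L" shows "neighbours k b u \<subseteq> site_box k (Suc L)"
proof -
  obtain x y z where u: "u = (x, y, z)" by (metis prod_cases3)
  have "neighbours k b u \<subseteq> {x-1..x+1} \<times> {y-1..y+1} \<times> {0..<int k}"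
    unfolding neighbours_def slab_def u edge_mult_def by (auto split: if_splits)
  also have "\<dots> \<subseteq> site_box k (Suc L)" using assms unfolding u site_box_def by auto
  finally show ?thesis .
qed

context slab_dynamics
begin

definition lowering_before :: "site \<Rightarrow> real \<Rightarrow> nat \<Rightarrow> sample set" where
  "lowering_before x t n =
     {\<omega>\<in>space (glauber_measure k). ring_time (fst (snd \<omega>)) x n < t \<and> lowering \<omega> x n}"

lemma sets_lowering_before: "x \<in> slab k \<Longrightarrow> lowering_before x t n \<in> sets (glauber_measure k)"
  unfolding lowering_before_def by measurable

text \<open>The energy balance is applied to the box of radius L + 1: sites within radius L are
  interior to it, and its rim lies within radius L + 2 but outside radius L. The rings of a rim site
  before t number at most \<open>exp t\<close> in expectation.\<close>

lemma sum_lowering_box_le: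
  assumes k: "k \<ge> 2"
  shows "(\<Sum>x\<in>site_box k L. \<Sum>n. emeasure (glauber_measure k) (lowering_before x t n)) * 4
    \<le> ennreal (36 * real k * real (card (site_box k (Suc L))) + 72 * real k * real (card (site_box k (L + 2) - site_box k L)) * exp t)"
proof -
  let ?M = "glauber_measure k"
  interpret prob_space ?M by (rule prob_space_glauber_measure)
  let ?\<Lambda> = "site_box k (Suc L)" and ?R = "site_box k (L + 2) - site_box k L"
  define ring where "ring x n = {\<omega>\<in>space ?M. ring_time (fst (snd \<omega>)) x n < t}" for x n
  have slab: "x \<in> slab k" if "x \<in> site_box k L \<or> x \<in> ?R" for x using that site_box_subset_slab by blast
  have ring_sets: "ring x n \<in> sets ?M" if [measurable]: "x \<in> slab k" for x n unfolding ring_def by measurable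
  have "(\<Sum>x\<in>site_box k L. \<Sum>n. emeasure ?M (lowering_before x t n)) * 4
      = (\<Sum>x\<in>site_box k L. \<integral>\<^sup>+\<omega>. (\<Sum>n. indicator (lowering_before x t n) \<omega>) \<partial>?M) * 4"
    using slab sets_lowering_before
    by (intro arg_cong2[where f = "(*)"] refl sum.cong, subst nn_integral_suminf) auto
  also have "\<dots> = (\<integral>\<^sup>+\<omega>. (\<Sum>x\<in>site_box k L. \<Sum>n. indicator (lowering_before x t n) \<omega>) * 4 \<partial>?M)"
    using slab sets_lowering_before
    by (subst nn_integral_multc, measurable, subst nn_integral_sum) (auto intro!: borel_measurable_suminf borel_measurable_indicator)
  also have "\<dots> \<le> (\<integral>\<^sup>+\<omega>. of_nat (36 * k * card ?\<Lambda>) + of_nat (72 * k) * (\<Sum>x\<in>?R. \<Sum>n. indicator (ring x n) \<omega>) \<partial>?M)"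
  proof (rule nn_integral_mono_AE)
    show "AE \<omega> in ?M. (\<Sum>x\<in>site_box k L. \<Sum>n. indicator (lowering_before x t n) \<omega> :: ennreal) * 4
        \<le> of_nat (36 * k * card ?\<Lambda>) + of_nat (72 * k) * (\<Sum>x\<in>?R. \<Sum>n. indicator (ring x n) \<omega>)"
      using AE_good_sample AE_space
    proof eventually_elim
      case (elim \<omega>)
      obtain s w c where \<omega>: "\<omega> = (s, w, c)" by (metis prod_cases3)
      interpret good_sample k b s w c using elim(1) by (simp add: \<omega>)
      have fin: "finite {n. T x n < t}" if "x \<in> slab k" for x using clocks[OF that] by (simp add: regular_clock_def)
      have low: "(\<Sum>n. indicator (lowering_before x t n) \<omega> :: ennreal) = of_nat (card {n. T x n < t \<and> lowering (s, w, c) x n})"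
        if "x \<in> slab k" for x
      proof -
        have "{n. \<omega> \<in> lowering_before x t n} = {n. T x n < t \<and> lowering (s, w, c) x n}"
          using elim(2) unfolding lowering_before_def \<omega> by auto
        moreover have "finite {n. T x n < t \<and> lowering (s, w, c) x n}" using fin[OF that] by simp
        ultimately show ?thesis by (subst suminf_indicator_eq_card) auto
      qed
      have ring: "(\<Sum>n. indicator (ring x n) \<omega> :: ennreal) = of_nat (card {n. T x n < t})" if "x \<in> slab k" for x
      proof -
        have "{n. \<omega> \<in> ring x n} = {n. T x n < t}" using elim(2) unfolding ring_def \<omega> by auto
        then show ?thesis using fin[OF that] by (subst suminf_indicator_eq_card) auto
      qed
      let ?I = "{x\<in>?\<Lambda>. neighbours k b x \<subseteq> ?\<Lambda>}"
      let ?N = "(?\<Lambda> \<union> (\<Union>x\<in>?\<Lambda>. neighbours k b x)) - ?I"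
      have "site_box k L \<subseteq> site_box k (Suc L)" by (rule site_box_mono) simp
      then have I: "site_box k L \<subseteq> ?I" using neighbours_site_box by blast
      have "site_box k (Suc L) \<subseteq> site_box k (L + 2)" by (rule site_box_mono) simp
      moreover have "neighbours k b x \<subseteq> site_box k (L + 2)" if "x \<in> ?\<Lambda>" for x
        using neighbours_site_box[OF that] by simp
      ultimately have N: "?N \<subseteq> ?R" using I by blast
      have finI: "finite ?I" using finite_site_box by simp
      have "4 * (\<Sum>x\<in>site_box k L. card {n. T x n < t \<and> lowering (s, w, c) x n}) =
          4 * card (SIGMA x:site_box k L. {n. T x n < t \<and> lowering (s, w, c) x n})"
        using finite_site_box slab fin by (subst card_SigmaI) auto
      also have "\<dots> \<le> 4 * card (SIGMA x:?I. {n. T x n < t \<and> lowering (s, w, c) x n})"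
      proof (intro mult_left_mono card_mono)
        show "finite (SIGMA x:?I. {n. T x n < t \<and> lowering (s, w, c) x n})"
          using finI fin site_box_subset_slab[of k "Suc L"] by (intro finite_SigmaI) auto
      qed (use I in auto)
      also have "\<dots> \<le> 36 * k * card ?\<Lambda> + 72 * k * card (SIGMA x:?N. {n. T x n < t})"
        by (rule energy_budget[OF k finite_site_box site_box_subset_slab])
      also have "\<dots> \<le> 36 * k * card ?\<Lambda> + 72 * k * card (SIGMA x:?R. {n. T x n < t})"
      proof (intro add_left_mono mult_left_mono card_mono)
        show "finite (SIGMA x:?R. {n. T x n < t})"
          using finite_site_box fin slab by (intro finite_SigmaI) auto
      qed (use N in auto)
      also have "\<dots> = 36 * k * card ?\<Lambda> + 72 * k * (\<Sum>x\<in>?R. card {n. T x n < t})"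
        using finite_site_box slab fin by (subst card_SigmaI) auto
      finally have "4 * (\<Sum>x\<in>site_box k L. card {n. T x n < t \<and> lowering (s, w, c) x n})
          \<le> 36 * k * card ?\<Lambda> + 72 * k * (\<Sum>x\<in>?R. card {n. T x n < t})" .
      from of_nat_mono[OF this, where 'a = ennreal]
      have "4 * (\<Sum>x\<in>site_box k L. of_nat (card {n. T x n < t \<and> lowering (s, w, c) x n}) :: ennreal)
          \<le> of_nat (36 * k * card ?\<Lambda>) + of_nat (72 * k) * (\<Sum>x\<in>?R. of_nat (card {n. T x n < t}))"
        by (simp only: of_nat_add of_nat_mult of_nat_sum of_nat_numeral)
      moreover have "(\<Sum>x\<in>site_box k L. \<Sum>n. indicator (lowering_before x t n) \<omega> :: ennreal)
          = (\<Sum>x\<in>site_box k L. of_nat (card {n. T x n < t \<and> lowering (s, w, c) x n}))"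
        using low slab by (intro sum.cong) auto
      moreover have "(\<Sum>x\<in>?R. \<Sum>n. indicator (ring x n) \<omega> :: ennreal) = (\<Sum>x\<in>?R. of_nat (card {n. T x n < t}))"
        using ring slab by (intro sum.cong) auto
      ultimately show ?case by (simp only: mult.commute[of _ 4])
    qed
  qed
  also have "\<dots> = of_nat (36 * k * card ?\<Lambda>) + of_nat (72 * k) * (\<Sum>x\<in>?R. \<Sum>n. emeasure ?M (ring x n))"
  proof -
    have m: "(\<lambda>\<omega>. \<Sum>n. indicator (ring x n) \<omega> :: ennreal) \<in> borel_measurable ?M" if "x \<in> ?R" for x
    proof -
      have [measurable]: "ring x n \<in> sets ?M" for n using ring_sets slab that by blast
      show ?thesis by measurable
    qed
    have "(\<integral>\<^sup>+\<omega>. (\<Sum>x\<in>?R. \<Sum>n. indicator (ring x n) \<omega>) \<partial>?M) = (\<Sum>x\<in>?R. \<Sum>n. emeasure ?M (ring x n))"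
    proof (subst nn_integral_sum[OF m], simp, intro sum.cong refl)
      fix x assume "x \<in> ?R"
      then show "(\<integral>\<^sup>+\<omega>. (\<Sum>n. indicator (ring x n) \<omega>) \<partial>?M) = (\<Sum>n. emeasure ?M (ring x n))"
        using slab ring_sets by (subst nn_integral_suminf) auto
    qed
    moreover have "(\<lambda>\<omega>. (\<Sum>x\<in>?R. \<Sum>n. indicator (ring x n) \<omega> :: ennreal)) \<in> borel_measurable ?M"
      using m by (intro borel_measurable_sum) auto
    ultimately show ?thesis
      by (subst nn_integral_add) (auto simp: nn_integral_cmult emeasure_space_1)
  qed
  also have "\<dots> \<le> of_nat (36 * k * card ?\<Lambda>) + of_nat (72 * k) * (\<Sum>x\<in>?R. ennreal (exp t))"
    using suminf_emeasure_ring_less slab unfolding ring_def by (intro add_left_mono mult_left_mono sum_mono) auto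
  also have "\<dots> = ennreal (36 * real k * real (card ?\<Lambda>) + 72 * real k * real (card ?R) * exp t)"
    by (simp add: ennreal_of_nat_eq_real_of_nat ennreal_mult'[symmetric] ennreal_plus[symmetric] mult_ac del: ennreal_plus)
  finally show ?thesis .
qed

text \<open>By translation invariance all (2 L + 1)^2 sites of a layer contribute equally. The rim
  has size of order L, so for L at least \<open>exp t\<close> its cost is no larger than the order
  of the volume term, and after division by the volume t has disappeared.\<close>

lemma suminf_lowering_before_le:
  assumes k: "k \<ge> 2" and x: "x \<in> slab k"
  shows "(\<Sum>n. emeasure (glauber_measure k) (lowering_before x t n)) \<le> ennreal (513 * (real k)\<^sup>2)"
proof -
  let ?l = "\<lambda>x. \<Sum>n. emeasure (glauber_measure k) (lowering_before x t n)"
  obtain i j z where xz: "x = (i, j, z)" by (metis prod_cases3)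
  obtain L where L: "exp t \<le> real L" using real_arch_simple by blast
  define q where "q = 2 * real L + 1"
  have q: "q \<ge> 1" "exp t \<le> q" using L by (auto simp: q_def)
  have l_eq: "?l (i', j', z) = ?l x" for i' j'
  proof -
    have "shift (i' - i, j' - j) x = (i', j', z)" by (simp add: shift_def xz)
    then show ?thesis using emeasure_lowering_shift[OF x, of "(i' - i, j' - j)" _ t] unfolding lowering_before_def by simp
  qed
  define S where "S = {- int L..int L} \<times> {- int L..int L} \<times> {z}"
  have cS: "card S = (2 * L + 1)\<^sup>2"
  proof -
    have "nat (2 * int L + 1) = 2 * L + 1" by simp
    then show ?thesis by (simp add: S_def card_cartesian_product power2_eq_square)
  qed
  have "ennreal (q\<^sup>2) * ?l x * 4 = (\<Sum>y\<in>S. ?l y) * 4"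
  proof -
    have "(\<Sum>y\<in>S. ?l y) = (\<Sum>y\<in>S. ?l x)" using l_eq by (intro sum.cong refl) (auto simp: S_def)
    also have "\<dots> = of_nat (card S) * ?l x" by simp
    also have "of_nat (card S) = ennreal (q\<^sup>2)" unfolding cS q_def by (simp add: ennreal_of_nat_eq_real_of_nat)
    finally show ?thesis by simp
  qed
  also have "\<dots> \<le> (\<Sum>y\<in>site_box k L. ?l y) * 4"
    using x by (intro mult_right_mono sum_mono2 finite_site_box) (auto simp: S_def site_box_def xz slab_def)
  also have "\<dots> \<le> ennreal (36 * real k * real (card (site_box k (Suc L))) + 72 * real k * real (card (site_box k (L + 2) - site_box k L)) * exp t)"
    by (rule sum_lowering_box_le[OF k])
  \<comment> \<open>The constant is 36 * 9 + 72 * 24 = 2052, from (2 L + 3)^2 \<le> 9 q^2 and (8 q +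
    16) \<open>exp t\<close> \<le> 24 q^2. Dividing it by the 4 of the energy drop leaves
    513.\<close>
  also have "\<dots> \<le> ennreal (q\<^sup>2 * (2052 * (real k)\<^sup>2))"
  proof (rule ennreal_leI)
    have 1: "real (card (site_box k (Suc L))) \<le> k * (9 * q\<^sup>2)"
    proof -
      have "(2 * real (Suc L) + 1) \<le> 3 * q" by (simp add: q_def)
      then have "(2 * real (Suc L) + 1)\<^sup>2 \<le> (3 * q)\<^sup>2" by (intro power_mono) auto
      then have "(2 * real (Suc L) + 1)\<^sup>2 \<le> 9 * q\<^sup>2" by (simp only: power_mult_distrib) simp
      then have "real k * (2 * real (Suc L) + 1)\<^sup>2 \<le> real k * (9 * q\<^sup>2)" by (rule mult_left_mono) simp
      moreover have "real (card (site_box k (Suc L))) = real k * (2 * real (Suc L) + 1)\<^sup>2"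
        unfolding card_site_box by (simp only: of_nat_mult of_nat_power of_nat_add of_nat_numeral of_nat_1)
      ultimately show ?thesis by simp
    qed
    have 2: "real (card (site_box k (L + 2) - site_box k L)) = k * (8 * q + 16)"
    proof -
      have "card (site_box k (L + 2) - site_box k L) = k * (2 * (L + 2) + 1)\<^sup>2 - k * (2 * L + 1)\<^sup>2"
        using site_box_mono[of L "L + 2" k] finite_site_box by (subst card_Diff_subset) (auto simp: card_site_box)
      also have "\<dots> = k * (16 * L + 24)" by (simp add: power2_eq_square algebra_simps)
      finally show ?thesis by (simp add: q_def)
    qed
    have "(8 * q + 16) * exp t \<le> (24 * q) * q" using q by (intro mult_mono) auto
    then have "real k * real k * ((8 * q + 16) * exp t) \<le> real k * real k * ((24 * q) * q)" by (intro mult_left_mono) auto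
    moreover have "36 * real k * real (card (site_box k (Suc L))) \<le> 36 * real k * (k * (9 * q\<^sup>2))"
      using 1 by (intro mult_left_mono) auto
    ultimately show "36 * real k * real (card (site_box k (Suc L))) + 72 * real k * real (card (site_box k (L + 2) - site_box k L)) * exp t
        \<le> q\<^sup>2 * (2052 * (real k)\<^sup>2)"
      unfolding 2 by (simp add: power2_eq_square algebra_simps)
  qed
  finally have "ennreal (q\<^sup>2) * ?l x * 4 \<le> ennreal (q\<^sup>2 * (2052 * (real k)\<^sup>2))" .
  moreover have "ennreal (4 * q\<^sup>2) * ?l x = ennreal (q\<^sup>2) * ?l x * 4"
    by (simp add: ennreal_mult' mult_ac)
  moreover have "ennreal (4 * q\<^sup>2) * ennreal (513 * (real k)\<^sup>2) = ennreal (q\<^sup>2 * (2052 * (real k)\<^sup>2))"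
    by (subst ennreal_mult'[symmetric]) (auto intro!: arg_cong[where f = ennreal])
  ultimately have "ennreal (4 * q\<^sup>2) * ?l x \<le> ennreal (4 * q\<^sup>2) * ennreal (513 * (real k)\<^sup>2)" by metis
  then show ?thesis using q
    by (subst (asm) ennreal_mult_le_mult_iff) auto
qed

text \<open>The bound for finite horizons is uniform, so it survives the monotone limit.\<close>

lemma suminf_lowering_le:
  assumes k: "k \<ge> 2" and x: "x \<in> slab k"
  shows "(\<Sum>n. emeasure (glauber_measure k) {\<omega>\<in>space (glauber_measure k). lowering \<omega> x n}) \<le> ennreal (513 * (real k)\<^sup>2)"
proof (rule suminf_le_const)
  let ?M = "glauber_measure k"
  fix N
  have lim: "(\<lambda>i. emeasure ?M (lowering_before x (real i) n)) \<longlonglongrightarrow> emeasure ?M {\<omega>\<in>space ?M. lowering \<omega> x n}" for n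
  proof -
    have "incseq (\<lambda>i. lowering_before x (real i) n)"
      unfolding lowering_before_def by (intro monoI) auto
    moreover have "(\<Union>i. lowering_before x (real i) n) = {\<omega>\<in>space ?M. lowering \<omega> x n}"
      unfolding lowering_before_def by (auto simp: reals_Archimedean2)
    ultimately show ?thesis
      using Lim_emeasure_incseq[of "\<lambda>i. lowering_before x (real i) n" ?M] sets_lowering_before[OF x] by auto
  qed
  have "(\<lambda>i. \<Sum>n<N. emeasure ?M (lowering_before x (real i) n)) \<longlonglongrightarrow> (\<Sum>n<N. emeasure ?M {\<omega>\<in>space ?M. lowering \<omega> x n})"
    by (intro tendsto_sum lim)
  moreover have "(\<Sum>n<N. emeasure ?M (lowering_before x (real i) n)) \<le> ennreal (513 * (real k)\<^sup>2)" for i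
    using suminf_lowering_before_le[OF k x, of "real i"] sum_le_suminf[of "\<lambda>n. emeasure ?M (lowering_before x (real i) n)" "{..<N}"]
    by (auto intro: order_trans)
  ultimately show "(\<Sum>n<N. emeasure ?M {\<omega>\<in>space ?M. lowering \<omega> x n}) \<le> ennreal (513 * (real k)\<^sup>2)"
    by (intro LIMSEQ_le_const2) auto
qed simp

end

section \<open>Configurations that are visited finitely often\<close>

lemma ring_time_upd_ge:
  assumes "m \<le> n" shows "ring_time (w((z, m) := u)) z n = ring_time w z n - w (z, m) + u"
proof -
  have "ring_time w' z n = w' (z, m) + (\<Sum>i\<in>{..n}-{m}. w' (z, i))" for w' :: "site \<times> nat \<Rightarrow> real"
    unfolding ring_time_def using assms by (subst sum.remove[of _ m]) auto
  from this[of w] this[of "w((z, m) := u)"] show ?thesis by simp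
qed

lemma regular_clock_upd:
  assumes "regular_clock w x" "u > 0" shows "regular_clock (w((z, m) := u)) x"
proof (cases "x = z")
  case True
  have "finite {n. ring_time (w((z, m) := u)) z n < t}" for t
  proof (rule finite_subset)
    show "{n. ring_time (w((z, m) := u)) z n < t} \<subseteq> {..<m} \<union> {n. ring_time w z n < t + w (z, m)}"
      using assms(2) by (auto simp: not_less ring_time_upd_ge)
  qed (use assms(1) in \<open>auto simp: regular_clock_def True\<close>)
  then show ?thesis using assms by (auto simp: regular_clock_def True)
next
  case False
  then show ?thesis using assms by (auto simp: regular_clock_def ring_time_upd_other)
qed

text \<open>Finiteness below every real t is replaced by countably many quantifiers, as
  measurability requires.\<close>

lemma regular_clock_iff:
  "regular_clock w x \<longleftrightarrow> (\<forall>n. w (x, n) > 0) \<and> (\<forall>j. \<exists>n. real j \<le> ring_time w x n)"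
proof (intro iffI conjI)
  assume r: "regular_clock w x"
  then show "\<forall>n. w (x, n) > 0" by (simp add: regular_clock_def)
  show "\<forall>j. \<exists>n. real j \<le> ring_time w x n"
  proof
    fix j
    have "{n. ring_time w x n < real j} \<noteq> UNIV" using r by (metis infinite_UNIV_nat regular_clock_def)
    then show "\<exists>n. real j \<le> ring_time w x n" by (auto simp: not_less)
  qed
next
  assume r: "(\<forall>n. w (x, n) > 0) \<and> (\<forall>j. \<exists>n. real j \<le> ring_time w x n)"
  then have mono: "strict_mono (ring_time w x)" by (intro ring_time_strict_mono) simp
  have "finite {n. ring_time w x n < t}" for t
  proof -
    obtain j where j: "t < real j" using reals_Archimedean2 by blast
    obtain n where n: "real j \<le> ring_time w x n" using r by blast
    have "{n. ring_time w x n < t} \<subseteq> {..<n}"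
    proof
      fix i assume "i \<in> {n. ring_time w x n < t}"
      then have "ring_time w x i < ring_time w x n" using j n by simp
      then show "i \<in> {..<n}" by (simp add: strict_mono_less[OF mono])
    qed
    then show ?thesis by (rule finite_subset) simp
  qed
  with r show "regular_clock w x" by (simp add: regular_clock_def)
qed

lemma measurable_regular_clock[measurable]:
  assumes [measurable]: "x \<in> slab k"
  shows "Measurable.pred (glauber_measure k) (\<lambda>\<omega>. regular_clock (fst (snd \<omega>)) x)"
  unfolding regular_clock_iff by measurable

lemma emeasure_count_space_inj_le:
  assumes "inj_on g S" "g ` S \<subseteq> S'"
  shows "emeasure (count_space UNIV) S \<le> emeasure (count_space UNIV) S'"
proof (cases "finite S'")
  case True
  then have "finite S" using assms finite_imageD finite_subset by blast
  then show ?thesis using True assms by (simp add: card_inj_on_le)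
qed simp

text \<open>Both sums count the events that occur in the given sample, so an injection of indices
  compares them even if they are infinite.\<close>

lemma suminf_indicator_inj_le:
  assumes "inj_on g {n::nat. \<omega> \<in> A n}" "\<And>n. \<omega> \<in> A n \<Longrightarrow> \<omega> \<in> A' (g n :: nat)"
  shows "(\<Sum>n. indicator (A n) \<omega> :: ennreal) \<le> (\<Sum>n. indicator (A' n) \<omega>)"
proof -
  have eq: "(\<Sum>n. indicator (A n) \<omega> :: ennreal) = emeasure (count_space UNIV) {n. \<omega> \<in> A n}" for A :: "nat \<Rightarrow> 'a set"
  proof -
    have "(\<Sum>n. indicator (A n) \<omega> :: ennreal) = (\<integral>\<^sup>+n. indicator (A n) \<omega> \<partial>count_space UNIV)"
      by (rule nn_integral_count_space_nat[symmetric])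
    also have "\<dots> = (\<integral>\<^sup>+n. indicator {n. \<omega> \<in> A n} n \<partial>count_space UNIV)"
      by (intro nn_integral_cong) (auto simp: indicator_def)
    finally show ?thesis by simp
  qed
  show ?thesis unfolding eq by (rule emeasure_count_space_inj_le[OF assms(1)]) (use assms(2) in auto)
qed

context slab_dynamics
begin

text \<open>Adaptedness: rings and coins after t do not enter the spins up to t. This permits
  redrawing the first waiting time that ends after t, and the coin of that ring, without changing
  the configuration at t.\<close>

lemma spin_fuel_agree:
  assumes reg: "\<And>y. y \<in> slab k \<Longrightarrow> regular_clock w y" "\<And>y. y \<in> slab k \<Longrightarrow> regular_clock w' y"
    and w: "\<And>y n. y \<in> slab k \<Longrightarrow> ring_time w y n \<le> t \<or> ring_time w' y n \<le> t \<Longrightarrow> ring_time w y n = ring_time w' y n"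
    and c: "\<And>y n. y \<in> slab k \<Longrightarrow> ring_time w y n \<le> t \<Longrightarrow> c (y, n) = c' (y, n)"
  shows "y \<in> slab k \<Longrightarrow> (\<And>i. j = Suc i \<Longrightarrow> ring_time w y i \<le> t) \<Longrightarrow> spin_fuel d s w c y j = spin_fuel d s w' c' y j"
proof (induction d arbitrary: y j)
  case (Suc d)
  show ?case
  proof (cases j)
    case (Suc n)
    have n1: "ring_time w y n \<le> t" using Suc.prems(2)[OF Suc] .
    have n: "ring_time w y n \<le> t" "ring_time w' y n = ring_time w y n"
      using n1 w[OF Suc.prems(1) disjI1[OF n1]] by auto
    have rb: "rings_before w' v (ring_time w y n) = rings_before w v (ring_time w y n)" if v: "v \<in> slab k" for v
    proof (rule nat_eqI_less)
      fix i
      show "i < rings_before w' v (ring_time w y n) \<longleftrightarrow> i < rings_before w v (ring_time w y n)"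
        unfolding less_rings_before_iff[OF reg(1)[OF v]] less_rings_before_iff[OF reg(2)[OF v]]
        using w[OF v, of i] n(1) by linarith
    qed
    have eq: "spin_fuel d s w c v (rings_before w v (ring_time w y n)) = spin_fuel d s w' c' v (rings_before w v (ring_time w y n))"
      if v: "v \<in> slab k" for v
    proof (rule Suc.IH[OF v])
      fix i assume "rings_before w v (ring_time w y n) = Suc i"
      then have "ring_time w v i < ring_time w y n"
        using less_rings_before_iff[OF reg(1)[OF v], of i "ring_time w y n"] by simp
      then show "ring_time w v i \<le> t" using n(1) by simp
    qed
    have nb: "v \<in> slab k" if "v \<in> insert y (neighbours k b y)" for v
      using that Suc.prems(1) neighbours_slab by blast
    have "energy k b (\<lambda>v. spin_fuel d s w c v (rings_before w v (ring_time w y n))) y =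
        energy k b (\<lambda>v. spin_fuel d s w' c' v (rings_before w' v (ring_time w y n))) y"
      by (rule energy_cong) (use nb rb eq in presburger)
    then show ?thesis
      using eq[OF Suc.prems(1)] rb[OF Suc.prems(1)] c[OF Suc.prems(1) n(1)]
      by (simp add: \<open>j = Suc n\<close> Let_def n(2))
  qed simp
qed simp

lemma config_at_agree:
  assumes reg: "\<And>y. y \<in> slab k \<Longrightarrow> regular_clock w y" "\<And>y. y \<in> slab k \<Longrightarrow> regular_clock w' y"
    and w: "\<And>y n. y \<in> slab k \<Longrightarrow> ring_time w y n \<le> t \<or> ring_time w' y n \<le> t \<Longrightarrow> ring_time w y n = ring_time w' y n"
    and c: "\<And>y n. y \<in> slab k \<Longrightarrow> ring_time w y n \<le> t \<Longrightarrow> c (y, n) = c' (y, n)"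
    and y: "y \<in> slab k"
  shows "config_at s w c t y = config_at s w' c' t y"
proof -
  have "rings_upto w' y t = rings_upto w y t"
  proof (rule nat_eqI_less)
    fix i
    show "i < rings_upto w' y t \<longleftrightarrow> i < rings_upto w y t"
      unfolding less_rings_upto_iff[OF reg(1)[OF y]] less_rings_upto_iff[OF reg(2)[OF y]]
      using w[OF y, of i] by linarith
  qed
  moreover have "spin_fuel d s w c y (rings_upto w y t) = spin_fuel d s w' c' y (rings_upto w y t)" for d
  proof (rule spin_fuel_agree[where t = t and w = w and w' = w' and c = c and c' = c', OF reg w c y])
    fix i assume "rings_upto w y t = Suc i"
    then show "ring_time w y i \<le> t" using less_rings_upto_iff[OF reg(1)[OF y], of i t] by simp
  qed
  ultimately show ?thesis by (simp add: config_at_def spin_after_def)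
qed

section \<open>Visits to a local configuration\<close>

definition visits :: "site set \<Rightarrow> (site \<Rightarrow> int) \<Rightarrow> site \<Rightarrow> nat \<Rightarrow> sample set" where
  "visits B f x n = {\<omega>\<in>space (glauber_measure k).
     \<forall>z\<in>B. config_at (fst \<omega>) (fst (snd \<omega>)) (snd (snd \<omega>)) (ring_time (fst (snd \<omega>)) x n) z = f z}"

text \<open>The coin is recorded because at energy zero it decides whether y flips.\<close>

definition departs :: "site set \<Rightarrow> (site \<Rightarrow> int) \<Rightarrow> site \<Rightarrow> int \<Rightarrow> nat \<Rightarrow> sample set" where
  "departs B f y d m = {\<omega>\<in>space (glauber_measure k).
     (\<forall>z\<in>B. config_before (fst \<omega>) (fst (snd \<omega>)) (snd (snd \<omega>)) (ring_time (fst (snd \<omega>)) y m) z = f z)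
     \<and> snd (snd \<omega>) (y, m) = d}"

lemma sets_visits:
  assumes B: "finite B" "B \<subseteq> slab k" and x: "x \<in> slab k"
  shows "visits B f x n \<in> sets (glauber_measure k)"
proof -
  have "{\<omega>\<in>space (glauber_measure k). config_at (fst \<omega>) (fst (snd \<omega>)) (snd (snd \<omega>)) (ring_time (fst (snd \<omega>)) x n) z = f z}
      \<in> sets (glauber_measure k)" if "z \<in> B" for z
  proof -
    have [measurable]: "z \<in> slab k" "x \<in> slab k" using that B x by auto
    show ?thesis by measurable
  qed
  with B(1) show ?thesis unfolding visits_def by (intro sets.sets_Collect_finite_All) auto
qed

lemma sets_departs:
  assumes B: "finite B" "B \<subseteq> slab k" and y: "y \<in> slab k"
  shows "departs B f y d m \<in> sets (glauber_measure k)"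
proof -
  have "{\<omega>\<in>space (glauber_measure k). config_before (fst \<omega>) (fst (snd \<omega>)) (snd (snd \<omega>)) (ring_time (fst (snd \<omega>)) y m) z = f z}
      \<in> sets (glauber_measure k)" if "z \<in> B" for z
  proof -
    have [measurable]: "z \<in> slab k" "y \<in> slab k" using that B y by auto
    show ?thesis by measurable
  qed
  moreover have "{\<omega>\<in>space (glauber_measure k). snd (snd \<omega>) (y, m) = d} \<in> sets (glauber_measure k)"
    using y by measurable
  ultimately show ?thesis
    using B(1) unfolding departs_def by (intro sets.sets_Collect_conj sets.sets_Collect_finite_All) auto
qed

text \<open>Given a visit, y rings within one time unit with probability 1 - 1/e, each other site of
  B stays quiet for that unit with probability 1/e, and the next coin at y is d with probability
  1/2, all independently. In that case the configuration on B is still f when y rings. Different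
  visits of this kind lead to different rings of y, so the expected numbers can be compared.\<close>

lemma suminf_visits_le_departs:
  assumes B: "finite B" "B \<subseteq> slab k" and x: "x \<in> B" and y: "y \<in> B" and d: "d \<in> {-1, 1}"
  shows "ennreal (1/2 * (1 - exp (-1)) * exp (-1) ^ card (B - {y})) * (\<Sum>n. emeasure (glauber_measure k) (visits B f x n))
    \<le> (\<Sum>m. emeasure (glauber_measure k) (departs B f y d m))"
proof -
  let ?M = "glauber_measure k"
  interpret prob_space ?M by (rule prob_space_glauber_measure)
  have xs: "x \<in> slab k" and ys: "y \<in> slab k" using x y B by auto
  note [measurable] = xs ys
  define \<tau> where "\<tau> n \<omega> = ring_time (fst (snd \<omega>)) x n" for n and \<omega> :: sample
  define reg where "reg \<omega> \<longleftrightarrow> (\<forall>z\<in>slab k. regular_clock (fst (snd \<omega>)) z)" for \<omega> :: sample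
  \<comment> \<open>Regularity of the clocks is part of the event because
    \<open>emeasure_quiet\<close> asks for invariance at every sample of the event, not at almost
    every one.\<close>
  define A where "A n Z = {\<omega>\<in>space ?M. (reg \<omega> \<and> \<omega> \<in> visits B f x n) \<and> (\<forall>z\<in>Z. quiet (fst (snd \<omega>)) z (\<tau> n \<omega>) 1)}" for n Z
  define E where "E n = {\<omega>\<in>A n (B - {y}). \<not> quiet (fst (snd \<omega>)) y (\<tau> n \<omega>) 1}" for n
  define F where "F n = {\<omega>\<in>E n. snd (snd \<omega>) (y, rings_upto (fst (snd \<omega>)) y (\<tau> n \<omega>)) = d}" for n
  have [measurable]: "\<tau> n \<in> borel_measurable ?M" for n unfolding \<tau>_def by measurable
  have [measurable]: "Measurable.pred ?M reg"
    unfolding reg_def by (intro pred_intros_countable_bounded countable_slab) measurable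
  have [measurable]: "visits B f x n \<in> sets ?M" for n using sets_visits[OF B xs] .
  have A_sets[measurable]: "A n Z \<in> sets ?M" if "finite Z" "Z \<subseteq> slab k" for n Z
  proof -
    have "{\<omega>\<in>space ?M. quiet (fst (snd \<omega>)) z (\<tau> n \<omega>) 1} \<in> sets ?M" if "z \<in> Z" for z
    proof -
      have [measurable]: "z \<in> slab k" using that \<open>Z \<subseteq> slab k\<close> by auto
      show ?thesis by measurable
    qed
    moreover have "{\<omega>\<in>space ?M. reg \<omega> \<and> \<omega> \<in> visits B f x n} \<in> sets ?M" by measurable
    ultimately show ?thesis unfolding A_def using that(1) by (intro sets.sets_Collect_conj sets.sets_Collect_finite_All) auto
  qed
  have regD: "regular_clock w z" if "reg (s, w, c)" "z \<in> slab k" for s w c z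
    using that by (simp add: reg_def)
  have spaceI: "(s, w((z, m) := u), c) \<in> space ?M" if "(s, w, c) \<in> space ?M" "z \<in> slab k" for s w c z m u
    using that by (auto simp: space_glauber_measure PiE_iff extensional_def)
  have A_inv: "(s, w((z, m) := u), c) \<in> A n Z \<and> \<tau> n (s, w((z, m) := u), c) = \<tau> n (s, w, c)"
    if A: "(s, w, c) \<in> A n Z" and z: "z \<in> slab k" "z \<notin> Z" and u: "u > 0"
      and before: "\<And>j. j < m \<Longrightarrow> ring_time w z j \<le> \<tau> n (s, w, c)" and after: "\<tau> n (s, w, c) < ring_time w z m"
        "\<tau> n (s, w, c) < ring_time (w((z, m) := u)) z m" for s w c m u n Z z
  proof -
    have reg: "reg (s, w, c)" using A by (simp add: A_def)
    have mono: "strict_mono (ring_time w x)" "strict_mono (ring_time (w((z, m) := u)) z)" "strict_mono (ring_time w z)"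
      using regD[OF reg xs] regD[OF reg z(1)] regular_clock_upd[OF regD[OF reg z(1)] u, of z m]
      unfolding regular_clock_def by (blast intro: ring_time_strict_mono)+
    have \<tau>_eq: "\<tau> n (s, w((z, m) := u), c) = \<tau> n (s, w, c)"
    proof (cases "z = x")
      case True
      then have "n < m" using after(1) mono(1) by (simp add: \<tau>_def strict_mono_less)
      then show ?thesis using True by (simp add: \<tau>_def ring_time_upd_less)
    qed (simp add: \<tau>_def ring_time_upd_other)
    have reg': "reg (s, w((z, m) := u), c)" using reg u regular_clock_upd by (auto simp: reg_def)
    have agree: "ring_time w v i = ring_time (w((z, m) := u)) v i"
      if v: "v \<in> slab k" "ring_time w v i \<le> \<tau> n (s, w, c) \<or> ring_time (w((z, m) := u)) v i \<le> \<tau> n (s, w, c)" for v i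
    proof (cases "v = z")
      case True
      have "i < m" using that after strict_mono_less[OF mono(3), of i m] strict_mono_less[OF mono(2), of i m] unfolding True by linarith
      then show ?thesis using True by (simp add: ring_time_upd_less)
    qed (simp add: ring_time_upd_other)
    have cfg: "config_at s (w((z, m) := u)) c (\<tau> n (s, w, c)) v = f v" if v: "v \<in> B" for v
    proof -
      have "config_at s w c (\<tau> n (s, w, c)) v = f v"
        using A v unfolding A_def visits_def \<tau>_def by simp
      moreover have "config_at s w c (\<tau> n (s, w, c)) v = config_at s (w((z, m) := u)) c (\<tau> n (s, w, c)) v"
        by (rule config_at_agree) (use regD[OF reg] regD[OF reg'] agree subsetD[OF B(2) v] in auto)
      ultimately show ?thesis by simp
    qed
    have "(s, w((z, m) := u), c) \<in> visits B f x n"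
      using A \<tau>_eq spaceI[OF _ z(1)] cfg unfolding A_def visits_def \<tau>_def by simp
    moreover have "quiet (w((z, m) := u)) v t 1 = quiet w v t 1" if "v \<in> Z" for v t
      using that z by (intro quiet_upd_other) auto
    ultimately show ?thesis using A \<tau>_eq reg' spaceI[OF _ z(1)] unfolding A_def by auto
  qed
  have tau0: "\<tau> n \<omega> \<ge> 0" if "\<omega> \<in> A n Z" for n Z \<omega>
  proof -
    have "\<And>i. fst (snd \<omega>) (x, i) > 0" using that xs by (auto simp: A_def reg_def regular_clock_def)
    from ring_time_pos[of "fst (snd \<omega>)" x n, OF this] show ?thesis by (simp add: \<tau>_def)
  qed
  have PA: "emeasure ?M (A n Z) = ennreal (exp (-1) ^ card Z) * emeasure ?M (A n {})" if "finite Z" "Z \<subseteq> slab k" for n Z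
    using that
  proof (induction Z rule: finite_induct)
    case (insert z Z)
    have "A n (insert z Z) = {\<omega>\<in>A n Z. quiet (fst (snd \<omega>)) z (\<tau> n \<omega>) 1}" by (auto simp: A_def)
    also have "emeasure ?M \<dots> = ennreal (exp (-1)) * emeasure ?M (A n Z)"
      by (rule emeasure_quiet) (use insert A_inv[of _ _ _ n Z z] tau0 in auto)
    finally show ?case using insert by (simp add: ennreal_mult' mult_ac)
  qed simp
  have E_sets[measurable]: "E n \<in> sets ?M" for n
  proof -
    have [measurable]: "A n (B - {y}) \<in> sets ?M" using B by (intro A_sets) auto
    have "E n = {\<omega>\<in>space ?M. \<omega> \<in> A n (B - {y}) \<and> \<not> quiet (fst (snd \<omega>)) y (\<tau> n \<omega>) 1}"
      by (auto simp: E_def A_def)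
    also have "\<dots> \<in> sets ?M" by measurable
    finally show ?thesis .
  qed
  have PE: "emeasure ?M (E n) = ennreal (1 - exp (-1)) * emeasure ?M (A n (B - {y}))" for n
  proof -
    have "A n (B - {y}) \<in> sets ?M" using B by (intro A_sets) auto
    then show ?thesis
      unfolding E_def by (rule emeasure_not_quiet[OF ys]) (use ys A_inv[of _ _ _ n "B - {y}" y] tau0 in auto)
  qed
  have PF: "emeasure ?M (F n) = 1/2 * emeasure ?M (E n)" for n
    unfolding F_def
  proof (rule emeasure_fresh_coin[OF ys E_sets _ d])
    fix s w c u assume E: "(s, w, c) \<in> E n"
    let ?N = "rings_upto (fst (snd (s, w, c))) y (\<tau> n (s, w, c))"
    let ?c = "c((y, ?N) := u)"
    have reg: "reg (s, w, c)" using E by (simp add: E_def A_def)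
    have sp: "(s, w, ?c) \<in> space ?M"
      using E ys by (auto simp: E_def A_def space_glauber_measure PiE_iff extensional_def)
    have "c (v, i) = ?c (v, i)" if "v \<in> slab k" "ring_time w v i \<le> \<tau> n (s, w, c)" for v i
      using that less_rings_upto_iff[OF regD[OF reg ys], of i "\<tau> n (s, w, c)"] by auto
    then have cfg: "config_at s w ?c (\<tau> n (s, w, c)) v = config_at s w c (\<tau> n (s, w, c)) v" if "v \<in> slab k" for v
      by (intro config_at_agree[symmetric]) (use regD[OF reg] that in auto)
    have "config_at s w ?c (\<tau> n (s, w, c)) v = f v" if v: "v \<in> B" for v
      using E v cfg[OF subsetD[OF B(2) v]] unfolding E_def A_def visits_def \<tau>_def by simp
    then have "(s, w, ?c) \<in> visits B f x n"
      using sp unfolding visits_def \<tau>_def by simp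
    then show "(s, w, ?c) \<in> E n \<and> rings_upto (fst (snd (s, w, ?c))) y (\<tau> n (s, w, ?c)) = ?N"
      using E sp unfolding E_def A_def reg_def \<tau>_def by auto
  qed (rule measurable_rings_upto[OF ys], measurable)
  have "emeasure ?M (visits B f x n) = emeasure ?M (A n {})" for n
  proof (rule emeasure_eq_AE)
    have "AE \<omega> in ?M. reg \<omega>"
      unfolding reg_def by (intro AE_ball_countable' countable_slab AE_regular_clock)
    then show "AE \<omega> in ?M. \<omega> \<in> visits B f x n \<longleftrightarrow> \<omega> \<in> A n {}"
      by eventually_elim (auto simp: A_def visits_def)
  qed auto
  then have PF': "emeasure ?M (F n) = ennreal (1/2 * (1 - exp (-1)) * exp (-1) ^ card (B - {y})) * emeasure ?M (visits B f x n)" for n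
  proof -
    have split: "ennreal (1/2 * a * e) = 1/2 * (ennreal a * ennreal e)" if "a \<ge> 0" for a e
    proof -
      have "ennreal (1/2 * a * e) = ennreal (1/2) * (ennreal a * ennreal e)"
        unfolding mult.assoc by (subst ennreal_mult', simp, subst ennreal_mult', rule that, rule refl)
      then show ?thesis by (simp add: divide_ennreal_def)
    qed
    have "emeasure ?M (A n (B - {y})) = ennreal (exp (-1) ^ card (B - {y})) * emeasure ?M (A n {})"
      using PA[of "B - {y}" n] B by auto
    then show ?thesis
      unfolding PF PE \<open>\<And>n. emeasure ?M (visits B f x n) = emeasure ?M (A n {})\<close>
      by (subst split) (simp_all add: mult.assoc)
  qed
  have F_sets[measurable]: "F n \<in> sets ?M" for n
  proof -
    have 1: "(\<lambda>\<omega>. snd (snd \<omega>) (y, rings_upto (fst (snd \<omega>)) y (\<tau> n \<omega>))) \<in> ?M \<rightarrow>\<^sub>M count_space UNIV"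
      by (rule measurable_compose_countable[of "\<lambda>i \<omega>. snd (snd \<omega>) (y, i)"]) measurable
    have "F n = {\<omega>\<in>space ?M. \<omega> \<in> E n \<and> snd (snd \<omega>) (y, rings_upto (fst (snd \<omega>)) y (\<tau> n \<omega>)) = d}"
      by (auto simp: F_def E_def A_def)
    also have "\<dots> \<in> sets ?M" using 1 by measurable
    finally show ?thesis .
  qed
  note departs_sets = sets_departs[OF B ys]
  have "ennreal (1/2 * (1 - exp (-1)) * exp (-1) ^ card (B - {y})) * (\<Sum>n. emeasure ?M (visits B f x n)) = (\<Sum>n. emeasure ?M (F n))"
    unfolding PF' by (rule ennreal_suminf_cmult[symmetric])
  also have "\<dots> = (\<integral>\<^sup>+\<omega>. (\<Sum>n. indicator (F n) \<omega>) \<partial>?M)"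
    by (subst nn_integral_suminf) auto
  also have "\<dots> \<le> (\<integral>\<^sup>+\<omega>. (\<Sum>m. indicator (departs B f y d m) \<omega>) \<partial>?M)"
  proof (rule nn_integral_mono_AE)
    show "AE \<omega> in ?M. (\<Sum>n. indicator (F n) \<omega> :: ennreal) \<le> (\<Sum>m. indicator (departs B f y d m) \<omega>)"
      using AE_good_sample
    proof eventually_elim
      case (elim \<omega>)
      obtain s w c where \<omega>: "\<omega> = (s, w, c)" by (metis prod_cases3)
      interpret good_sample k b s w c using elim by (simp add: \<omega>)
      have next_ring: "T x n < T y (rings_upto w y (T x n))" "T y (rings_upto w y (T x n)) \<le> T x n + 1" if F: "\<omega> \<in> F n" for n
      proof -
        let ?m = "rings_upto w y (T x n)"
        show gt: "T x n < T y ?m" using less_rings_upto_iff[OF clocks[OF ys], of ?m "T x n"] by simp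
        obtain j where j: "T y j \<in> {T x n<..T x n + 1}"
          using F unfolding F_def E_def \<omega> \<tau>_def quiet_def by auto
        then have "?m \<le> j" using less_rings_upto_iff[OF clocks[OF ys], of j "T x n"] by auto
        then have "T y ?m \<le> T y j" using T_mono[OF ys] by (simp add: strict_mono_less_eq)
        then show "T y ?m \<le> T x n + 1" using j by simp
      qed
      have q: "quiet w z (T x n) 1" if "\<omega> \<in> F n" "z \<in> B - {y}" for n z
        using that unfolding F_def E_def A_def \<omega> \<tau>_def by auto
      show ?case
      proof (rule suminf_indicator_inj_le[where g = "\<lambda>n. rings_upto w y (T x n)"])
        \<comment> \<open>If x differs from y, then x is quiet for one unit after the n-th visit
          while y rings within that unit. The next visit falls on a later ring of x, hence after
          that ring of y.\<close>
        show "inj_on (\<lambda>n. rings_upto w y (T x n)) {n. \<omega> \<in> F n}"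
        proof (rule linorder_inj_onI')
          fix n n' :: nat assume n: "n \<in> {n. \<omega> \<in> F n}" "n' \<in> {n. \<omega> \<in> F n}" "n < n'"
          show "rings_upto w y (T x n) \<noteq> rings_upto w y (T x n')"
          proof (cases "x = y")
            case True
            then show ?thesis using n rings_upto_ring_time[OF clocks[OF ys]] by simp
          next
            case False
            show ?thesis
            proof
              assume "rings_upto w y (T x n) = rings_upto w y (T x n')"
              then have "T x n' < T x n + 1" using next_ring[of n] next_ring[of n'] n by fastforce
              moreover have "T x n < T x n'" using n(3) T_mono[OF xs] by (simp add: strict_mono_less)
              moreover have "T x n' \<notin> {T x n<..T x n + 1}" using q[of n x] n False x unfolding quiet_def by blast
              ultimately show False by simp
            qed
          qed
        qed
      next
        fix n assume F: "\<omega> \<in> F n"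
        let ?m = "rings_upto w y (T x n)"
        have "config_before s w c (T y ?m) z = f z" if z: "z \<in> B" for z
        proof -
          have zs: "z \<in> slab k" using z B by auto
          have "rings_before w z (T y ?m) = rings_upto w z (T x n)"
          proof (rule nat_eqI_less)
            fix i
            show "i < rings_before w z (T y ?m) \<longleftrightarrow> i < rings_upto w z (T x n)"
            proof (cases "z = y")
              case True
              then show ?thesis by (simp add: rings_before_ring_time[OF clocks[OF ys]])
            next
              case False
              then have "T z i \<notin> {T x n<..T x n + 1}" using q[OF F, of z] z unfolding quiet_def by blast
              then show ?thesis
                unfolding less_rings_before_iff[OF clocks[OF zs]] less_rings_upto_iff[OF clocks[OF zs]]
                using next_ring[OF F] by auto
            qed
          qed
          then have "config_before s w c (T y ?m) z = config_at s w c (T x n) z"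
            by (simp add: config_before_def config_at_def)
          also have "\<dots> = f z" using F z unfolding F_def E_def A_def visits_def \<omega> by auto
          finally show ?thesis .
        qed
        moreover have "\<omega> \<in> space ?M" "snd (snd \<omega>) (y, ?m) = d"
          using F unfolding F_def E_def A_def \<tau>_def by (simp_all add: \<omega>)
        ultimately show "\<omega> \<in> departs B f y d ?m"
          unfolding departs_def mem_Collect_eq by (simp only: \<omega> fst_conv snd_conv) blast
      qed
    qed
  qed
  also have "\<dots> = (\<Sum>m. emeasure ?M (departs B f y d m))"
    using departs_sets by (subst nn_integral_suminf) auto
  finally show ?thesis .
qed

text \<open>Only sites with all their neighbours in B take part, so the energies along the sequence,
  and with them the whole notion, depend on the spins in B alone (\<open>live_cong\<close>).\<close>

inductive live :: "site set \<Rightarrow> (site \<Rightarrow> int) \<Rightarrow> bool" for B where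
  lower: "y \<in> B \<Longrightarrow> neighbours k b y \<subseteq> B \<Longrightarrow> energy k b \<eta> y > 0 \<Longrightarrow> live B \<eta>"
| flip: "y \<in> B \<Longrightarrow> neighbours k b y \<subseteq> B \<Longrightarrow> energy k b \<eta> y = 0 \<Longrightarrow> live B (\<eta>(y := - \<eta> y)) \<Longrightarrow> live B \<eta>"

lemma live_cong: "live B \<eta> \<Longrightarrow> (\<And>z. z \<in> B \<Longrightarrow> \<eta> z = \<eta>' z) \<Longrightarrow> live B \<eta>'"
proof (induction arbitrary: \<eta>' rule: live.induct)
  case (lower y \<eta>)
  have "energy k b \<eta>' y = energy k b \<eta> y"
    by (rule energy_cong, rule sym, rule lower.prems) (use lower.hyps in blast)
  with live.lower[OF lower.hyps(1,2), of \<eta>'] show ?case using lower.hyps(3) by simp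
next
  case (flip y \<eta>)
  have e: "energy k b \<eta>' y = energy k b \<eta> y"
    by (rule energy_cong, rule sym, rule flip.prems) (use flip.hyps in blast)
  have "live B (\<eta>'(y := - \<eta>' y))"
  proof (rule flip.IH)
    fix z assume "z \<in> B"
    then show "(\<eta>(y := - \<eta> y)) z = (\<eta>'(y := - \<eta>' y)) z"
      using flip.prems[of z] flip.prems[OF flip.hyps(1)] by simp
  qed
  from live.flip[OF flip.hyps(1,2) _ this] show ?case using flip.hyps(3) e by simp
qed

text \<open>Induction along the sequence of flips. Visits are controlled by departures with a
  prescribed coin; these are lowering rings at the last step of the sequence, and visits to the next
  configuration at every earlier one.\<close>

lemma suminf_visits_finite:
  assumes k: "k \<ge> 2" and B: "finite B" "B \<subseteq> slab k"
  shows "live B f \<Longrightarrow> (\<And>z. z \<in> B \<Longrightarrow> f z \<in> {-1, 1}) \<Longrightarrow> x \<in> B \<Longrightarrow> (\<Sum>n. emeasure (glauber_measure k) (visits B f x n)) < \<infinity>"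
proof (induction arbitrary: x rule: live.induct)
  have *: "(\<Sum>n. emeasure (glauber_measure k) (visits B \<eta> x n)) < \<infinity>"
    if "x \<in> B" "y \<in> B" "d \<in> {-1, 1}" "(\<Sum>m. emeasure (glauber_measure k) (departs B \<eta> y d m)) < \<infinity>" for x y d \<eta>
  proof -
    have "ennreal (1/2 * (1 - exp (-1)) * exp (-1) ^ card (B - {y})) > 0" by simp
    moreover have "ennreal (1/2 * (1 - exp (-1)) * exp (-1) ^ card (B - {y})) * (\<Sum>n. emeasure (glauber_measure k) (visits B \<eta> x n)) < \<infinity>"
      using suminf_visits_le_departs[OF B that(1,2,3), of \<eta>] that(4) by (rule le_less_trans)
    ultimately show ?thesis by (auto simp: ennreal_mult_less_top)
  qed
  {
    case (lower y \<eta>)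
    have ys: "y \<in> slab k" using lower B by auto
    \<comment> \<open>At positive energy the flip happens for either coin, so the value 1 is an
      arbitrary choice.\<close>
    have "emeasure (glauber_measure k) (departs B \<eta> y 1 m) \<le> emeasure (glauber_measure k) {\<omega>\<in>space (glauber_measure k). lowering \<omega> y m}" for m
    proof (rule emeasure_mono)
      show "departs B \<eta> y 1 m \<subseteq> {\<omega>\<in>space (glauber_measure k). lowering \<omega> y m}"
      proof
        fix \<omega> assume \<omega>: "\<omega> \<in> departs B \<eta> y 1 m"
        have "energy k b (config_before (fst \<omega>) (fst (snd \<omega>)) (snd (snd \<omega>)) (ring_time (fst (snd \<omega>)) y m)) y = energy k b \<eta> y"
          using \<omega> lower by (intro energy_cong) (auto simp: departs_def)
        then show "\<omega> \<in> {\<omega>\<in>space (glauber_measure k). lowering \<omega> y m}"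
          using \<omega> lower by (simp add: departs_def lowering_alt)
      qed
      show "{\<omega>\<in>space (glauber_measure k). lowering \<omega> y m} \<in> sets (glauber_measure k)" using ys by measurable
    qed
    then have "(\<Sum>m. emeasure (glauber_measure k) (departs B \<eta> y 1 m)) \<le> (\<Sum>m. emeasure (glauber_measure k) {\<omega>\<in>space (glauber_measure k). lowering \<omega> y m})"
      by (intro suminf_le) auto
    also have "\<dots> \<le> ennreal (513 * (real k)\<^sup>2)" by (rule suminf_lowering_le[OF k ys])
    also have "\<dots> < \<infinity>" by simp
    finally show ?case using lower by (intro *[of x y 1]) auto
  next
    case (flip y \<eta>)
    have ys: "y \<in> slab k" using flip B by auto
    let ?\<eta> = "\<eta>(y := - \<eta> y)"
    have pm: "\<eta> y \<in> {-1, 1}" using flip by blast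
    have "emeasure (glauber_measure k) (departs B \<eta> y (- \<eta> y) m) \<le> emeasure (glauber_measure k) (visits B ?\<eta> y m)" for m
    proof (rule emeasure_mono_AE)
      show "AE \<omega> in glauber_measure k. \<omega> \<in> departs B \<eta> y (- \<eta> y) m \<longrightarrow> \<omega> \<in> visits B ?\<eta> y m"
        using AE_good_sample
      proof eventually_elim
        case (elim \<omega>)
        obtain s w c where \<omega>: "\<omega> = (s, w, c)" by (metis prod_cases3)
        interpret good_sample k b s w c using elim by (simp add: \<omega>)
        show ?case
        proof
          assume dep: "\<omega> \<in> departs B \<eta> y (- \<eta> y) m"
          then have bef: "before (T y m) z = \<eta> z" if "z \<in> B" for z using that by (simp add: departs_def \<omega>)
          have "energy k b (before (T y m)) y = energy k b \<eta> y" using bef flip by (intro energy_cong) auto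
          then have "at_time (T y m) y = - \<eta> y"
            using dep flip unfolding at_ring[OF ys] spin_Suc[OF ys] by (simp add: updated_spin_def departs_def \<omega>)
          moreover have "at_time (T y m) z = \<eta> z" if "z \<in> B" "z \<noteq> y" for z
            using at_ring_other[OF ys, of z m] bef[OF that(1)] that B by auto
          ultimately show "\<omega> \<in> visits B ?\<eta> y m"
            using dep unfolding visits_def departs_def \<omega> by auto
        qed
      qed
    qed (rule sets_visits[OF B ys])
    then have "(\<Sum>m. emeasure (glauber_measure k) (departs B \<eta> y (- \<eta> y) m)) \<le> (\<Sum>m. emeasure (glauber_measure k) (visits B ?\<eta> y m))"
      by (intro suminf_le) auto
    also have "\<dots> < \<infinity>" using flip.prems pm by (intro flip.IH flip.hyps) auto
    finally have "(\<Sum>m. emeasure (glauber_measure k) (departs B \<eta> y (- \<eta> y) m)) < \<infinity>" .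
    moreover have "- \<eta> y \<in> {-1, 1}" using pm by auto
    ultimately show ?case using *[of x y "- \<eta> y" \<eta>] flip.hyps(1) flip.prems(2) by blast
  }
qed

text \<open>A box carries finitely many spin assignments, and there are countably many boxes. All of
  them are covered by one null set because in three layers the relevant box depends on the
  sample.\<close>

lemma AE_finite_live:
  assumes k: "k \<ge> 2"
  shows "AE \<omega> in glauber_measure k. \<forall>L. \<forall>x\<in>site_box k L.
    finite {n. live (site_box k L) (config_at (fst \<omega>) (fst (snd \<omega>)) (snd (snd \<omega>)) (ring_time (fst (snd \<omega>)) x n))}"
proof (intro AE_all_countable[THEN iffD2] allI AE_ball_countable')
  fix L x assume x: "x \<in> site_box k L"
  interpret prob_space "glauber_measure k" by (rule prob_space_glauber_measure)
  let ?B = "site_box k L"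
  note B = finite_site_box[of k L] site_box_subset_slab[of k L]
  define P where "P = {f \<in> ?B \<rightarrow>\<^sub>E {-1, 1 :: int}. live ?B f}"
  have finP: "finite P" unfolding P_def using B by (simp add: finite_PiE)
  have "AE \<omega> in glauber_measure k. \<forall>f\<in>P. finite {n. \<omega> \<in> visits ?B f x n}"
    using finP
  proof (intro AE_ball_countable' countable_finite)
    fix f assume f: "f \<in> P"
    show "AE \<omega> in glauber_measure k. finite {n. \<omega> \<in> visits ?B f x n}"
    proof (rule AE_finite_of_suminf)
      show "visits ?B f x n \<in> events" for n using x B by (intro sets_visits) auto
      show "(\<Sum>n. emeasure (glauber_measure k) (visits ?B f x n)) < \<infinity>"
        using f x by (intro suminf_visits_finite[OF k B]) (auto simp: P_def PiE_iff)
    qed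
  qed
  then show "AE \<omega> in glauber_measure k. finite {n. live ?B (config_at (fst \<omega>) (fst (snd \<omega>)) (snd (snd \<omega>)) (ring_time (fst (snd \<omega>)) x n))}"
    using AE_good_sample AE_space
  proof eventually_elim
    case (elim \<omega>)
    obtain s w c where \<omega>: "\<omega> = (s, w, c)" by (metis prod_cases3)
    interpret good_sample k b s w c using elim by (simp add: \<omega>)
    have "{n. live ?B (at_time (T x n))} \<subseteq> (\<Union>f\<in>P. {n. \<omega> \<in> visits ?B f x n})"
    proof
      fix n assume n: "n \<in> {n. live ?B (at_time (T x n))}"
      let ?f = "restrict (at_time (T x n)) ?B"
      have "live ?B ?f" by (rule live_cong[of _ "at_time (T x n)"]) (use n in auto)
      moreover have "at_time t z \<in> {-1, 1}" if "z \<in> ?B" for t z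
        unfolding config_at_def using that B spin_pm1 by blast
      ultimately have "?f \<in> P" unfolding P_def by (simp add: PiE_iff)
      moreover have "\<omega> \<in> visits ?B ?f x n" using elim by (simp add: visits_def \<omega>)
      ultimately show "n \<in> (\<Union>f\<in>P. {n. \<omega> \<in> visits ?B f x n})" by blast
    qed
    moreover have "finite (\<Union>f\<in>P. {n. \<omega> \<in> visits ?B f x n})" using finP elim by simp
    ultimately show ?case unfolding \<omega> by (simp add: finite_subset)
  qed
qed (use finite_site_box countable_finite in blast)

end

section \<open>Certificates for lowering sequences\<close>

text \<open>A list rather than a set, in order to carry multiplicities: for k = 2 the two vertical
  entries are the same site, counted twice as the periodic boundary condition demands.\<close>

fun nbl :: "nat \<Rightarrow> site \<Rightarrow> site list" where
  "nbl k (x, y, z) = [(x + 1, y, z), (x - 1, y, z), (x, y + 1, z), (x, y - 1, z),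
     (x, y, (z + 1) mod int k), (x, y, (z - 1) mod int k)]"

text \<open>A certificate that a lowering flip can be reached from every configuration extending a
  partial assignment of spins: either a sequence of flips, each at a site with at least three
  known disagreeing neighbours and the last at one with at least four, or a case distinction.\<close>

datatype cert = Script "site list" | Split site cert cert

text \<open>The value 0 stands for an unknown spin. The first entry of a site wins, so a flip is
  recorded by putting the new spin in front.\<close>

fun spin_in :: "(site \<times> int) list \<Rightarrow> site \<Rightarrow> int" where
  "spin_in [] u = 0"
| "spin_in ((v, s) # A) u = (if v = u then s else spin_in A u)"

fun count_spin :: "(site \<times> int) list \<Rightarrow> int \<Rightarrow> site list \<Rightarrow> int" where
  "count_spin A s [] = 0"
| "count_spin A s (v # vs) = (if spin_in A v = s then 1 + count_spin A s vs else count_spin A s vs)"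

fun window :: "nat \<Rightarrow> site \<Rightarrow> bool" where
  "window k (x, y, z) \<longleftrightarrow> -2 \<le> x \<and> x \<le> 2 \<and> -2 \<le> y \<and> y \<le> 2 \<and> 0 \<le> z \<and> z < int k"

text \<open>Among six neighbours, d known disagreeing ones force an energy of at least 2 d - 6,
  whatever the unknown spins are. This is positive for d = 4; for d = 3 the flip is either lowering
  already or has energy exactly zero and may be made.\<close>

fun check_script :: "nat \<Rightarrow> (site \<times> int) list \<Rightarrow> site list \<Rightarrow> bool" where
  "check_script k A [] \<longleftrightarrow> False"
| "check_script k A (u # us) \<longleftrightarrow> (let s = spin_in A u; d = count_spin A (- s) (nbl k u)
     in window k u \<and> s \<noteq> 0 \<and> (if 4 \<le> d then True else if d = 3 then check_script k ((u, - s) # A) us else False))"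

fun check :: "nat \<Rightarrow> (site \<times> int) list \<Rightarrow> cert \<Rightarrow> bool" where
  "check k A (Script us) \<longleftrightarrow> check_script k A us"
| "check k A (Split u c c') \<longleftrightarrow> check k ((u, 1) # A) c \<and> check k ((u, -1) # A) c'"

text \<open>By symmetry the spin at the origin is -1. The opposite spin in its column counts twice
  against it, so energy zero means that exactly one of the four neighbours in the layer disagrees; a
  rotation puts it at (1, 0, 0).\<close>

lemma check_mixed_column:
  "check 2 [((0, 0, 0), -1), ((0, 0, 1), 1), ((1, 0, 0), 1), ((-1, 0, 0), -1), ((0, 1, 0), -1), ((0, -1, 0), -1)]
     (Split (0, 1, 1) (Split (1, 1, 0) (Script [(0, 0, 0), (0, 1, 0)]) (Split (-1, 1, 0) (Script [(0, 0, 0), (0, 1,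
      0)]) (Split (1, 1, 1) (Script [(0, 0, 0), (0, 1, 0), (1, 1, 0)]) (Split (-1, 1, 1) (Split (-1, 0, 1) (Script
      [(0, 0, 0), (-1, 0, 0), (0, 1, 0), (-1, 1, 0)]) (Script [(0, 0, 1), (0, 1, 1)])) (Script [(0, 1, 1)])))))
      (Split (-1, 0, 1) (Split (-1, 1, 0) (Script [(0, 0, 0), (-1, 0, 0)]) (Split (-1, 1, 1) (Script [(0, 0, 1),
      (-1, 0, 1), (-1, 1, 1)]) (Script [(0, 0, 1), (-1, 0, 1)]))) (Script [(0, 0, 1)])))"
  by code_simp

text \<open>A minority spin of its column at energy zero, with its one disagreeing neighbour of the
  layer at (1, 0, 0). The spin at (-1, 0, 1) excludes that the column behind has the same minority
  spin; in the excluded case the situation moves on to that column, see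
  \<open>minority_slides\<close>.\<close>

lemma check_minority:
  "check 3 [((0, 0, 0), -1), ((0, 0, 1), 1), ((0, 0, 2), 1), ((1, 0, 0), 1), ((-1, 0, 0), -1), ((0, 1, 0), -1),
       ((0, -1, 0), -1), ((-1, 0, 1), -1)]
     (Split (0, -1, 1) (Split (0, -1, 2) (Split (1, -1, 0) (Script [(0, -1, 0), (0, 0, 0)]) (Split (1, -1, 1) (Split
      (1, -1, 2) (Script [(0, 0, 0), (1, -1, 0), (0, -1, 0)]) (Split (1, 0, 2) (Script [(0, 0, 0), (0, -1, 0), (1,
      -1, 2), (1, -1, 0)]) (Split (1, 0, 1) (Split (1, 1, 0) (Split (1, 1, 2) (Script [(1, 0, 2)]) (Split (1, 1, 1)
      (Split (0, 1, 2) (Script [(1, 0, 2), (1, 1, 2)]) (Split (-1, 0, 2) (Split (0, 1, 1) (Split (-1, 1, 2) (Script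
      [(0, 0, 0), (0, 1, 2), (0, 1, 0)]) (Script [(0, 0, 2), (-1, 0, 2)])) (Script [(0, 0, 1), (0, 0, 2)])) (Script
      [(0, 0, 2)]))) (Script [(1, 1, 0), (1, 0, 0)]))) (Script [(1, 0, 0)])) (Script [(1, 0, 0)])))) (Split (1, 0,
      2) (Split (1, 0, 1) (Split (1, -1, 2) (Script [(1, -1, 1), (1, -1, 0), (0, -1, 0), (0, 0, 0)]) (Split (0, 1,
      2) (Split (1, 1, 0) (Split (0, 1, 1) (Script [(0, 0, 0), (0, 1, 0)]) (Split (1, 1, 1) (Script [(0, 1, 1), (0,
      1, 0), (0, 0, 0)]) (Split (1, 1, 2) (Script [(1, 1, 1), (0, 1, 1), (0, 1, 0), (0, 0, 0)]) (Script [(0, 0, 1),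
      (1, 1, 0), (1, 0, 0), (1, 0, 1)])))) (Split (0, 1, 1) (Split (1, 1, 1) (Split (1, 1, 2) (Script [(0, 0, 0),
      (0, 1, 0), (1, 1, 0)]) (Script [(0, 0, 0), (0, 1, 0), (1, 1, 2), (1, 1, 0)])) (Split (1, 1, 2) (Script [(1, 1,
      1), (1, 1, 0), (0, 1, 0), (0, 0, 0)]) (Script [(1, 0, 0), (1, 0, 1), (1, 0, 2)]))) (Split (1, 1, 1) (Split (1,
      1, 2) (Script [(0, 0, 0), (0, 1, 1), (0, 1, 0), (1, 1, 0)]) (Script [(0, 0, 1), (1, 0, 0), (1, 0, 2), (1, 0,
      1)])) (Script [(1, 0, 0), (1, 0, 1), (0, 0, 1)])))) (Split (-1, -1, 1) (Split (-1, 0, 2) (Split (-1, 1, 1)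
      (Script [(-1, 0, 1)]) (Split (-1, 1, 0) (Script [(0, 0, 0), (-1, 0, 0), (-1, 0, 1)]) (Split (0, 1, 1) (Script
      [(0, 1, 1), (0, 0, 1), (0, -1, 1), (0, 0, 2), (0, -1, 2)]) (Split (-1, 1, 2) (Script [(-1, 1, 2), (-1, 0, 2),
      (0, 0, 1), (0, 0, 2)]) (Script [(0, 0, 1), (0, 0, 2), (-1, 0, 2)]))))) (Script [(0, 0, 2), (0, 0, 1), (0, -1,
      1), (0, -1, 2)])) (Script [(0, -1, 1), (0, 0, 1), (0, 0, 2), (0, -1, 2)])))) (Split (1, 1, 1) (Script [(1, 0,
      1)]) (Split (1, 1, 0) (Split (0, 1, 1) (Split (0, 1, 2) (Script [(0, 0, 0), (0, 1, 0)]) (Script [(0, 0, 1),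
      (0, 1, 1)])) (Script [(0, 0, 1)])) (Script [(1, 0, 0)])))) (Split (1, 0, 1) (Split (1, 1, 0) (Split (1, 1, 2)
      (Script [(1, 0, 2)]) (Split (1, 1, 1) (Split (0, 1, 2) (Script [(1, 0, 2), (1, 1, 2)]) (Split (-1, 0, 2)
      (Split (0, 1, 1) (Split (-1, 1, 2) (Script [(0, 0, 0), (0, 1, 2), (0, 1, 0)]) (Script [(0, 0, 2), (-1, 0,
      2)])) (Script [(0, 0, 1), (0, 0, 2)])) (Script [(0, 0, 2)]))) (Script [(1, 0, 0), (1, 0, 1)]))) (Script [(1,
      0, 0)])) (Script [(1, 0, 0)]))))) (Split (1, 0, 2) (Split (0, 1, 1) (Split (0, 1, 2) (Split (1, 1, 0) (Script
      [(0, 0, 0), (0, 1, 0)]) (Split (1, 1, 2) (Split (1, 1, 1) (Script [(0, 0, 0), (0, 1, 0), (1, 1, 0)]) (Split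
      (1, 0, 1) (Script [(1, 1, 1), (1, 1, 0), (0, 1, 0), (0, 0, 0)]) (Split (1, -1, 1) (Script [(1, 0, 1)]) (Script
      [(0, 0, 1), (0, -1, 1)])))) (Split (1, 1, 1) (Script [(0, 0, 0), (0, 1, 0), (1, 1, 2), (1, 1, 0)]) (Split (-1,
      1, 1) (Split (-1, -1, 1) (Split (-1, 0, 2) (Script [(-1, 0, 1)]) (Split (1, -1, 1) (Split (1, -1, 0) (Split
      (1, -1, 2) (Script [(0, 0, 0), (0, -1, 0), (0, -1, 2)]) (Script [(0, 0, 0), (1, -1, 2), (0, -1, 2), (0, -1,
      0)])) (Split (1, -1, 2) (Script [(0, 0, 0), (1, -1, 0), (0, -1, 0), (0, -1, 2)]) (Script [(1, 0, 0), (1, 0,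
      2), (0, 0, 2)]))) (Script [(0, -1, 1), (0, 0, 1), (0, 0, 2)]))) (Script [(0, -1, 1), (0, 0, 1), (0, 0, 2), (0,
      1, 1), (0, 1, 2)])) (Script [(0, 1, 1), (0, 1, 2), (0, 0, 2), (0, 0, 1)]))))) (Split (-1, 0, 2) (Split (-1, 1,
      2) (Split (-1, -1, 2) (Split (1, 1, 2) (Script [(0, 1, 2)]) (Split (1, 1, 0) (Script [(0, 0, 0), (0, 1, 2),
      (0, 1, 0)]) (Split (1, -1, 2) (Script [(0, -1, 2)]) (Split (1, -1, 0) (Script [(0, -1, 2), (0, -1, 0), (0, 0,
      0)]) (Script [(0, 0, 2), (1, 0, 2), (1, 0, 0)]))))) (Script [(-1, 0, 2), (0, 0, 2)])) (Script [(-1, 0, 2), (0,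
      0, 2)])) (Script [(0, 0, 2)]))) (Split (-1, 0, 2) (Split (1, -1, 1) (Split (-1, -1, 2) (Split (1, -1, 2)
      (Script [(0, -1, 2)]) (Split (1, -1, 0) (Script [(0, -1, 2), (0, -1, 0), (0, 0, 0)]) (Script [(0, -1, 2), (1,
      -1, 2), (1, -1, 0), (0, -1, 0), (0, 0, 0)]))) (Script [(-1, 0, 2), (0, 0, 1), (0, 0, 2)])) (Script [(0, -1,
      1), (0, 0, 1)])) (Script [(0, 0, 1), (0, 0, 2)]))) (Split (0, 1, 2) (Split (-1, 0, 2) (Split (0, 1, 1) (Split
      (-1, -1, 2) (Split (1, 1, 0) (Script [(0, 0, 0), (0, 1, 0)]) (Split (1, -1, 0) (Script [(0, -1, 2), (0, -1,
      0), (0, 0, 0)]) (Script [(1, 0, 0)]))) (Script [(0, 0, 2), (-1, 0, 2)])) (Script [(0, 0, 1), (0, 0, 2)]))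
      (Script [(0, 0, 2)])) (Script [(0, 0, 2)])))) (Split (1, 0, 1) (Split (0, 1, 1) (Split (0, 1, 2) (Split (1, 1,
      0) (Script [(0, 0, 0), (0, 1, 0)]) (Split (1, 1, 1) (Split (1, 1, 2) (Script [(0, 0, 0), (0, 1, 0), (1, 1,
      0)]) (Split (1, 0, 2) (Script [(0, 0, 0), (0, 1, 0), (1, 1, 2), (1, 1, 0)]) (Script [(0, 0, 0), (0, 1, 0), (1,
      0, 2), (1, 1, 2), (1, 1, 0)]))) (Split (1, 1, 2) (Script [(1, 1, 1), (1, 1, 0), (0, 1, 0), (0, 0, 0)]) (Split
      (0, -1, 2) (Split (1, -1, 1) (Split (1, -1, 0) (Script [(0, -1, 1), (0, 0, 0), (0, -1, 0)]) (Split (1, -1, 2)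
      (Script [(0, -1, 1), (1, -1, 0), (0, -1, 0), (0, 0, 0)]) (Script [(0, 0, 1), (1, -1, 1), (1, 0, 0), (1, 0,
      1)]))) (Split (1, -1, 0) (Split (1, -1, 2) (Script [(0, 0, 0), (0, -1, 0), (1, -1, 1), (0, -1, 1)]) (Script
      [(0, 0, 1), (1, -1, 0), (1, 0, 1), (1, 0, 0)])) (Script [(0, 0, 1), (1, 0, 1), (1, 0, 0)]))) (Script [(0, 0,
      1), (0, 0, 2), (0, 1, 1), (0, 1, 2)]))))) (Split (1, 1, 1) (Split (-1, 0, 2) (Split (1, 0, 2) (Split (-1, 1,
      2) (Split (1, 1, 2) (Script [(0, 1, 2)]) (Split (1, 1, 0) (Script [(0, 0, 0), (0, 1, 2), (0, 1, 0)]) (Script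
      [(0, 1, 2), (1, 1, 2), (1, 1, 0), (0, 1, 0), (0, 0, 0)]))) (Script [(-1, 0, 2), (0, 0, 2), (0, 0, 1)]))
      (Script [(0, 0, 2), (0, 0, 1)])) (Script [(0, 0, 2), (0, 0, 1)])) (Script [(0, 1, 1), (0, 0, 1)]))) (Script
      [(0, 0, 1)])) (Script [(0, 0, 1)])))"
  by code_simp


lemma abs_sum3_eq_1:
  fixes a b c :: int
  assumes "\<bar>a\<bar> + \<bar>b\<bar> + \<bar>c\<bar> = 1"
  obtains "a = 1" "b = 0" "c = 0" | "a = -1" "b = 0" "c = 0" | "a = 0" "b = 1" "c = 0" |
    "a = 0" "b = -1" "c = 0" | "a = 0" "b = 0" "c = 1" | "a = 0" "b = 0" "c = -1"
proof -
  have "a = -1 \<or> a = 0 \<or> a = 1" "b = -1 \<or> b = 0 \<or> b = 1" "c = -1 \<or> c = 0 \<or> c = 1" using assms by linarith+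
  then show thesis using assms that by (elim disjE) simp_all
qed

lemma neighboursD:
  assumes "(x', y', z') \<in> neighbours k b (x, y, z)"
  shows "0 \<le> z' \<and> z' < int k \<and> (x' = x + 1 \<and> y' = y \<and> z' = z \<or> x' = x - 1 \<and> y' = y \<and> z' = z \<or>
    x' = x \<and> y' = y + 1 \<and> z' = z \<or> x' = x \<and> y' = y - 1 \<and> z' = z \<or>
    x' = x \<and> y' = y \<and> (z' = z + 1 \<or> z' = z - 1 \<or> z = 0 \<and> z' = int k - 1 \<or> z = int k - 1 \<and> z' = 0))"
proof -
  have z: "0 \<le> z'" "z' < int k" using assms by (auto simp: neighbours_def slab_def)
  have "\<bar>x - x'\<bar> + \<bar>y - y'\<bar> + \<bar>z - z'\<bar> = 1 \<or> x = x' \<and> y = y' \<and> {z, z'} = {0, int k - 1}"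
    using assms by (auto simp: neighbours_def edge_mult_def split: if_splits)
  then show ?thesis
  proof (elim disjE abs_sum3_eq_1 conjE)
    assume "x = x'" "y = y'" "{z, z'} = {0, int k - 1}"
    then show ?thesis using z by (simp add: doubleton_eq_iff)
  qed (use z in simp_all)
qed

lemma neighbours_periodic:
  shows "neighbours 2 Periodic (x, y, 0) = {(x+1,y,0), (x-1,y,0), (x,y+1,0), (x,y-1,0), (x,y,1)}"
    and "neighbours 2 Periodic (x, y, 1) = {(x+1,y,1), (x-1,y,1), (x,y+1,1), (x,y-1,1), (x,y,0)}"
    and "neighbours 3 Periodic (x, y, 0) = {(x+1,y,0), (x-1,y,0), (x,y+1,0), (x,y-1,0), (x,y,1), (x,y,2)}"
    and "neighbours 3 Periodic (x, y, 1) = {(x+1,y,1), (x-1,y,1), (x,y+1,1), (x,y-1,1), (x,y,2), (x,y,0)}"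
    and "neighbours 3 Periodic (x, y, 2) = {(x+1,y,2), (x-1,y,2), (x,y+1,2), (x,y-1,2), (x,y,0), (x,y,1)}"
proof -
  have *: "neighbours k Periodic (x, y, z) = S"
    if "\<And>x' y' z'. (x', y', z') \<in> neighbours k Periodic (x, y, z) \<Longrightarrow> (x', y', z') \<in> S"
      "S \<subseteq> neighbours k Periodic (x, y, z)" for k z S
    using that by (intro equalityI subsetI) (metis prod_cases3, blast)
  show "neighbours 2 Periodic (x, y, 0) = {(x+1,y,0), (x-1,y,0), (x,y+1,0), (x,y-1,0), (x,y,1)}"
    by (rule *, drule neighboursD, force) (simp add: neighbours_def edge_mult_def slab_def doubleton_eq_iff)
  show "neighbours 2 Periodic (x, y, 1) = {(x+1,y,1), (x-1,y,1), (x,y+1,1), (x,y-1,1), (x,y,0)}"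
    by (rule *, drule neighboursD, force) (simp add: neighbours_def edge_mult_def slab_def doubleton_eq_iff)
  show "neighbours 3 Periodic (x, y, 0) = {(x+1,y,0), (x-1,y,0), (x,y+1,0), (x,y-1,0), (x,y,1), (x,y,2)}"
    by (rule *, drule neighboursD, force) (simp add: neighbours_def edge_mult_def slab_def doubleton_eq_iff)
  show "neighbours 3 Periodic (x, y, 1) = {(x+1,y,1), (x-1,y,1), (x,y+1,1), (x,y-1,1), (x,y,2), (x,y,0)}"
    by (rule *, drule neighboursD, force) (simp add: neighbours_def edge_mult_def slab_def doubleton_eq_iff)
  show "neighbours 3 Periodic (x, y, 2) = {(x+1,y,2), (x-1,y,2), (x,y+1,2), (x,y-1,2), (x,y,0), (x,y,1)}"
    by (rule *, drule neighboursD, force) (simp add: neighbours_def edge_mult_def slab_def doubleton_eq_iff)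
qed

text \<open>For k = 2 the double edge becomes a repeated entry of the list. For k = 3 any two layers
  of a column are joined by exactly one edge, vertical or wrapping.\<close>

lemma energy_nbl:
  assumes k: "k = 2 \<or> k = 3" and u: "u \<in> slab k"
  shows "energy k Periodic \<eta> u = - (\<Sum>v\<leftarrow>nbl k u. \<eta> u * \<eta> v)"
proof -
  obtain x y z where xyz: "u = (x, y, z)" by (metis prod_cases3)
  consider "k = 2" "z = 0" | "k = 2" "z = 1" | "k = 3" "z = 0" | "k = 3" "z = 1" | "k = 3" "z = 2"
    using k u by (force simp: xyz slab_def)
  then show ?thesis
    by cases (simp_all add: xyz energy_def neighbours_periodic edge_mult_def doubleton_eq_iff)
qed

lemma nbl_slab: "k = 2 \<or> k = 3 \<Longrightarrow> u \<in> slab k \<Longrightarrow> set (nbl k u) \<subseteq> slab k"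
  by (cases u) (auto simp: slab_def)

section \<open>Transporting certificates by symmetries\<close>

abbreviation plive :: "nat \<Rightarrow> site set \<Rightarrow> (site \<Rightarrow> int) \<Rightarrow> bool" where
  "plive k \<equiv> slab_dynamics.live k Periodic"

text \<open>The map \<phi> places the coordinates of the certificate in the slab. The sign \<sigma>
  allows a global change of spins, under which all energies are invariant.\<close>

definition agrees :: "nat \<Rightarrow> (site \<Rightarrow> site) \<Rightarrow> int \<Rightarrow> (site \<Rightarrow> int) \<Rightarrow> (site \<times> int) list \<Rightarrow> bool" where
  "agrees k \<phi> \<sigma> \<eta> A \<longleftrightarrow> (\<forall>v\<in>slab k. spin_in A v \<noteq> 0 \<longrightarrow> \<eta> (\<phi> v) = \<sigma> * spin_in A v)"

lemma agrees_Nil: "agrees k \<phi> \<sigma> \<eta> []"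
  by (simp add: agrees_def)

lemma agrees_Cons: "\<eta> (\<phi> u) = \<sigma> * s \<Longrightarrow> agrees k \<phi> \<sigma> \<eta> A \<Longrightarrow> agrees k \<phi> \<sigma> \<eta> ((u, s) # A)"
  unfolding agrees_def by simp

text \<open>Sums over neighbour lists are compared, not the lists, since a symmetry may permute the
  neighbours. The last assumption keeps every site that a script flips, together with its
  neighbours, inside B.\<close>

locale local_embedding =
  fixes k :: nat and \<phi> :: "site \<Rightarrow> site" and \<sigma> :: int and B :: "site set"
  assumes k: "k = 2 \<or> k = 3" and \<sigma>: "\<sigma> \<in> {-1, 1}"
    and inj: "inj_on \<phi> (slab k)" and slab: "\<And>u. u \<in> slab k \<Longrightarrow> \<phi> u \<in> slab k"
    and nbl: "\<And>u g. u \<in> slab k \<Longrightarrow> (\<Sum>v\<leftarrow>nbl k (\<phi> u). g v :: int) = (\<Sum>v\<leftarrow>nbl k u. g (\<phi> v))"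
    and interior: "\<And>u. window k u \<Longrightarrow> \<phi> u \<in> B \<and> neighbours k Periodic (\<phi> u) \<subseteq> B"
begin

lemma window_slab: "window k u \<Longrightarrow> u \<in> slab k"
  by (cases u) (simp add: slab_def)

lemma sum_le_count:
  assumes ag: "agrees k \<phi> \<sigma> \<eta> A" and pm: "\<And>v. v \<in> slab k \<Longrightarrow> \<eta> (\<phi> v) \<in> {-1, 1}"
    and u: "u \<in> slab k" "spin_in A u \<noteq> 0" and vs: "set vs \<subseteq> slab k"
  shows "(\<Sum>v\<leftarrow>vs. \<eta> (\<phi> u) * \<eta> (\<phi> v)) \<le> int (length vs) - 2 * count_spin A (- spin_in A u) vs"
  using vs
proof (induction vs)
  case (Cons v vs)
  have eu: "\<eta> (\<phi> u) = \<sigma> * spin_in A u" using ag u by (simp add: agrees_def)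
  have su: "spin_in A u = 1 \<or> spin_in A u = -1" using pm[OF u(1)] eu \<sigma> by auto
  have "\<eta> (\<phi> u) * \<eta> (\<phi> v) \<le> (if spin_in A v = - spin_in A u then - 1 else 1)"
  proof (cases "spin_in A v = - spin_in A u")
    case True
    then have "\<eta> (\<phi> v) = \<sigma> * (- spin_in A u)" using ag Cons.prems u by (auto simp: agrees_def)
    then show ?thesis using True eu su \<sigma> by auto
  next
    case False
    then show ?thesis using pm[OF u(1)] pm[of v] Cons.prems by auto
  qed
  then show ?case using Cons by auto
qed simp

lemma check_script_sound:
  "check_script k A us \<Longrightarrow> agrees k \<phi> \<sigma> \<eta> A \<Longrightarrow> (\<And>v. v \<in> slab k \<Longrightarrow> \<eta> (\<phi> v) \<in> {-1, 1}) \<Longrightarrow> plive k B \<eta>"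
proof (induction us arbitrary: A \<eta>)
  case (Cons u us)
  define d where "d = count_spin A (- spin_in A u) (nbl k u)"
  have win: "window k u" and s: "spin_in A u \<noteq> 0" and d: "4 \<le> d \<or> d = 3 \<and> check_script k ((u, - spin_in A u) # A) us"
    using Cons.prems(1) by (auto simp: Let_def d_def split: if_splits)
  have u: "u \<in> slab k" using window_slab[OF win] .
  note int = interior[OF win]
  have len: "int (length (nbl k u)) = 6" by (cases u) simp
  have "energy k Periodic \<eta> (\<phi> u) = - (\<Sum>v\<leftarrow>nbl k u. \<eta> (\<phi> u) * \<eta> (\<phi> v))"
    by (simp add: energy_nbl[OF k slab[OF u]] nbl[OF u])
  then have e: "energy k Periodic \<eta> (\<phi> u) \<ge> 2 * d - 6"
    using sum_le_count[OF Cons.prems(2,3) u s nbl_slab[OF k u]] unfolding len d_def by simp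
  show ?case
  proof (cases "energy k Periodic \<eta> (\<phi> u) > 0")
    case True
    from slab_dynamics.live.lower[OF conjunct1[OF int] conjunct2[OF int] this] show ?thesis .
  next
    case False
    then have "d = 3" and us: "check_script k ((u, - spin_in A u) # A) us" and e0: "energy k Periodic \<eta> (\<phi> u) = 0"
      using d e by auto
    let ?\<eta> = "\<eta>(\<phi> u := - \<eta> (\<phi> u))"
    have "agrees k \<phi> \<sigma> ?\<eta> ((u, - spin_in A u) # A)"
      unfolding agrees_def
    proof (intro ballI impI)
      fix v assume v: "v \<in> slab k" "spin_in ((u, - spin_in A u) # A) v \<noteq> 0"
      show "?\<eta> (\<phi> v) = \<sigma> * spin_in ((u, - spin_in A u) # A) v"
      proof (cases "v = u")
        case True
        then show ?thesis using Cons.prems(2) u s by (simp add: agrees_def)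
      next
        case False
        then have "\<phi> v \<noteq> \<phi> u" using inj v u by (meson inj_onD)
        then show ?thesis using Cons.prems(2) v False by (simp add: agrees_def)
      qed
    qed
    moreover have "?\<eta> (\<phi> v) \<in> {-1, 1}" if "v \<in> slab k" for v
      using Cons.prems(3)[OF that] Cons.prems(3)[OF u] by auto
    ultimately have "plive k B ?\<eta>" by (intro Cons.IH[OF us])
    from slab_dynamics.live.flip[OF conjunct1[OF int] conjunct2[OF int] e0 this] show ?thesis .
  qed
qed simp

lemma check_sound:
  "check k A c \<Longrightarrow> agrees k \<phi> \<sigma> \<eta> A \<Longrightarrow> (\<And>v. v \<in> slab k \<Longrightarrow> \<eta> (\<phi> v) \<in> {-1, 1}) \<Longrightarrow> plive k B \<eta>"
proof (induction c arbitrary: A)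
  case (Script us)
  then show ?case using check_script_sound[of A us \<eta>] by simp
next
  case (Split u c c')
  show ?case
  \<comment> \<open>For u outside the slab an entry means nothing to \<open>agrees\<close>, so the
    first branch can be followed.\<close>
  proof (cases "u \<in> slab k \<and> \<eta> (\<phi> u) \<noteq> \<sigma>")
    case True
    then have "\<eta> (\<phi> u) = \<sigma> * (-1)" using Split.prems(3)[of u] \<sigma> by auto
    then have "agrees k \<phi> \<sigma> \<eta> ((u, -1) # A)" using Split.prems(2) by (intro agrees_Cons)
    moreover have "check k ((u, -1) # A) c'" using Split.prems(1) by simp
    ultimately show ?thesis using Split.prems(3) by (intro Split.IH(2))
  next
    case False
    then have "agrees k \<phi> \<sigma> \<eta> ((u, 1) # A)" using Split.prems(2) unfolding agrees_def by auto
    moreover have "check k ((u, 1) # A) c" using Split.prems(1) by simp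
    ultimately show ?thesis using Split.prems(3) by (intro Split.IH(1))
  qed
qed

end

text \<open>For a unit vector \<open>(a, c)\<close>, the rotation that takes \<open>(1, 0)\<close> to \<open>(a, c)\<close>, composed with a translation;
  \<open>\<epsilon> = -1\<close> reverses the cyclic order of the layers.\<close>

fun placement :: "nat \<Rightarrow> int \<Rightarrow> int \<Rightarrow> int \<Rightarrow> int \<Rightarrow> int \<Rightarrow> int \<Rightarrow> site \<Rightarrow> site" where
  "placement k px py a c z0 \<epsilon> (x, y, z) = (px + x * a - y * c, py + x * c + y * a, (z0 + \<epsilon> * z) mod int k)"

definition directions :: "(int \<times> int) set" where
  "directions = {(1, 0), (-1, 0), (0, 1), (0, -1)}"

lemma site_box_interior:
  assumes "\<bar>x\<bar> \<le> int L - 1" "\<bar>y\<bar> \<le> int L - 1" "0 \<le> z" "z < int k"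
  shows "(x, y, z) \<in> site_box k L \<and> neighbours k b (x, y, z) \<subseteq> site_box k L"
proof -
  obtain L' where L: "L = Suc L'" using assms by (cases L) auto
  have "(x, y, z) \<in> site_box k L'" using assms by (auto simp: site_box_def L)
  then show ?thesis
    using neighbours_site_box[of "(x, y, z)" k L' b] site_box_mono[of L' L k] by (auto simp: L)
qed

text \<open>Rotations, translations and cyclic or reversing maps of the layers permute the six
  entries of \<open>nbl\<close>. The margin 3 is the radius 2 of the window plus one step to the
  neighbours.\<close>

lemma local_embedding_placement:
  assumes k: "k = 2 \<or> k = 3" and \<sigma>: "\<sigma> \<in> {-1, 1}" and ac: "(a, c) \<in> directions" and \<epsilon>: "\<epsilon> \<in> {-1, 1}"
    and p: "\<bar>px\<bar> \<le> int L - 3" "\<bar>py\<bar> \<le> int L - 3"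
  shows "local_embedding k (placement k px py a c z0 \<epsilon>) \<sigma> (site_box k L)"
proof
  have kpos: "int k > 0" using k by auto
  show "k = 2 \<or> k = 3" "\<sigma> \<in> {-1, 1}" by fact+
  show "placement k px py a c z0 \<epsilon> u \<in> slab k" for u
    using kpos by (cases u) (simp add: slab_def)
  show "inj_on (placement k px py a c z0 \<epsilon>) (slab k)"
  proof (rule inj_onI)
    fix u v assume uv: "u \<in> slab k" "v \<in> slab k" and eq: "placement k px py a c z0 \<epsilon> u = placement k px py a c z0 \<epsilon> v"
    obtain x y z where u: "u = (x, y, z)" by (metis prod_cases3)
    obtain x' y' z' where v: "v = (x', y', z')" by (metis prod_cases3)
    have z: "0 \<le> z" "z < int k" "0 \<le> z'" "z' < int k" using uv by (auto simp: u v slab_def)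
    have m: "(z0 + \<epsilon> * z) mod int k = (z0 + \<epsilon> * z') mod int k" using eq by (simp add: u v)
    have "int k dvd (z0 + \<epsilon> * z) - (z0 + \<epsilon> * z')" using m by (simp add: mod_eq_dvd_iff)
    then have "int k dvd \<epsilon> * (z - z')" by (simp add: algebra_simps)
    then have "int k dvd z - z'" using \<epsilon> by (auto simp: dvd_diff_commute[of "int k" z' z])
    have "z = z'"
    proof (rule ccontr)
      assume "z \<noteq> z'"
      then have "int k \<le> \<bar>z - z'\<bar>" using dvd_imp_le_int[of "z - z'" "int k"] \<open>int k dvd z - z'\<close> by simp
      then show False using z by linarith
    qed
    then show "u = v" using eq ac by (auto simp: u v directions_def)
  qed
  show "(\<Sum>v\<leftarrow>nbl k (placement k px py a c z0 \<epsilon> u). g v :: int) = (\<Sum>v\<leftarrow>nbl k u. g (placement k px py a c z0 \<epsilon> v))"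
    for u g
    using ac \<epsilon> by (cases u) (auto simp: directions_def mod_simps algebra_simps)
  show "placement k px py a c z0 \<epsilon> u \<in> site_box k L \<and> neighbours k Periodic (placement k px py a c z0 \<epsilon> u) \<subseteq> site_box k L"
    if "window k u" for u
  proof -
    obtain x y z where u: "u = (x, y, z)" by (metis prod_cases3)
    show ?thesis unfolding u placement.simps
      using that ac p kpos by (intro site_box_interior) (auto simp: u directions_def)
  qed
qed

lemma one_of_four:
  fixes s :: int
  assumes "s = 1 \<or> s = -1" "a = 1 \<or> a = -1" "b = 1 \<or> b = -1" "c = 1 \<or> c = -1" "d = 1 \<or> d = -1"
    and "s * (a + b + c + d) = 2"
  shows "a = - s \<and> b = s \<and> c = s \<and> d = s \<or> b = - s \<and> a = s \<and> c = s \<and> d = s \<or>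
    c = - s \<and> d = s \<and> b = s \<and> a = s \<or> d = - s \<and> c = s \<and> a = s \<and> b = s"
  using assms by (elim disjE; simp)

text \<open>The pair (a, c) is the direction of the odd neighbour, and (-c, a) and (c, -a) are its
  quarter turns; the rotation in \<open>placement\<close> takes (1, 0) to it.\<close>

lemma direction_exI:
  fixes f :: "int \<Rightarrow> int \<Rightarrow> int"
  assumes "f 1 0 = - s \<and> f (-1) 0 = s \<and> f 0 1 = s \<and> f 0 (-1) = s \<or> f (-1) 0 = - s \<and> f 1 0 = s \<and> f 0 1 = s \<and> f 0 (-1) = s \<or>
    f 0 1 = - s \<and> f 0 (-1) = s \<and> f (-1) 0 = s \<and> f 1 0 = s \<or> f 0 (-1) = - s \<and> f 0 1 = s \<and> f 1 0 = s \<and> f (-1) 0 = s"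
  shows "\<exists>a c. (a, c) \<in> directions \<and> f a c = - s \<and> f (-a) (-c) = s \<and> f (-c) a = s \<and> f c (-a) = s"
  using assms
proof (elim disjE)
  assume "f 1 0 = - s \<and> f (-1) 0 = s \<and> f 0 1 = s \<and> f 0 (-1) = s"
  then show ?thesis by (intro exI[of _ 1] exI[of _ 0]) (simp add: directions_def)
next
  assume "f (-1) 0 = - s \<and> f 1 0 = s \<and> f 0 1 = s \<and> f 0 (-1) = s"
  then show ?thesis by (intro exI[of _ "-1"] exI[of _ 0]) (simp add: directions_def)
next
  assume "f 0 1 = - s \<and> f 0 (-1) = s \<and> f (-1) 0 = s \<and> f 1 0 = s"
  then show ?thesis by (intro exI[of _ 0] exI[of _ 1]) (simp add: directions_def)
next
  assume "f 0 (-1) = - s \<and> f 0 1 = s \<and> f 1 0 = s \<and> f (-1) 0 = s"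
  then show ?thesis by (intro exI[of _ 0] exI[of _ "-1"]) (simp add: directions_def)
qed

text \<open>The double edge of a mixed column contributes 2 to the energy, so three of the four
  neighbours in the layer agree. The sign is \<open>- \<eta> (px, py, z)\<close> because the
  certificate has -1 at the origin.\<close>

lemma mixed_column_live:
  assumes pm: "\<And>v. v \<in> slab 2 \<Longrightarrow> \<eta> v \<in> {-1, 1}" and p: "\<bar>px\<bar> \<le> int L - 3" "\<bar>py\<bar> \<le> int L - 3"
    and z: "z \<in> {0, 1}" and e: "energy 2 Periodic \<eta> (px, py, z) = 0"
    and mixed: "\<eta> (px, py, 1 - z) = - \<eta> (px, py, z)"
  shows "plive 2 (site_box 2 L) \<eta>"
proof -
  let ?s = "\<eta> (px, py, z)"
  have in_slab: "(x, y, z) \<in> slab 2" "(x, y, 1 - z) \<in> slab 2" for x y using z by (auto simp: slab_def)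
  have m: "(z + 1) mod 2 = 1 - z" "(z - 1) mod 2 = 1 - z" using z by auto
  have s: "?s = 1 \<or> ?s = -1" using pm[OF in_slab(1)] by auto
  have "?s * (\<eta> (px + 1, py, z) + \<eta> (px - 1, py, z) + \<eta> (px, py + 1, z) + \<eta> (px, py - 1, z)) = 2"
    using e s unfolding energy_nbl[of 2 "(px, py, z)", simplified, OF in_slab(1)] by (auto simp: m mixed)
  from one_of_four[OF s _ _ _ _ this] pm[OF in_slab(1)]
  have "\<exists>a c. (a, c) \<in> directions \<and> \<eta> (px + a, py + c, z) = - ?s \<and> \<eta> (px + - a, py + - c, z) = ?s \<and>
      \<eta> (px + - c, py + a, z) = ?s \<and> \<eta> (px + c, py + - a, z) = ?s"
    by (intro direction_exI[of "\<lambda>a c. \<eta> (px + a, py + c, z)"]) (simp, blast)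
  then obtain a c where ac: "(a, c) \<in> directions" "\<eta> (px + a, py + c, z) = - ?s" "\<eta> (px - a, py - c, z) = ?s"
      "\<eta> (px - c, py + a, z) = ?s" "\<eta> (px + c, py - a, z) = ?s" by auto
  interpret local_embedding 2 "placement 2 px py a c z 1" "- ?s" "site_box 2 L"
    by (rule local_embedding_placement) (use s ac p in auto)
  have zz: "z mod 2 = z" using z by auto
  show ?thesis
    by (rule check_sound[OF check_mixed_column]) (use ac mixed m s slab pm in \<open>auto intro!: agrees_Cons agrees_Nil simp: zz\<close>)
qed

text \<open>If the two spins of the column agree, flipping one of them at energy zero keeps its
  energy at zero and makes the column mixed.\<close>

lemma zero_energy_live_2:
  assumes pm: "\<And>v. v \<in> slab 2 \<Longrightarrow> \<eta> v \<in> {-1, 1}" and p: "\<bar>px\<bar> \<le> int L - 3" "\<bar>py\<bar> \<le> int L - 3"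
    and z: "z \<in> {0, 1}" and e: "energy 2 Periodic \<eta> (px, py, z) = 0"
  shows "plive 2 (site_box 2 L) \<eta>"
proof (cases "\<eta> (px, py, 1 - z) = - \<eta> (px, py, z)")
  case True
  then show ?thesis by (intro mixed_column_live[OF pm p z e])
next
  case False
  let ?u = "(px, py, z)"
  let ?\<eta> = "\<eta>(?u := - \<eta> ?u)"
  have "?u \<in> slab 2" "(px, py, 1 - z) \<in> slab 2" using z by (auto simp: slab_def)
  then have eq: "\<eta> (px, py, 1 - z) = \<eta> ?u" using False pm[of ?u] pm[of "(px, py, 1 - z)"] by auto
  have "energy 2 Periodic ?\<eta> ?u = 0" using e energy_flip_self[of 2 Periodic \<eta> ?u] by simp
  moreover have "1 - z \<noteq> z" using z by auto
  moreover have "?\<eta> v \<in> {-1, 1}" if "v \<in> slab 2" for v using pm[OF that] pm[OF \<open>?u \<in> slab 2\<close>] by auto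
  ultimately have "plive 2 (site_box 2 L) ?\<eta>"
    using eq by (intro mixed_column_live[OF _ p z]) auto
  moreover have "?u \<in> site_box 2 L \<and> neighbours 2 Periodic ?u \<subseteq> site_box 2 L"
    by (rule site_box_interior) (use p z in auto)
  ultimately show ?thesis using slab_dynamics.live.flip[of ?u "site_box 2 L" 2 Periodic \<eta>] e by blast
qed

text \<open>The choice of \<epsilon> decides which of the other two layers is layer 1 of the
  certificate, so agreement with the column behind is asked in one of them only.\<close>

lemma minority_live:
  assumes pm: "\<And>v. v \<in> slab 3 \<Longrightarrow> \<eta> v \<in> {-1, 1}" and p: "\<bar>px\<bar> \<le> int L - 3" "\<bar>py\<bar> \<le> int L - 3"
    and z: "z \<in> {0, 1, 2}" and \<epsilon>: "\<epsilon> \<in> {-1, 1}" and ac: "(a, c) \<in> directions"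
    and minority: "\<eta> (px, py, (z + 1) mod 3) = - \<eta> (px, py, z)" "\<eta> (px, py, (z - 1) mod 3) = - \<eta> (px, py, z)"
    and nb: "\<eta> (px + a, py + c, z) = - \<eta> (px, py, z)" "\<eta> (px - a, py - c, z) = \<eta> (px, py, z)"
      "\<eta> (px - c, py + a, z) = \<eta> (px, py, z)" "\<eta> (px + c, py - a, z) = \<eta> (px, py, z)"
    and W: "\<eta> (px - a, py - c, (z + \<epsilon>) mod 3) = \<eta> (px, py, z)"
  shows "plive 3 (site_box 3 L) \<eta>"
proof -
  let ?s = "\<eta> (px, py, z)"
  have s: "?s = 1 \<or> ?s = -1" using pm[of "(px, py, z)"] z by (auto simp: slab_def)
  interpret local_embedding 3 "placement 3 px py a c z \<epsilon>" "- ?s" "site_box 3 L"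
    by (rule local_embedding_placement) (use s ac p \<epsilon> in auto)
  have zz: "z mod 3 = z" using z by auto
  have z2: "(z + 2) mod 3 = (z - 1) mod 3" "(z - 2) mod 3 = (z + 1) mod 3" using z by auto
  have "\<eta> (px, py, (z + \<epsilon>) mod 3) = - ?s" "\<eta> (px, py, (z + \<epsilon> * 2) mod 3) = - ?s"
    using \<epsilon> minority z2 by (auto simp: algebra_simps)
  then show ?thesis
    by - (rule check_sound[OF check_minority], use nb W s slab pm in \<open>auto intro!: agrees_Cons agrees_Nil simp: zz\<close>)
qed

section \<open>Wandering boundaries in three layers\<close>

text \<open>The cells of \<open>U\<close> carry unanimous columns, which no flip of interest touches; every cell
  within distance \<open>R\<close> of the origin sees such a column in each of the four directions.\<close>

lemma three_agree:
  fixes s :: int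
  assumes "s = 1 \<or> s = -1" "b = 1 \<or> b = -1" "c = 1 \<or> c = -1" "d = 1 \<or> d = -1"
    and "s * (- s + b + c + d - s - s) \<ge> 0"
  shows "b = s \<and> c = s \<and> d = s"
  using assms by (elim disjE; simp)

lemma three_or_four_agree:
  fixes s :: int
  assumes "s = 1 \<or> s = -1" "a = 1 \<or> a = -1" "b = 1 \<or> b = -1" "c = 1 \<or> c = -1" "d = 1 \<or> d = -1"
    and "s * (a + b + c + d - s - s) \<ge> 0"
  shows "s * (a + b + c + d) = 2 \<or> a = s \<and> b = s \<and> c = s \<and> d = s"
  using assms by (elim disjE; simp)

locale walled =
  fixes U :: "(int \<times> int) set" and L :: nat and R :: int
  assumes walls: "\<And>x y a c. \<bar>x\<bar> \<le> R \<Longrightarrow> \<bar>y\<bar> \<le> R \<Longrightarrow> (a, c) \<in> directions \<Longrightarrow>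
      \<exists>D::nat. D \<ge> 1 \<and> (x + int D * a, y + int D * c) \<in> U \<and> \<bar>x + int D * a\<bar> \<le> int L - 3 \<and> \<bar>y + int D * c\<bar> \<le> int L - 3"
    and R_le: "R \<le> int L - 3"
begin

section \<open>Configurations from which no lowering flip can be reached\<close>

definition unanimous :: "(site \<Rightarrow> int) \<Rightarrow> int \<Rightarrow> int \<Rightarrow> bool" where
  "unanimous \<eta> x y \<longleftrightarrow> \<eta> (x, y, 0) = \<eta> (x, y, 1) \<and> \<eta> (x, y, 1) = \<eta> (x, y, 2)"

text \<open>The object of the contradiction. It is preserved by flips at energy zero off U
  (\<open>stuck_flip\<close>), so the inequality \<open>stuck_sum\<close> is available not only for
  the given configuration but for all that such flips lead to.\<close>

definition stuck :: "(site \<Rightarrow> int) \<Rightarrow> bool" where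
  "stuck \<eta> \<longleftrightarrow> (\<forall>v\<in>slab 3. \<eta> v = 1 \<or> \<eta> v = -1) \<and> (\<forall>(x, y)\<in>U. unanimous \<eta> x y) \<and> \<not> plive 3 (site_box 3 L) \<eta>"

definition around :: "(site \<Rightarrow> int) \<Rightarrow> int \<Rightarrow> int \<Rightarrow> int \<Rightarrow> int" where
  "around \<eta> x y z = \<eta> (x + 1, y, z) + \<eta> (x - 1, y, z) + \<eta> (x, y + 1, z) + \<eta> (x, y - 1, z)"

lemma layer_in_slab: "z \<in> {0, 1, 2} \<Longrightarrow> (x, y, z) \<in> slab 3"
  by (auto simp: slab_def)

lemma layers: "z \<in> {0, 1, 2} \<Longrightarrow> (z + 1) mod 3 \<in> {0, 1, 2} \<and> (z - 1) mod 3 \<in> {0, 1, 2::int} \<and>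
    (z + 1) mod 3 \<noteq> z \<and> (z - 1) mod 3 \<noteq> z \<and> (z + 1) mod 3 \<noteq> (z - 1) mod 3"
  by auto

lemma spin_cases: "stuck \<eta> \<Longrightarrow> z \<in> {0, 1, 2} \<Longrightarrow> \<eta> (x, y, z) = 1 \<or> \<eta> (x, y, z) = -1"
  using layer_in_slab unfolding stuck_def by blast

lemma energy_3: "z \<in> {0, 1, 2} \<Longrightarrow> energy 3 Periodic \<eta> (x, y, z) =
    - (\<eta> (x, y, z) * (around \<eta> x y z + \<eta> (x, y, (z + 1) mod 3) + \<eta> (x, y, (z - 1) mod 3)))"
  using energy_nbl[of 3 "(x, y, z)" \<eta>] layer_in_slab by (simp add: around_def algebra_simps)

lemma interior: "\<bar>x\<bar> \<le> int L - 1 \<Longrightarrow> \<bar>y\<bar> \<le> int L - 1 \<Longrightarrow> z \<in> {0, 1, 2} \<Longrightarrow>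
    (x, y, z) \<in> site_box 3 L \<and> neighbours 3 Periodic (x, y, z) \<subseteq> site_box 3 L"
  by (rule site_box_interior) auto

text \<open>A violation is a site of positive energy in the interior of the box, that is, an
  immediate lowering flip.\<close>

lemma stuck_sum:
  assumes "stuck \<eta>" "\<bar>x\<bar> \<le> int L - 1" "\<bar>y\<bar> \<le> int L - 1" "z \<in> {0, 1, 2}"
  shows "\<eta> (x, y, z) * (around \<eta> x y z + \<eta> (x, y, (z + 1) mod 3) + \<eta> (x, y, (z - 1) mod 3)) \<ge> 0"
proof (rule ccontr)
  assume "\<not> ?thesis"
  then have "energy 3 Periodic \<eta> (x, y, z) > 0" using energy_3[OF assms(4), of \<eta> x y] by simp
  then have "plive 3 (site_box 3 L) \<eta>"
    using interior[OF assms(2,3,4)] slab_dynamics.live.lower[of "(x, y, z)" "site_box 3 L" 3 Periodic \<eta>] by blast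
  then show False using assms(1) by (simp add: stuck_def)
qed

lemma unanimous_iff: "z \<in> {0, 1, 2} \<Longrightarrow> unanimous \<eta> x y \<longleftrightarrow>
    \<eta> (x, y, (z + 1) mod 3) = \<eta> (x, y, z) \<and> \<eta> (x, y, (z - 1) mod 3) = \<eta> (x, y, z)"
  by (auto simp: unanimous_def)

text \<open>A lowering sequence after the flip, preceded by the flip itself, would be one from the
  start. Off U the flip leaves the unanimous columns alone.\<close>

lemma stuck_flip:
  assumes st: "stuck \<eta>" and xy: "\<bar>x\<bar> \<le> int L - 1" "\<bar>y\<bar> \<le> int L - 1" and z: "z \<in> {0, 1, 2}" and U: "(x, y) \<notin> U"
    and zero: "around \<eta> x y z + \<eta> (x, y, (z + 1) mod 3) + \<eta> (x, y, (z - 1) mod 3) = 0"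
  shows "stuck (\<eta>((x, y, z) := - \<eta> (x, y, z)))"
proof -
  let ?u = "(x, y, z)" let ?\<eta> = "\<eta>(?u := - \<eta> ?u)"
  have "energy 3 Periodic \<eta> ?u = 0" using energy_3[OF z, of \<eta> x y] zero by simp
  then have "\<not> plive 3 (site_box 3 L) ?\<eta>"
    using st interior[OF xy z] slab_dynamics.live.flip[of ?u "site_box 3 L" 3 Periodic \<eta>] unfolding stuck_def by blast
  moreover have "?\<eta> v = 1 \<or> ?\<eta> v = -1" if "v \<in> slab 3" for v
    using st that layer_in_slab[OF z, of x y] unfolding stuck_def by (cases "v = ?u") force+
  moreover have "unanimous ?\<eta> p q" if "(p, q) \<in> U" for p q
  proof -
    have "(p, q) \<noteq> (x, y)" using that U by blast
    then have "?\<eta> (p, q, z') = \<eta> (p, q, z')" for z' by auto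
    moreover have "unanimous \<eta> p q" using st that unfolding stuck_def by blast
    ultimately show ?thesis by (simp only: unanimous_def)
  qed
  ultimately show ?thesis unfolding stuck_def by blast
qed

text \<open>A minority spin with exactly three agreeing neighbours in its layer turns its column
  unanimous and passes the same situation on to the next column, until a wall is hit.\<close>

lemma minority_slides:
  assumes "D \<ge> 1" "stuck \<eta>" "z \<in> {0, 1, 2}" "(a, c) \<in> directions" "(x - int D * a, y - int D * c) \<in> U"
    "\<bar>x\<bar> \<le> int L - 3" "\<bar>y\<bar> \<le> int L - 3" "\<bar>x - int D * a\<bar> \<le> int L - 3" "\<bar>y - int D * c\<bar> \<le> int L - 3"
    "\<eta> (x, y, (z + 1) mod 3) = - \<eta> (x, y, z)" "\<eta> (x, y, (z - 1) mod 3) = - \<eta> (x, y, z)"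
    "\<eta> (x + a, y + c, z) = - \<eta> (x, y, z)" "\<eta> (x - a, y - c, z) = \<eta> (x, y, z)"
    "\<eta> (x - c, y + a, z) = \<eta> (x, y, z)" "\<eta> (x + c, y - a, z) = \<eta> (x, y, z)"
  shows False
  using assms
proof (induction D arbitrary: \<eta> x y)
  case (Suc D)
  note st = Suc.prems(2) and z = Suc.prems(3) and ac = Suc.prems(4)
  have pm: "\<eta> v \<in> {-1, 1}" if "v \<in> slab 3" for v using st that unfolding stuck_def by blast
  \<comment> \<open>Otherwise the certificate for a minority spin would yield a lowering sequence.
    So neither other layer of the column behind agrees with the sliding spin, and that column has
    the same minority spin.\<close>
  have W: "\<eta> (x - a, y - c, (z + \<epsilon>) mod 3) \<noteq> \<eta> (x, y, z)" if "\<epsilon> \<in> {-1, 1}" for \<epsilon>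
    using minority_live[OF pm Suc.prems(6,7) z that ac Suc.prems(10-15)] st unfolding stuck_def by blast
  have s: "\<eta> (x, y, z) = 1 \<or> \<eta> (x, y, z) = -1" by (rule spin_cases[OF st z])
  have W1: "\<eta> (x - a, y - c, (z + 1) mod 3) = - \<eta> (x, y, z)"
    using W[of 1] s spin_cases[OF st, of "(z + 1) mod 3" "x - a" "y - c"] layers[OF z] by auto
  have W2: "\<eta> (x - a, y - c, (z - 1) mod 3) = - \<eta> (x, y, z)"
    using W[of "-1"] s spin_cases[OF st, of "(z - 1) mod 3" "x - a" "y - c"] layers[OF z] by auto
  show False
  \<comment> \<open>The distance to the wall is \<open>Suc D\<close>, so D = 0 means that the column
    behind is the wall itself.\<close>
  proof (cases "D = 0")
    case True
    then have "unanimous \<eta> (x - a) (y - c)" using Suc.prems(5) st unfolding stuck_def by auto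
    then show False using W1 Suc.prems(13) s unfolding unanimous_iff[OF z] by auto
  next
    case False
    let ?\<eta> = "\<eta>((x, y, z) := - \<eta> (x, y, z))"
    have "\<not> unanimous \<eta> x y" using Suc.prems(10) s unfolding unanimous_iff[OF z] by auto
    then have notU: "(x, y) \<notin> U" using st unfolding stuck_def by blast
    have around: "around \<eta> p q z = \<eta> (p + a, q + c, z) + \<eta> (p - a, q - c, z) + \<eta> (p - c, q + a, z) + \<eta> (p + c, q - a, z)" for \<eta> p q
      using ac unfolding directions_def around_def by auto
    have st': "stuck ?\<eta>"
      using Suc.prems(6,7,10-15) by (intro stuck_flip[OF st _ _ z notU]) (auto simp: around)
    have ne: "(x - a, y - c) \<noteq> (x, y)" "(x - 2 * a, y - 2 * c) \<noteq> (x, y)" "(x - a - c, y - c + a) \<noteq> (x, y)" "(x - a + c, y - c - a) \<noteq> (x, y)"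
      using ac unfolding directions_def by auto
    have bnd: "\<bar>x - a\<bar> \<le> int L - 3" "\<bar>y - c\<bar> \<le> int L - 3"
      using Suc.prems(6-9) ac unfolding directions_def by auto
    have s': "?\<eta> (x - a, y - c, z) = \<eta> (x, y, z)" using ne Suc.prems(13) by auto
    have W1': "?\<eta> (x - a, y - c, (z + 1) mod 3) = - \<eta> (x, y, z)" and W2': "?\<eta> (x - a, y - c, (z - 1) mod 3) = - \<eta> (x, y, z)"
      using ne W1 W2 by auto
    have p': "?\<eta> (x - a + a, y - c + c, z) = - \<eta> (x, y, z)" by simp
    have "\<eta> (x, y, z) * (around ?\<eta> (x - a) (y - c) z - \<eta> (x, y, z) - \<eta> (x, y, z)) \<ge> 0"
      using stuck_sum[OF st' _ _ z, of "x - a" "y - c"] bnd unfolding W1' W2' s' by simp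
    \<comment> \<open>At the new minority site the neighbour just flipped disagrees; as the energy
      is not positive, the other three neighbours of the layer agree.\<close>
    then have nb: "?\<eta> (x - a - a, y - c - c, z) = \<eta> (x, y, z) \<and> ?\<eta> (x - a - c, y - c + a, z) = \<eta> (x, y, z) \<and> ?\<eta> (x - a + c, y - c - a, z) = \<eta> (x, y, z)"
      by (intro three_agree s spin_cases[OF st' z]) (simp only: around p')
    have D: "D \<ge> 1" using False by simp
    have far: "(x - a - int D * a, y - c - int D * c) \<in> U" "\<bar>x - a - int D * a\<bar> \<le> int L - 3" "\<bar>y - c - int D * c\<bar> \<le> int L - 3"
      using Suc.prems(5,8,9) by (simp_all only: of_nat_Suc distrib_right mult_1_left diff_diff_eq)
    show False
      by (rule Suc.IH[OF D st' z ac far(1) bnd far(2,3)]) (simp_all only: s' W1' W2' p' nb)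
  qed
qed simp

lemma around_direction:
  assumes "stuck \<eta>" "z \<in> {0, 1, 2}" "s = 1 \<or> s = -1" "s * around \<eta> x y z = 2"
  shows "\<exists>a c. (a, c) \<in> directions \<and> \<eta> (x + a, y + c, z) = - s \<and> \<eta> (x - a, y - c, z) = s \<and>
      \<eta> (x - c, y + a, z) = s \<and> \<eta> (x + c, y - a, z) = s"
proof -
  note pm = spin_cases[OF assms(1,2)]
  have "\<exists>a c. (a, c) \<in> directions \<and> \<eta> (x + a, y + c, z) = - s \<and> \<eta> (x + - a, y + - c, z) = s \<and>
      \<eta> (x + - c, y + a, z) = s \<and> \<eta> (x + c, y + - a, z) = s"
    by (rule direction_exI[of "\<lambda>a c. \<eta> (x + a, y + c, z)"])
      (use one_of_four[OF assms(3) pm pm pm pm assms(4)[unfolded around_def]] in simp)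
  then show ?thesis by simp
qed

text \<open>Energy at most zero leaves at least three agreeing neighbours in the layer. Exactly
  three would start a slide, away from the disagreeing one, towards a wall.\<close>

lemma minority_surrounded:
  assumes st: "stuck \<eta>" and z: "z \<in> {0, 1, 2}" and xy: "\<bar>x\<bar> \<le> R" "\<bar>y\<bar> \<le> R"
    and m: "\<eta> (x, y, (z + 1) mod 3) = - \<eta> (x, y, z)" "\<eta> (x, y, (z - 1) mod 3) = - \<eta> (x, y, z)"
  shows "\<eta> (x + 1, y, z) = \<eta> (x, y, z) \<and> \<eta> (x - 1, y, z) = \<eta> (x, y, z) \<and> \<eta> (x, y + 1, z) = \<eta> (x, y, z) \<and> \<eta> (x, y - 1, z) = \<eta> (x, y, z)"
proof (rule ccontr)
  let ?s = "\<eta> (x, y, z)"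
  assume not: "\<not> ?thesis"
  have s: "?s = 1 \<or> ?s = -1" by (rule spin_cases[OF st z])
  have "?s * (around \<eta> x y z - ?s - ?s) \<ge> 0"
    using stuck_sum[OF st _ _ z, of x y] xy R_le unfolding m by simp
  then have "?s * around \<eta> x y z = 2"
    using three_or_four_agree[OF s spin_cases[OF st z] spin_cases[OF st z] spin_cases[OF st z] spin_cases[OF st z],
      of "x + 1" y "x - 1" y x "y + 1" x "y - 1"] not unfolding around_def by blast
  then obtain a c where ac: "(a, c) \<in> directions" "\<eta> (x + a, y + c, z) = - ?s" "\<eta> (x - a, y - c, z) = ?s"
      "\<eta> (x - c, y + a, z) = ?s" "\<eta> (x + c, y - a, z) = ?s"
    using around_direction[OF st z s] by blast
  have "(- a, - c) \<in> directions" using ac(1) by (auto simp: directions_def)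
  then obtain D :: nat where D: "D \<ge> 1" "(x + int D * - a, y + int D * - c) \<in> U" "\<bar>x + int D * - a\<bar> \<le> int L - 3" "\<bar>y + int D * - c\<bar> \<le> int L - 3"
    using walls[OF xy] by blast
  have D': "(x - int D * a, y - int D * c) \<in> U" "\<bar>x - int D * a\<bar> \<le> int L - 3" "\<bar>y - int D * c\<bar> \<le> int L - 3"
    using D(2-4) by simp_all
  have "\<bar>x\<bar> \<le> int L - 3" "\<bar>y\<bar> \<le> int L - 3" using xy R_le by linarith+
  from minority_slides[OF D(1) st z ac(1) D'(1) this D'(2,3) m ac(2-5)] show False .
qed

text \<open>The two other layers cancel, so only layer z decides the energy. If moreover the spin in
  z is free, each of the two other spins is the minority of its column before or after a flip in z,
  and is then surrounded by equal spins in its own layer.\<close>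

lemma balanced_column:
  assumes st: "stuck \<eta>" and z: "z \<in> {0, 1, 2}" and xy: "\<bar>x\<bar> \<le> R" "\<bar>y\<bar> \<le> R"
    and ne: "\<eta> (x, y, (z + 1) mod 3) \<noteq> \<eta> (x, y, (z - 1) mod 3)"
  shows balanced_sum: "\<eta> (x, y, z) * around \<eta> x y z \<ge> 0"
    and balanced_flip: "around \<eta> x y z = 0 \<Longrightarrow> stuck (\<eta>((x, y, z) := - \<eta> (x, y, z)))"
    and balanced_neighbours: "around \<eta> x y z = 0 \<Longrightarrow> (a, c) \<in> directions \<Longrightarrow> z' \<in> {(z + 1) mod 3, (z - 1) mod 3} \<Longrightarrow>
      \<eta> (x + a, y + c, z') = \<eta> (x, y, z')"
proof -
  have pm: "\<eta> (x, y, z') = 1 \<or> \<eta> (x, y, z') = -1" if "z' \<in> {0, 1, 2}" for z' by (rule spin_cases[OF st that])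
  have sum0: "\<eta> (x, y, (z + 1) mod 3) + \<eta> (x, y, (z - 1) mod 3) = 0"
    using ne pm[of "(z + 1) mod 3"] pm[of "(z - 1) mod 3"] layers[OF z] by auto
  show "\<eta> (x, y, z) * around \<eta> x y z \<ge> 0"
    using stuck_sum[OF st _ _ z, of x y] xy R_le sum0 by (simp add: add.assoc)
  assume zero: "around \<eta> x y z = 0"
  let ?\<eta> = "\<eta>((x, y, z) := - \<eta> (x, y, z))"
  have "\<not> unanimous \<eta> x y" using ne unfolding unanimous_iff[OF z] by auto
  then have notU: "(x, y) \<notin> U" using st unfolding stuck_def by blast
  show st': "stuck ?\<eta>"
    using xy R_le zero sum0 by (intro stuck_flip[OF st _ _ z notU]) auto
  assume ac: "(a, c) \<in> directions" and z': "z' \<in> {(z + 1) mod 3, (z - 1) mod 3}"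
  have z'z: "z' \<in> {0, 1, 2}" "z' \<noteq> z" using z' layers[OF z] by auto
  have min: "\<zeta> (x + a, y + c, z') = \<zeta> (x, y, z')"
    if "stuck \<zeta>" "\<zeta> (x, y, (z' + 1) mod 3) = - \<zeta> (x, y, z')" "\<zeta> (x, y, (z' - 1) mod 3) = - \<zeta> (x, y, z')" for \<zeta>
    using minority_surrounded[OF that(1) z'z(1) xy that(2,3)] ac unfolding directions_def by auto
  have other: "{(z' + 1) mod 3, (z' - 1) mod 3} = {z, if z' = (z + 1) mod 3 then (z - 1) mod 3 else (z + 1) mod 3}"
    using z z' by auto
  show "\<eta> (x + a, y + c, z') = \<eta> (x, y, z')"
  proof (cases "\<eta> (x, y, z) = \<eta> (x, y, z')")
    case False
    have "\<eta> (x, y, i) = - \<eta> (x, y, z')" if "i \<in> {(z' + 1) mod 3, (z' - 1) mod 3}" for i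
      using that z' False sum0 pm[OF z] pm[OF z'z(1)] unfolding other by (auto split: if_splits)
    then show ?thesis by (intro min[OF st]) auto
  next
    case True
    have "?\<eta> (x, y, i) = - ?\<eta> (x, y, z')" if "i \<in> {(z' + 1) mod 3, (z' - 1) mod 3}" for i
      using that z' True sum0 z'z layers[OF z] unfolding other by (auto split: if_splits)
    then have "?\<eta> (x + a, y + c, z') = ?\<eta> (x, y, z')" by (intro min[OF st']) auto
    then show ?thesis using z'z by simp
  qed
qed

text \<open>A corner at \<open>(x, y)\<close>: in layer \<open>z\<close> the boundary between the spins \<open>s\<close> and \<open>-s\<close> can pass on either side
  of the site, so that the spin there is free. The directions of the corner are given by the signs \<open>e\<close> and \<open>n\<close>.\<close>

definition corner :: "int \<Rightarrow> int \<Rightarrow> int \<Rightarrow> int \<Rightarrow> (site \<Rightarrow> int) \<Rightarrow> int \<Rightarrow> int \<Rightarrow> bool" where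
  "corner z s e n \<eta> x y \<longleftrightarrow> \<eta> (x + e, y, z) = s \<and> \<eta> (x, y - n, z) = s \<and> \<eta> (x - e, y, z) = - s \<and> \<eta> (x, y + n, z) = - s \<and>
     \<eta> (x, y, (z + 1) mod 3) \<noteq> \<eta> (x, y, (z - 1) mod 3)"

section \<open>Corners and how they move\<close>

context
  fixes z s e n :: int
  assumes z: "z \<in> {0, 1, 2}" and s: "s = 1 \<or> s = -1" and e: "e = 1 \<or> e = -1" and n: "n = 1 \<or> n = -1"
begin

lemma around_signed: "around \<eta> x y z = \<eta> (x + e, y, z) + \<eta> (x - e, y, z) + \<eta> (x, y + n, z) + \<eta> (x, y - n, z)"
  using e n by (auto simp: around_def)

lemma corner_around: "corner z s e n \<eta> x y \<Longrightarrow> around \<eta> x y z = 0"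
  by (simp add: corner_def around_signed)

text \<open>The two pairs of neighbours in the layer cancel and so do the two other layers: the spin
  at a corner has energy zero for either value.\<close>

lemma stuck_corner_set:
  assumes st: "stuck \<eta>" and c: "corner z s e n \<eta> x y" and xy: "\<bar>x\<bar> \<le> R" "\<bar>y\<bar> \<le> R" and t: "t = 1 \<or> t = -1"
  shows "stuck (\<eta>((x, y, z) := t))"
proof (cases "\<eta> (x, y, z) = t")
  case True
  then have "\<eta>((x, y, z) := t) = \<eta>" by auto
  then show ?thesis using st by simp
next
  case False
  then have "t = - \<eta> (x, y, z)" using t spin_cases[OF st z, of x y] by auto
  then show ?thesis
    using balanced_flip[OF st z xy _ corner_around[OF c]] c by (simp add: corner_def)
qed

lemma corner_upd_other:
  assumes "u \<notin> {(x + e, y, z), (x, y - n, z), (x - e, y, z), (x, y + n, z)}" "snd (snd u) = z"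
  shows "corner z s e n (\<eta>(u := t)) x y = corner z s e n \<eta> x y"
proof -
  have "(x + e, y, z) \<noteq> u" "(x, y - n, z) \<noteq> u" "(x - e, y, z) \<noteq> u" "(x, y + n, z) \<noteq> u"
    using assms(1) by blast+
  moreover have "(x, y, (z + 1) mod 3) \<noteq> u" "(x, y, (z - 1) mod 3) \<noteq> u"
    using assms(2) layers[OF z] by auto
  ultimately show ?thesis by (simp add: corner_def)
qed

lemma corner_upd_self: "corner z s e n (\<eta>((x, y, z) := t)) x y = corner z s e n \<eta> x y"
  using e n by (intro corner_upd_other) auto

text \<open>As walls are unanimous, no corner can stand next to one; this is the contradiction in
  which a sweep ends.\<close>

lemma corner_neighbour_mixed:
  assumes st: "stuck \<eta>" and c: "corner z s e n \<eta> x y" and xy: "\<bar>x\<bar> \<le> R" "\<bar>y\<bar> \<le> R" and ac: "(a, c) \<in> directions"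
  shows "\<eta> (x + a, y + c, (z + 1) mod 3) \<noteq> \<eta> (x + a, y + c, (z - 1) mod 3)"
  using balanced_neighbours[OF st z xy _ corner_around[OF c] ac] c by (simp add: corner_def)

text \<open>The site at x + e has spin s, two neighbours -s in its layer and a balanced column. Its
  energy is not positive, so the two remaining neighbours are s, which makes it a corner.\<close>

lemma corner_step_e:
  assumes st: "stuck \<eta>" and c: "corner z s e n \<eta> x y" and xy: "\<bar>x\<bar> \<le> R" "\<bar>y\<bar> \<le> R" "\<bar>x + e\<bar> \<le> R"
    and p: "\<eta> (x, y, z) = - s" and ne: "\<eta> (x + e, y + n, z) = - s"
  shows "corner z s e n \<eta> (x + e) y"
proof -
  have mixed: "\<eta> (x + e, y, (z + 1) mod 3) \<noteq> \<eta> (x + e, y, (z - 1) mod 3)"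
    using corner_neighbour_mixed[OF st c xy(1,2), of e 0] e by (auto simp: directions_def)
  have "\<eta> (x + e, y, z) * around \<eta> (x + e) y z \<ge> 0" by (rule balanced_sum[OF st z xy(3,2) mixed])
  then have "s * (\<eta> (x + e + e, y, z) - s + (- s) + \<eta> (x + e, y - n, z)) \<ge> 0"
    using c p ne unfolding around_signed corner_def by simp
  then have "\<eta> (x + e + e, y, z) = s \<and> \<eta> (x + e, y - n, z) = s"
    using s spin_cases[OF st z, of "x + e + e" y] spin_cases[OF st z, of "x + e" "y - n"] by (elim disjE) simp_all
  then show ?thesis using p ne mixed by (simp add: corner_def)
qed

text \<open>The same with the two axes and the two signs of the spin exchanged.\<close>

lemma corner_step_n:
  assumes st: "stuck \<eta>" and c: "corner z s e n \<eta> x y" and xy: "\<bar>x\<bar> \<le> R" "\<bar>y\<bar> \<le> R" "\<bar>y + n\<bar> \<le> R"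
    and p: "\<eta> (x, y, z) = s" and ne: "\<eta> (x + e, y + n, z) = s"
  shows "corner z s e n \<eta> x (y + n)"
proof -
  have mixed: "\<eta> (x, y + n, (z + 1) mod 3) \<noteq> \<eta> (x, y + n, (z - 1) mod 3)"
    using corner_neighbour_mixed[OF st c xy(1,2), of 0 n] n by (auto simp: directions_def)
  have "\<eta> (x, y + n, z) * around \<eta> x (y + n) z \<ge> 0" by (rule balanced_sum[OF st z xy(1,3) mixed])
  then have "- s * (s + \<eta> (x - e, y + n, z) + \<eta> (x, y + n + n, z) + s) \<ge> 0"
    using c p ne unfolding around_signed corner_def by simp
  then have "\<eta> (x - e, y + n, z) = - s \<and> \<eta> (x, y + n + n, z) = - s"
    using s spin_cases[OF st z, of "x - e" "y + n"] spin_cases[OF st z, of x "y + n + n"] by (elim disjE) simp_all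
  then show ?thesis using p ne mixed by (simp add: corner_def)
qed

text \<open>The part of the layer that a sweep may change. Since all else is left alone, a corner
  that the sweep has moved on from can be used again afterwards.\<close>

definition quadrant :: "int \<Rightarrow> int \<Rightarrow> site set" where
  "quadrant x y = {(x + e * int i, y + n * int j, z) |i j. True}"

lemma quadrant_step: "quadrant (x + e) y \<subseteq> quadrant x y" "quadrant x (y + n) \<subseteq> quadrant x y"
proof -
  have "(x + e + e * int i, y + n * int j, z) = (x + e * int (Suc i), y + n * int j, z)"
    "(x + e * int i, y + n + n * int j, z) = (x + e * int i, y + n * int (Suc j), z)" for i j
    by (simp_all add: algebra_simps)
  then show "quadrant (x + e) y \<subseteq> quadrant x y" "quadrant x (y + n) \<subseteq> quadrant x y"
    unfolding quadrant_def by blast+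
qed

lemma quadrant_self: "(x, y, z) \<in> quadrant x y"
  unfolding quadrant_def by (auto intro!: exI[of _ 0])

lemma quadrant_iff: "(x', y', z') \<in> quadrant x y \<longleftrightarrow> e * (x' - x) \<ge> 0 \<and> n * (y' - y) \<ge> 0 \<and> z' = z"
proof
  assume "e * (x' - x) \<ge> 0 \<and> n * (y' - y) \<ge> 0 \<and> z' = z"
  then have "x' = x + e * int (nat (e * (x' - x)))" "y' = y + n * int (nat (n * (y' - y)))" "z' = z"
    using e n by auto
  then show "(x', y', z') \<in> quadrant x y" unfolding quadrant_def by blast
qed (use e n in \<open>auto simp: quadrant_def\<close>)

text \<open>The sweep. The boundary leaves a corner along a monotone lattice path; the corner can be
  carried along this path, and afterwards either the row or the column of the corner can be
  pushed over, so that a corner arrives at a prescribed distance in one of the two directions.\<close>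

lemma corner_sweep:
  assumes "stuck \<eta>" "corner z s e n \<eta> x y"
    "\<And>i. i \<le> A \<Longrightarrow> \<bar>x + e * int i\<bar> \<le> R" "\<And>j. j \<le> C \<Longrightarrow> \<bar>y + n * int j\<bar> \<le> R"
  shows "\<exists>\<eta>'. stuck \<eta>' \<and> (\<forall>u. u \<notin> quadrant x y \<longrightarrow> \<eta>' u = \<eta> u) \<and>
    (corner z s e n \<eta>' (x + e * int A) y \<and> (\<forall>i<A. \<eta>' (x + e * int i, y, z) = - s) \<or>
     corner z s e n \<eta>' x (y + n * int C) \<and> (\<forall>j<C. \<eta>' (x, y + n * int j, z) = s))"
  using assms
proof (induction "A + C" arbitrary: A C \<eta> x y)
  case 0
  then show ?case by (intro exI[of _ \<eta>]) auto
next
  case (Suc m)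
  note st = Suc.prems(1) and c = Suc.prems(2) and bA = Suc.prems(3) and bC = Suc.prems(4)
  show ?case
  \<comment> \<open>If one of the distances is 0, the corner has already arrived there and the
    condition on the row or column is empty.\<close>
  proof (cases "A = 0 \<or> C = 0")
    case True
    then show ?thesis using st c by (intro exI[of _ \<eta>]) auto
  next
    case False
    then obtain A' C' where A: "A = Suc A'" and C: "C = Suc C'" by (metis not0_implies_Suc)
    have xy: "\<bar>x\<bar> \<le> R" "\<bar>y\<bar> \<le> R" "\<bar>x + e\<bar> \<le> R" "\<bar>y + n\<bar> \<le> R"
      using bA[of 0] bA[of 1] bC[of 0] bC[of 1] A C by auto
    have bA': "\<bar>x + e + e * int i\<bar> \<le> R" if "i \<le> A'" for i
      using bA[of "Suc i"] that A by (simp add: algebra_simps)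
    have bC': "\<bar>y + n + n * int j\<bar> \<le> R" if "j \<le> C'" for j
      using bC[of "Suc j"] that C by (simp add: algebra_simps)
    show ?thesis
    \<comment> \<open>The diagonal site shows where the boundary continues: with the value of the
      diagonal site given to the corner itself, the next site along the row, or along the column,
      becomes a corner.\<close>
    proof (cases "\<eta> (x + e, y + n, z) = - s")
      case NE: True
      let ?\<eta>1 = "\<eta>((x, y, z) := - s)"
      have st1: "stuck ?\<eta>1" using s by (intro stuck_corner_set[OF st c xy(1,2)]) auto
      have c1: "corner z s e n ?\<eta>1 x y" using c by (simp add: corner_upd_self)
      have "corner z s e n ?\<eta>1 (x + e) y"
        using NE e by (intro corner_step_e[OF st1 c1 xy(1,2,3)]) auto
      with Suc.hyps(1)[of A' C ?\<eta>1 "x + e" y] Suc.hyps(2) st1 A bA' bC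
      obtain \<eta>2 where st2: "stuck \<eta>2" and out: "\<And>u. u \<notin> quadrant (x + e) y \<Longrightarrow> \<eta>2 u = ?\<eta>1 u" and
        alt: "corner z s e n \<eta>2 (x + e + e * int A') y \<and> (\<forall>i<A'. \<eta>2 (x + e + e * int i, y, z) = - s) \<or>
          corner z s e n \<eta>2 (x + e) (y + n * int C) \<and> (\<forall>j<C. \<eta>2 (x + e, y + n * int j, z) = s)" by auto
      have p2: "\<eta>2 (x, y, z) = - s" using e by (subst out) (auto simp: quadrant_iff)
      have out': "\<eta>2 u = \<eta> u" if "u \<notin> quadrant x y" for u
      proof -
        have "u \<notin> quadrant (x + e) y" "u \<noteq> (x, y, z)" using that quadrant_step(1) quadrant_self by blast+
        then show ?thesis using out[of u] by simp
      qed
      from alt show ?thesis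
      proof (elim disjE conjE)
        assume c2: "corner z s e n \<eta>2 (x + e + e * int A') y" and row: "\<forall>i<A'. \<eta>2 (x + e + e * int i, y, z) = - s"
        have "\<eta>2 (x + e * int i, y, z) = - s" if "i < A" for i
        proof (cases i)
          case (Suc i')
          then have "\<eta>2 (x + e + e * int i', y, z) = - s" using row that A by simp
          then show ?thesis using Suc by (simp add: algebra_simps)
        qed (use p2 in simp)
        moreover have "corner z s e n \<eta>2 (x + e * int A) y" using c2 A by (simp add: algebra_simps)
        ultimately show ?thesis using st2 out' by blast
      next
        \<comment> \<open>The inner sweep ended in column x + e, which consists of s once its last
          site is set to s too. Then (x, y) is a corner again, and it climbs column x because its
          diagonal site is s at every step; for this the conclusion records the filled
          column.\<close>
        assume c2: "corner z s e n \<eta>2 (x + e) (y + n * int C)" and col: "\<forall>j<C. \<eta>2 (x + e, y + n * int j, z) = s"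
        let ?\<eta>3 = "\<eta>2((x + e, y + n * int C, z) := s)"
        have st3: "stuck ?\<eta>3" using s by (intro stuck_corner_set[OF st2 c2 xy(3) bC]) auto
        have col3: "?\<eta>3 (x + e, y + n * int j, z) = s" if "j \<le> C" for j using col that n by (cases "j = C") auto
        have "\<exists>\<eta>'. stuck \<eta>' \<and> corner z s e n \<eta>' x (y + n * int j) \<and> (\<forall>i<j. \<eta>' (x, y + n * int i, z) = s) \<and>
            (\<forall>u. (\<forall>i<j. u \<noteq> (x, y + n * int i, z)) \<longrightarrow> \<eta>' u = ?\<eta>3 u)" if "j \<le> C" for j
          using that
        proof (induction j)
          case 0
          have "?\<eta>3 (x, y - n, z) = ?\<eta>1 (x, y - n, z)" "?\<eta>3 (x - e, y, z) = ?\<eta>1 (x - e, y, z)" "?\<eta>3 (x, y + n, z) = ?\<eta>1 (x, y + n, z)"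
            "?\<eta>3 (x, y, (z + 1) mod 3) = ?\<eta>1 (x, y, (z + 1) mod 3)" "?\<eta>3 (x, y, (z - 1) mod 3) = ?\<eta>1 (x, y, (z - 1) mod 3)"
            using e n out[of "(x, y - n, z)"] out[of "(x - e, y, z)"] out[of "(x, y + n, z)"]
              out[of "(x, y, (z + 1) mod 3)"] out[of "(x, y, (z - 1) mod 3)"] by (auto simp: quadrant_iff)
          moreover have "?\<eta>3 (x + e, y, z) = s" using col3[of 0] by simp
          ultimately have c3: "corner z s e n ?\<eta>3 x (y + n * int 0)" using c1 by (simp only: corner_def of_nat_0 mult_zero_right add_0_right simp_thms)
          show ?case by (intro exI[of _ ?\<eta>3] conjI st3 c3) simp_all
        next
          case (Suc j)
          then obtain \<eta>' where st': "stuck \<eta>'" and c': "corner z s e n \<eta>' x (y + n * int j)"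
            and col': "\<forall>i<j. \<eta>' (x, y + n * int i, z) = s" and out3: "\<And>u. (\<forall>i<j. u \<noteq> (x, y + n * int i, z)) \<Longrightarrow> \<eta>' u = ?\<eta>3 u"
            by auto
          let ?\<eta>'' = "\<eta>'((x, y + n * int j, z) := s)"
          have bj: "\<bar>y + n * int j\<bar> \<le> R" "\<bar>y + n * int j + n\<bar> \<le> R"
            using bC[of j] bC[of "Suc j"] Suc.prems by (simp_all add: algebra_simps)
          have st'': "stuck ?\<eta>''" using s by (intro stuck_corner_set[OF st' c' xy(1) bj(1)]) auto
          have c'': "corner z s e n ?\<eta>'' x (y + n * int j)" using c' by (simp add: corner_upd_self)
          have "?\<eta>'' (x + e, y + n * int j + n, z) = ?\<eta>3 (x + e, y + n * int (Suc j), z)"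
            using e out3[of "(x + e, y + n * int (Suc j), z)"] by (auto simp: algebra_simps)
          then have "?\<eta>'' (x + e, y + n * int j + n, z) = s" using col3[of "Suc j"] Suc.prems by simp
          then have "corner z s e n ?\<eta>'' x (y + n * int j + n)"
            by (intro corner_step_n[OF st'' c'' xy(1) bj]) auto
          then have "corner z s e n ?\<eta>'' x (y + n * int (Suc j))" by (simp add: algebra_simps)
          moreover have "\<forall>i<Suc j. ?\<eta>'' (x, y + n * int i, z) = s" using col' by (auto simp: less_Suc_eq)
          moreover have "?\<eta>'' u = ?\<eta>3 u" if "\<forall>i<Suc j. u \<noteq> (x, y + n * int i, z)" for u
            using out3[of u] that by (auto simp: less_Suc_eq)
          ultimately show ?case using st'' by blast
        qed
        from this[of C] obtain \<eta>' where *: "stuck \<eta>'" "corner z s e n \<eta>' x (y + n * int C)" "\<forall>i<C. \<eta>' (x, y + n * int i, z) = s"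
          and out3: "\<And>u. (\<forall>i<C. u \<noteq> (x, y + n * int i, z)) \<Longrightarrow> \<eta>' u = ?\<eta>3 u" by auto
        have "\<eta>' u = \<eta> u" if u: "u \<notin> quadrant x y" for u
        proof -
          have "(x, y + n * int i, z) \<in> quadrant x y" "(x + e, y + n * int i, z) \<in> quadrant x y" for i
            unfolding quadrant_iff using n e by auto
          then have "u \<noteq> (x, y + n * int i, z)" "u \<noteq> (x + e, y + n * int i, z)" for i using u by blast+
          then show ?thesis using out3[of u] out'[OF u] by simp
        qed
        with * show ?thesis by blast
      qed
    next
      case False
      then have NE: "\<eta> (x + e, y + n, z) = s" using spin_cases[OF st z, of "x + e" "y + n"] s by auto
      let ?\<eta>1 = "\<eta>((x, y, z) := s)"
      have st1: "stuck ?\<eta>1" using s by (intro stuck_corner_set[OF st c xy(1,2)]) auto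
      have c1: "corner z s e n ?\<eta>1 x y" using c by (simp add: corner_upd_self)
      have "corner z s e n ?\<eta>1 x (y + n)"
        using NE e by (intro corner_step_n[OF st1 c1 xy(1,2,4)]) auto
      with Suc.hyps(1)[of A C' ?\<eta>1 x "y + n"] Suc.hyps(2) st1 C bA bC'
      obtain \<eta>2 where st2: "stuck \<eta>2" and out: "\<And>u. u \<notin> quadrant x (y + n) \<Longrightarrow> \<eta>2 u = ?\<eta>1 u" and
        alt: "corner z s e n \<eta>2 (x + e * int A) (y + n) \<and> (\<forall>i<A. \<eta>2 (x + e * int i, y + n, z) = - s) \<or>
          corner z s e n \<eta>2 x (y + n + n * int C') \<and> (\<forall>j<C'. \<eta>2 (x, y + n + n * int j, z) = s)" by auto
      have p2: "\<eta>2 (x, y, z) = s" using n by (subst out) (auto simp: quadrant_iff)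
      have out': "\<eta>2 u = \<eta> u" if "u \<notin> quadrant x y" for u
      proof -
        have "u \<notin> quadrant x (y + n)" "u \<noteq> (x, y, z)" using that quadrant_step(2) quadrant_self by blast+
        then show ?thesis using out[of u] by simp
      qed
      from alt show ?thesis
      proof (elim disjE conjE)
        assume c2: "corner z s e n \<eta>2 x (y + n + n * int C')" and col: "\<forall>j<C'. \<eta>2 (x, y + n + n * int j, z) = s"
        have "\<eta>2 (x, y + n * int j, z) = s" if "j < C" for j
        proof (cases j)
          case (Suc j')
          then have "\<eta>2 (x, y + n + n * int j', z) = s" using col that C by simp
          then show ?thesis using Suc by (simp add: algebra_simps)
        qed (use p2 in simp)
        moreover have "corner z s e n \<eta>2 x (y + n * int C)" using c2 C by (simp add: algebra_simps)
        ultimately show ?thesis using st2 out' by blast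
      next
        \<comment> \<open>The mirror case: row y + n consists of -s, and the corner at (x, y) is
          pushed along row y beside it.\<close>
        assume c2: "corner z s e n \<eta>2 (x + e * int A) (y + n)" and row: "\<forall>i<A. \<eta>2 (x + e * int i, y + n, z) = - s"
        let ?\<eta>3 = "\<eta>2((x + e * int A, y + n, z) := - s)"
        have st3: "stuck ?\<eta>3" using s by (intro stuck_corner_set[OF st2 c2 bA xy(4)]) auto
        have row3: "?\<eta>3 (x + e * int i, y + n, z) = - s" if "i \<le> A" for i using row that e by (cases "i = A") auto
        have "\<exists>\<eta>'. stuck \<eta>' \<and> corner z s e n \<eta>' (x + e * int i) y \<and> (\<forall>j<i. \<eta>' (x + e * int j, y, z) = - s) \<and>
            (\<forall>u. (\<forall>j<i. u \<noteq> (x + e * int j, y, z)) \<longrightarrow> \<eta>' u = ?\<eta>3 u)" if "i \<le> A" for i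
          using that
        proof (induction i)
          case 0
          have "?\<eta>3 (x, y - n, z) = ?\<eta>1 (x, y - n, z)" "?\<eta>3 (x - e, y, z) = ?\<eta>1 (x - e, y, z)" "?\<eta>3 (x + e, y, z) = ?\<eta>1 (x + e, y, z)"
            "?\<eta>3 (x, y, (z + 1) mod 3) = ?\<eta>1 (x, y, (z + 1) mod 3)" "?\<eta>3 (x, y, (z - 1) mod 3) = ?\<eta>1 (x, y, (z - 1) mod 3)"
            using e n out[of "(x, y - n, z)"] out[of "(x - e, y, z)"] out[of "(x + e, y, z)"]
              out[of "(x, y, (z + 1) mod 3)"] out[of "(x, y, (z - 1) mod 3)"] by (auto simp: quadrant_iff)
          moreover have "?\<eta>3 (x, y + n, z) = - s" using row3[of 0] by simp
          ultimately have c3: "corner z s e n ?\<eta>3 (x + e * int 0) y" using c1 by (simp only: corner_def of_nat_0 mult_zero_right add_0_right simp_thms)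
          show ?case by (intro exI[of _ ?\<eta>3] conjI st3 c3) simp_all
        next
          case (Suc i)
          then obtain \<eta>' where st': "stuck \<eta>'" and c': "corner z s e n \<eta>' (x + e * int i) y"
            and row': "\<forall>j<i. \<eta>' (x + e * int j, y, z) = - s" and out3: "\<And>u. (\<forall>j<i. u \<noteq> (x + e * int j, y, z)) \<Longrightarrow> \<eta>' u = ?\<eta>3 u"
            by auto
          let ?\<eta>'' = "\<eta>'((x + e * int i, y, z) := - s)"
          have bi: "\<bar>x + e * int i\<bar> \<le> R" "\<bar>x + e * int i + e\<bar> \<le> R"
            using bA[of i] bA[of "Suc i"] Suc.prems by (simp_all add: algebra_simps)
          have st'': "stuck ?\<eta>''" using s by (intro stuck_corner_set[OF st' c' bi(1) xy(2)]) auto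
          have c'': "corner z s e n ?\<eta>'' (x + e * int i) y" using c' by (simp add: corner_upd_self)
          have "?\<eta>'' (x + e * int i + e, y + n, z) = ?\<eta>3 (x + e * int (Suc i), y + n, z)"
            using n out3[of "(x + e * int (Suc i), y + n, z)"] by (auto simp: algebra_simps)
          then have "?\<eta>'' (x + e * int i + e, y + n, z) = - s" using row3[of "Suc i"] Suc.prems by simp
          then have "corner z s e n ?\<eta>'' (x + e * int i + e) y"
            by (intro corner_step_e[OF st'' c'' bi(1) xy(2) bi(2)]) auto
          then have "corner z s e n ?\<eta>'' (x + e * int (Suc i)) y" by (simp add: algebra_simps)
          moreover have "\<forall>j<Suc i. ?\<eta>'' (x + e * int j, y, z) = - s" using row' by (auto simp: less_Suc_eq)
          moreover have "?\<eta>'' u = ?\<eta>3 u" if "\<forall>j<Suc i. u \<noteq> (x + e * int j, y, z)" for u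
            using out3[of u] that by (auto simp: less_Suc_eq)
          ultimately show ?case using st'' by blast
        qed
        from this[of A] obtain \<eta>' where *: "stuck \<eta>'" "corner z s e n \<eta>' (x + e * int A) y" "\<forall>j<A. \<eta>' (x + e * int j, y, z) = - s"
          and out3: "\<And>u. (\<forall>j<A. u \<noteq> (x + e * int j, y, z)) \<Longrightarrow> \<eta>' u = ?\<eta>3 u" by auto
        have "\<eta>' u = \<eta> u" if u: "u \<notin> quadrant x y" for u
        proof -
          have "(x + e * int i, y, z) \<in> quadrant x y" "(x + e * int i, y + n, z) \<in> quadrant x y" for i
            unfolding quadrant_iff using n e by auto
          then have "u \<noteq> (x + e * int i, y, z)" "u \<noteq> (x + e * int i, y + n, z)" for i using u by blast+
          then show ?thesis using out3[of u] out'[OF u] by simp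
        qed
        with * show ?thesis by blast
      qed
    qed
  qed
qed

text \<open>A sweep that stops one step short of the two walls leaves a corner next to one of
  them.\<close>

lemma corner_impossible:
  assumes st: "stuck \<eta>" and c: "corner z s e n \<eta> x y"
    and A: "A \<ge> 1" "(x + e * int A, y) \<in> U" "\<bar>x + e * int A\<bar> \<le> R"
    and C: "C \<ge> 1" "(x, y + n * int C) \<in> U" "\<bar>y + n * int C\<bar> \<le> R" and xy: "\<bar>x\<bar> \<le> R" "\<bar>y\<bar> \<le> R"
  shows False
proof -
  obtain A' C' where A': "A = Suc A'" and C': "C = Suc C'" using A(1) C(1) by (metis Suc_le_D One_nat_def)
  have bA: "\<bar>x + e * int i\<bar> \<le> R" if "i \<le> A'" for i using that e A(3) xy(1) A' by auto
  have bC: "\<bar>y + n * int j\<bar> \<le> R" if "j \<le> C'" for j using that n C(3) xy(2) C' by auto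
  obtain \<eta>' where st': "stuck \<eta>'" and alt: "corner z s e n \<eta>' (x + e * int A') y \<or> corner z s e n \<eta>' x (y + n * int C')"
    using corner_sweep[OF st c bA bC] by blast
  have U: "\<eta>' (p, q, (z + 1) mod 3) = \<eta>' (p, q, (z - 1) mod 3)" if "(p, q) \<in> U" for p q
  proof -
    have "unanimous \<eta>' p q" using st' that unfolding stuck_def by blast
    then show ?thesis unfolding unanimous_iff[OF z] by simp
  qed
  from alt show False
  proof
    assume c': "corner z s e n \<eta>' (x + e * int A') y"
    have "(e, 0) \<in> directions" using e by (auto simp: directions_def)
    from corner_neighbour_mixed[OF st' c' bA[OF order_refl] xy(2) this] show False
      using U[OF A(2)] A' by (simp add: algebra_simps)
  next
    assume c': "corner z s e n \<eta>' x (y + n * int C')"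
    have "(0, n) \<in> directions" using n by (auto simp: directions_def)
    from corner_neighbour_mixed[OF st' c' xy(1) bC[OF order_refl] this] show False
      using U[OF C(2)] C' by (simp add: algebra_simps)
  qed
qed

end

end

section \<open>Frozen blocks and fixation\<close>

text \<open>The centre has neighbours s to the east and west and -s to the north and south. If both
  eastern diagonal spins were s, \<open>N\<close> and \<open>S\<close> would make both western ones
  -s, against \<open>W\<close>; both being -s contradicts \<open>E\<close>. So they differ, and the
  eastern neighbour is a corner.\<close>

lemma saddle_corners:
  fixes s :: int
  assumes s: "s = 1 \<or> s = -1" and pm: "ne = 1 \<or> ne = -1" "nw = 1 \<or> nw = -1" "se = 1 \<or> se = -1" "sw = 1 \<or> sw = -1"
      "ee = 1 \<or> ee = -1" "ww = 1 \<or> ww = -1" "nn = 1 \<or> nn = -1" "ss = 1 \<or> ss = -1"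
    and E: "s * (ee + - s + ne + se) \<ge> 0" and W: "s * (- s + ww + nw + sw) \<ge> 0"
    and N: "- s * (ne + nw + nn + s) \<ge> 0" and S: "- s * (se + sw + s + ss) \<ge> 0"
  shows "ee = s \<and> (ne = s \<and> se = - s \<or> ne = - s \<and> se = s)"
proof -
  have "\<not> (ne = s \<and> se = s)"
  proof
    assume *: "ne = s \<and> se = s"
    have "nw = - s" using N s pm(2,7) * by auto
    moreover have "sw = - s" using S s pm(4,8) * by auto
    ultimately show False using W s pm(6) by auto
  qed
  moreover have "\<not> (ne = - s \<and> se = - s)" using E s pm(5) by auto
  ultimately have opp: "ne = s \<and> se = - s \<or> ne = - s \<and> se = s" using pm(1,3) s by auto
  then have "ne + se = 0" by auto
  then have "s * (ee - s) \<ge> 0" using E by (simp add: algebra_simps)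
  then have "ee = s" using s pm(5) by auto
  with opp show ?thesis by blast
qed

context walled
begin

text \<open>If the other two layers agree, the spin is a minority of its column, after a flip if
  necessary; being fully surrounded it does not have energy zero. Otherwise the neighbours in the
  layer split two against two. Either opposite ones differ, which is a corner, or they agree, which
  is a saddle and produces a corner at x + 1; hence the walls seen from both x and x + 1.\<close>

lemma zero_energy_impossible:
  assumes st: "stuck \<eta>" and z: "z \<in> {0, 1, 2}" and notU: "(x, y) \<notin> U"
    and zero: "energy 3 Periodic \<eta> (x, y, z) = 0"
    and xy': "\<bar>x\<bar> + 1 \<le> R" "\<bar>y\<bar> + 1 \<le> R"
    and near: "\<And>x' a c. x' \<in> {x, x + 1} \<Longrightarrow> (a, c) \<in> directions \<Longrightarrow>
      \<exists>D::nat. D \<ge> 1 \<and> (x' + int D * a, y + int D * c) \<in> U \<and> \<bar>x' + int D * a\<bar> \<le> R \<and> \<bar>y + int D * c\<bar> \<le> R"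
  shows False
proof -
  have xy: "\<bar>x\<bar> \<le> R" "\<bar>y\<bar> \<le> R" "\<bar>x + 1\<bar> \<le> R" and bnd: "\<bar>x - 1\<bar> \<le> R" "\<bar>y + 1\<bar> \<le> R" "\<bar>y - 1\<bar> \<le> R"
    using xy' by auto
  let ?p = "\<eta> (x, y, z)" and ?b = "\<eta> (x, y, (z + 1) mod 3)" and ?g = "\<eta> (x, y, (z - 1) mod 3)"
  have pm: "?p = 1 \<or> ?p = -1" "?b = 1 \<or> ?b = -1" "?g = 1 \<or> ?g = -1"
    using spin_cases[OF st z] spin_cases[OF st conjunct1[OF layers[OF z]]]
      spin_cases[OF st conjunct1[OF conjunct2[OF layers[OF z]]]] by simp_all
  have sum: "around \<eta> x y z + ?b + ?g = 0" 
  proof -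
    have "?p * (around \<eta> x y z + ?b + ?g) = 0" using zero unfolding energy_3[OF z] by simp
    moreover have "?p \<noteq> 0" using pm(1) by (elim disjE) simp_all
    ultimately show ?thesis by simp
  qed
  have no_corner: False if h: "stuck \<zeta>" "x' \<in> {x, x + 1}" "s = 1 \<or> s = -1" "e = 1 \<or> e = -1" "n = 1 \<or> n = -1" "corner z s e n \<zeta> x' y" for \<zeta> x' s e n
  proof -
    have "(e, 0) \<in> directions" "(0, n) \<in> directions" using h by (auto simp: directions_def)
    then obtain A C :: nat where A: "A \<ge> 1" "(x' + int A * e, y + int A * 0) \<in> U" "\<bar>x' + int A * e\<bar> \<le> R"
      and C: "C \<ge> 1" "(x' + int C * 0, y + int C * n) \<in> U" "\<bar>y + int C * n\<bar> \<le> R"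
      using near[OF h(2)] by meson
    have "(x' + e * int A, y) \<in> U" "\<bar>x' + e * int A\<bar> \<le> R" "(x', y + n * int C) \<in> U" "\<bar>y + n * int C\<bar> \<le> R"
      using A C by (simp_all add: mult.commute)
    then show False
      using corner_impossible[OF z h(3-5,1,6) A(1) _ _ C(1)] xy h(2) by blast
  qed
  consider "?b = ?p" "?g = ?p" | "?b = - ?p" "?g = - ?p" | "?b \<noteq> ?g" using pm by auto
  then show False
  proof cases
    case 1
    let ?\<eta> = "\<eta>((x, y, z) := - ?p)"
    have st': "stuck ?\<eta>" using xy R_le by (intro stuck_flip[OF st _ _ z notU sum]) auto
    have "around ?\<eta> x y z = around \<eta> x y z" by (simp add: around_def)
    moreover have "around ?\<eta> x y z = - 4 * ?p"
      using minority_surrounded[OF st' z xy(1,2)] 1 layers[OF z] by (simp add: around_def)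
    ultimately show False using sum 1 pm(1) by auto
  next
    case 2
    then have "around \<eta> x y z = 4 * ?p"
      using minority_surrounded[OF st z xy(1,2)] by (simp add: around_def)
    then show False using sum 2 pm(1) by auto
  next
    case 3
    then have around0: "around \<eta> x y z = 0" using sum pm by auto
    have E: "\<eta> (x + 1, y, z) = 1 \<or> \<eta> (x + 1, y, z) = -1" and W: "\<eta> (x - 1, y, z) = 1 \<or> \<eta> (x - 1, y, z) = -1"
      and N: "\<eta> (x, y + 1, z) = 1 \<or> \<eta> (x, y + 1, z) = -1" and S: "\<eta> (x, y - 1, z) = 1 \<or> \<eta> (x, y - 1, z) = -1"
      by (rule spin_cases[OF st z])+
    show False
    proof (cases "\<eta> (x + 1, y, z) = \<eta> (x - 1, y, z)")
      case False
      \<comment> \<open>The signs place the plus neighbours at x + e and y - n, as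
        \<open>corner\<close> requires for s = 1.\<close>
      define e n :: int where "e = (if \<eta> (x + 1, y, z) = 1 then 1 else -1)" and "n = (if \<eta> (x, y - 1, z) = 1 then 1 else -1)"
      have "corner z 1 e n \<eta> x y"
        using False E W N S around0 3 unfolding corner_def e_def n_def around_def by auto
      moreover have "e = 1 \<or> e = -1" "n = 1 \<or> n = -1" by (simp_all add: e_def n_def)
      ultimately show False using no_corner[OF st, of x 1 e n] by blast
    next
      case True
      let ?s = "\<eta> (x + 1, y, z)"
      have NS: "\<eta> (x, y + 1, z) = - ?s" "\<eta> (x, y - 1, z) = - ?s"
        using True E N S around0 unfolding around_def by auto
      have st': "stuck (\<eta>((x, y, z) := t))" if "t = 1 \<or> t = -1" for t
      proof (cases "t = ?p")
        case False
        then have "t = - ?p" using that pm(1) by auto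
        then show ?thesis using balanced_flip[OF st z xy(1,2) 3 around0] by simp
      qed (use st in \<open>simp add: fun_upd_idem\<close>)
      have mixed: "\<eta> (x + a, y + c, (z + 1) mod 3) \<noteq> \<eta> (x + a, y + c, (z - 1) mod 3)" if "(a, c) \<in> directions" for a c
        using balanced_neighbours[OF st z xy(1,2) 3 around0 that] 3 by simp
      \<comment> \<open>The free centre is set against the neighbour under consideration, since a
        disagreeing centre gives the sharper inequality: -s for east and west, s for north and
        south.\<close>
      let ?m = "\<eta>((x, y, z) := - ?s)" and ?q = "\<eta>((x, y, z) := ?s)"
      have stm: "stuck ?m" and stq: "stuck ?q" using E by (intro st'; auto)+
      have mixed_upd: "(\<eta>((x, y, z) := t)) (x + a, y + c, (z + 1) mod 3) \<noteq> (\<eta>((x, y, z) := t)) (x + a, y + c, (z - 1) mod 3)"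
        if "(a, c) \<in> directions" for a c t
        using mixed[OF that] layers[OF z] by simp
      have dirs: "(1, 0) \<in> directions" "(-1, 0) \<in> directions" "(0, 1) \<in> directions" "(0, -1) \<in> directions"
        by (auto simp: directions_def)
      have bE: "?m (x + 1, y, z) * around ?m (x + 1) y z \<ge> 0"
        using mixed_upd[OF dirs(1)] by (intro balanced_sum[OF stm z xy(3,2)]) simp
      have bW: "?m (x - 1, y, z) * around ?m (x - 1) y z \<ge> 0"
        using mixed_upd[OF dirs(2)] by (intro balanced_sum[OF stm z bnd(1) xy(2)]) simp
      have bN: "?q (x, y + 1, z) * around ?q x (y + 1) z \<ge> 0"
        using mixed_upd[OF dirs(3)] by (intro balanced_sum[OF stq z xy(1) bnd(2)]) simp
      have bS: "?q (x, y - 1, z) * around ?q x (y - 1) z \<ge> 0"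
        using mixed_upd[OF dirs(4)] by (intro balanced_sum[OF stq z xy(1) bnd(3)]) simp
      have c: "\<eta> (x + 2, y, z) = ?s \<and> (\<eta> (x + 1, y + 1, z) = ?s \<and> \<eta> (x + 1, y - 1, z) = - ?s \<or>
          \<eta> (x + 1, y + 1, z) = - ?s \<and> \<eta> (x + 1, y - 1, z) = ?s)"
      proof (rule saddle_corners)
        show "?s * (\<eta> (x + 2, y, z) + - ?s + \<eta> (x + 1, y + 1, z) + \<eta> (x + 1, y - 1, z)) \<ge> 0"
          using bE by (simp add: around_def add.commute[of 2])
        show "?s * (- ?s + \<eta> (x - 2, y, z) + \<eta> (x - 1, y + 1, z) + \<eta> (x - 1, y - 1, z)) \<ge> 0"
          using bW True by (simp add: around_def add.commute[of 2])
        show "- ?s * (\<eta> (x + 1, y + 1, z) + \<eta> (x - 1, y + 1, z) + \<eta> (x, y + 2, z) + ?s) \<ge> 0"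
          using bN NS by (simp add: around_def add.commute[of 2])
        show "- ?s * (\<eta> (x + 1, y - 1, z) + \<eta> (x - 1, y - 1, z) + ?s + \<eta> (x, y - 2, z)) \<ge> 0"
          using bS NS by (simp add: around_def add.commute[of 2])
      qed (rule spin_cases[OF st z])+
      have mE: "?m (x + 1, y, (z + 1) mod 3) \<noteq> ?m (x + 1, y, (z - 1) mod 3)"
        using mixed_upd[OF dirs(1)] by simp
      have "corner z ?s 1 (-1) ?m (x + 1) y \<or> corner z ?s 1 1 ?m (x + 1) y"
        using c mE unfolding corner_def by (auto simp: add.commute[of 2])
      then show False using no_corner[OF stm, of "x + 1" ?s 1 "-1"] no_corner[OF stm, of "x + 1" ?s 1 1] E by auto
    qed
  qed
qed

end

text \<open>A spin of K could change only at a ring before which another spin of K nearby had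
  changed; induction along \<open>influence\<close> excludes a first change.\<close>

lemma (in good_sample) spin_frozen:
  assumes K: "K \<subseteq> slab k" "\<And>x. x \<in> K \<Longrightarrow> s x = 1"
    and low: "\<And>x \<eta>. x \<in> K \<Longrightarrow> (\<And>v. v \<in> K \<Longrightarrow> \<eta> v = 1) \<Longrightarrow> (\<And>v. v \<in> slab k \<Longrightarrow> \<eta> v \<in> {-1, 1}) \<Longrightarrow> energy k b \<eta> x < 0"
    and x: "x \<in> K"
  shows "spin x n = 1"
proof -
  have ring: "x \<in> K \<Longrightarrow> spin x (Suc n) = 1" for x n
  proof (induction "(x, n)" arbitrary: x n rule: wf_induct_rule[OF wf_influence])
    case (1 x n)
    have xs: "x \<in> slab k" using 1 K by blast
    have before: "before (T x n) v = 1" if v: "v \<in> K" "v \<in> insert x (neighbours k b x)" for v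
    proof (cases "rings_before w v (T x n)")
      case 0
      have "v \<in> slab k" using v K by blast
      then show ?thesis using 0 K(2)[OF v(1)] spin_0 by (simp add: config_before_def)
    next
      case (Suc m)
      then have "T v m < T x n" using less_rings_before_iff[OF clocks, of v m "T x n"] v K by auto
      then have "((v, m), (x, n)) \<in> influence w" using v xs by (auto simp: influence_def)
      then show ?thesis using 1 v Suc by (simp add: config_before_def)
    qed
    \<comment> \<open>The induction gives the value 1 only at x and its neighbours in K, whereas
      \<open>low\<close> asks for it on all of K; the energy at x does not see the
      difference.\<close>
    define \<eta> where "\<eta> v = (if v \<in> K then 1 else before (T x n) v)" for v
    have "energy k b (before (T x n)) x = energy k b \<eta> x"
      using before by (intro energy_cong) (auto simp: \<eta>_def)
    also have "\<dots> < 0"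
      using 1 spin_pm1 by (intro low) (auto simp: \<eta>_def config_before_def)
    finally show ?case using before[of x] 1 unfolding spin_Suc[OF xs] before_ring[OF xs] by (simp add: updated_spin_def)
  qed
  show ?thesis
  proof (cases n)
    case 0
    have "x \<in> slab k" using K x by blast
    then show ?thesis using 0 spin_0 K(2)[OF x] by simp
  qed (use ring[OF x] in simp)
qed

definition block :: "int \<Rightarrow> int \<Rightarrow> site set" where
  "block i j = {i, i + 1} \<times> {j, j + 1} \<times> {0, 1, 2}"

lemma block_subset_slab: "block i j \<subseteq> slab 3" and finite_block: "finite (block i j)" and card_block: "card (block i j) = 12"
  by (auto simp: block_def slab_def card_cartesian_product)

text \<open>Four of the six neighbours belong to the block: two in the same layer and two in the
  same column.\<close>

lemma energy_block:
  assumes x: "x \<in> block i j" and one: "\<And>v. v \<in> block i j \<Longrightarrow> \<eta> v = 1" and pm: "\<And>v. v \<in> slab 3 \<Longrightarrow> \<eta> v \<in> {-1, 1}"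
  shows "energy 3 Periodic \<eta> x < 0"
proof -
  obtain p q z where pqz: "x = (p, q, z)" by (metis prod_cases3)
  have z: "z \<in> {0, 1, 2}" using x by (auto simp: pqz block_def)
  have ge: "\<eta> (p', q', z) \<ge> -1" for p' q' using pm[of "(p', q', z)"] z by (auto simp: slab_def)
  have "\<eta> (p, q, (z + 1) mod 3) = 1" "\<eta> (p, q, (z - 1) mod 3) = 1" "\<eta> (p, q, z) = 1"
    using x z by (auto intro!: one simp: pqz block_def)
  moreover have "\<eta> (p + 1, q, z) + \<eta> (p - 1, q, z) \<ge> 0"
    using x ge[of "p + 1" q] ge[of "p - 1" q] one[of "(p + 1, q, z)"] one[of "(p - 1, q, z)"] by (auto simp: pqz block_def)
  moreover have "\<eta> (p, q + 1, z) + \<eta> (p, q - 1, z) \<ge> 0"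
    using x ge[of p "q + 1"] ge[of p "q - 1"] one[of "(p, q + 1, z)"] one[of "(p, q - 1, z)"] by (auto simp: pqz block_def)
  moreover have "(p, q, z) \<in> slab 3" using x block_subset_slab unfolding pqz by blast
  ultimately show ?thesis
    using energy_nbl[of 3 x \<eta>] by (simp add: pqz)
qed

lemma emeasure_all_plus:
  assumes X: "finite X" "X \<subseteq> slab k" and A: "A \<in> sets (glauber_measure k)"
    and inv: "\<And>x s w c u. x \<in> X \<Longrightarrow> (s, w, c) \<in> A \<Longrightarrow> (s(x := u), w, c) \<in> A"
  shows "{\<omega>\<in>A. \<forall>x\<in>X. fst \<omega> x = 1} \<in> sets (glauber_measure k) \<and>
    emeasure (glauber_measure k) {\<omega>\<in>A. \<forall>x\<in>X. fst \<omega> x = 1} = ennreal ((1/2) ^ card X) * emeasure (glauber_measure k) A"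
  using X inv
proof (induction X rule: finite_induct)
  case (insert z X)
  let ?A = "{\<omega>\<in>A. \<forall>x\<in>X. fst \<omega> x = 1}"
  have z: "z \<in> slab k" using insert by simp
  note [measurable] = z
  have IH: "?A \<in> sets (glauber_measure k)" "emeasure (glauber_measure k) ?A = ennreal ((1/2) ^ card X) * emeasure (glauber_measure k) A"
    using insert by auto
  note [measurable] = IH(1)
  have eq: "{\<omega>\<in>A. \<forall>x\<in>insert z X. fst \<omega> x = 1} = {\<omega>\<in>?A. fst \<omega> z = 1}" by auto
  have "{\<omega>\<in>?A. fst \<omega> z = 1} = {\<omega>\<in>space (glauber_measure k). \<omega> \<in> ?A \<and> fst \<omega> z = 1}"
    using sets.sets_into_space[OF IH(1)] by auto
  also have "\<dots> \<in> sets (glauber_measure k)" by measurable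
  finally have "{\<omega>\<in>?A. fst \<omega> z = 1} \<in> sets (glauber_measure k)" .
  moreover have "emeasure (glauber_measure k) {\<omega>\<in>?A. fst \<omega> z = 1} = 1/2 * emeasure (glauber_measure k) ?A"
  proof (rule emeasure_fresh_initial[OF z IH(1)])
    fix s w c u assume "(s, w, c) \<in> ?A"
    then have "(s(z := u), w, c) \<in> A" "\<forall>x\<in>X. (s(z := u)) x = 1"
      using insert.prems(2)[of z s w c u] insert.hyps(2) by (blast, auto)
    then show "(s(z := u), w, c) \<in> ?A" by (simp only: mem_Collect_eq fst_conv simp_thms)
  qed simp
  moreover have "1/2 * (ennreal ((1/2) ^ card X) * a) = ennreal ((1/2) ^ card (insert z X)) * a" for a
  proof -
    have "ennreal ((1/2) ^ card (insert z X)) = ennreal (1/2) * ennreal ((1/2) ^ card X)"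
      using insert.hyps by (simp add: ennreal_mult'[symmetric] del: ennreal_half)
    then show ?thesis by (simp add: divide_ennreal_def mult.assoc)
  qed
  ultimately show ?case unfolding eq using IH(2) by simp
qed (use A in simp)

text \<open>Blocks at positive even distances are disjoint, hence independent, and each is all plus
  with probability 2^-12. The probability that the first J of them fail decays
  geometrically.\<close>

lemma AE_block_in_direction:
  assumes ac: "(a, c) \<in> directions"
  shows "AE \<omega> in glauber_measure 3. \<exists>D::nat. D \<ge> 1 \<and> (\<forall>u\<in>block (i + int D * a) (j + int D * c). fst \<omega> u = 1)"
proof -
  let ?M = "glauber_measure 3"
  interpret prob_space ?M by (rule prob_space_glauber_measure)
  define b where "b m = block (i + int (2 * Suc m) * a) (j + int (2 * Suc m) * c)" for m
  have b: "finite (b m)" "b m \<subseteq> slab 3" "card (b m) = 12" for m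
    unfolding b_def using finite_block block_subset_slab card_block by auto
  have disj: "b m \<inter> b m' = {}" if "m < m'" for m m'
    using ac that unfolding b_def block_def directions_def by auto
  define N where "N J = {\<omega>\<in>space ?M. \<forall>m<J. \<not> (\<forall>u\<in>b m. fst \<omega> u = 1)}" for J
  define r :: real where "r = 1 - (1/2) ^ 12"
  have r: "0 \<le> r" "r < 1" by (simp_all add: r_def power_le_one)
  have N: "N J \<in> sets ?M \<and> emeasure ?M (N J) = ennreal (r ^ J)" for J
  proof (induction J)
    case 0
    show ?case by (simp add: N_def emeasure_space_1)
  next
    case (Suc J)
    have inv: "(s(x := u), w, c') \<in> N J" if "x \<in> b J" "(s, w, c') \<in> N J" for x s w c' u
    proof -
      have "x \<in> slab 3" using that b by blast
      then have "(s(x := u), w, c') \<in> space ?M"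
        using that by (auto simp: N_def space_glauber_measure PiE_iff extensional_def)
      moreover have "(s(x := u)) v = s v" if "m < J" "v \<in> b m" for m v
        using disj[OF that(1)] that(2) \<open>x \<in> b J\<close> by auto
      ultimately show ?thesis using that(2) unfolding N_def by auto
    qed
    let ?P = "{\<omega>\<in>N J. \<forall>u\<in>b J. fst \<omega> u = 1}"
    have P: "?P \<in> sets ?M" "emeasure ?M ?P = ennreal ((1/2) ^ 12) * emeasure ?M (N J)"
      using emeasure_all_plus[OF b(1,2) _ inv] Suc b(3) by auto
    have eq: "N (Suc J) = N J - ?P" by (auto simp: N_def less_Suc_eq)
    have "emeasure ?M (N (Suc J)) = emeasure ?M (N J) - emeasure ?M ?P"
      unfolding eq using P Suc by (intro emeasure_Diff) auto
    also have "\<dots> = ennreal (r ^ J) - ennreal ((1/2) ^ 12 * r ^ J)"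
      using P Suc r by (simp add: ennreal_mult')
    also have "\<dots> = ennreal (r ^ Suc J)"
      using r by (subst ennreal_minus) (auto simp: r_def algebra_simps)
    finally show ?case unfolding eq using P Suc by auto
  qed
  have "(\<Sum>J. emeasure ?M (N J)) = (\<Sum>J. ennreal (r ^ J))" using N by simp
  also have "\<dots> = ennreal (1 / (1 - r))" using geometric_sums[of r] r by (intro suminf_ennreal_eq) auto
  finally have "AE \<omega> in ?M. finite {J. \<omega> \<in> N J}" using N by (intro AE_finite_of_suminf) auto
  then show ?thesis using AE_space
  proof eventually_elim
    case (elim \<omega>)
    have "{J. \<omega> \<in> N J} \<noteq> UNIV" using elim by auto
    then obtain J where "\<omega> \<notin> N J" by blast
    then obtain m where "\<forall>u\<in>b m. fst \<omega> u = 1" using elim by (auto simp: N_def)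
    then show ?case unfolding b_def by (intro exI[of _ "2 * Suc m"]) auto
  qed
qed

text \<open>A flip reverses the sign of the energy at its site, so energy zero before the ring is
  still visible after it, which is when \<open>AE_finite_live\<close> inspects the
  configuration.\<close>

lemma (in good_sample) energy_after_flip:
  assumes k: "k \<ge> 2" and x: "x \<in> slab k" and flip: "spin x (Suc n) \<noteq> spin x n" and low: "\<not> lowering (s, w, c) x n"
  shows "energy k b (at_time (T x n)) x = 0"
proof -
  let ?\<eta> = "before (T x n)"
  have e: "energy k b ?\<eta> x = 0"
    using flip low unfolding spin_Suc[OF x] by (auto simp: updated_spin_def lowering_def split: if_splits)
  have "at_time (T x n) x = - ?\<eta> x"
    using flip spin_pm1[OF x, of n] spin_pm1[OF x, of "Suc n"] unfolding at_ring[OF x] before_ring[OF x] by auto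
  then have "energy k b (at_time (T x n)) x = energy k b (?\<eta>(x := - ?\<eta> x)) x"
    using at_ring_other[OF x] nbr_in_slab[OF _ x] by (intro energy_cong) (metis fun_upd_apply)
  then show ?thesis using e energy_flip_self[OF k] by simp
qed

context slab_dynamics
begin

lemma AE_finite_lowering:
  assumes k: "k \<ge> 2"
  shows "AE \<omega> in glauber_measure k. \<forall>x\<in>slab k. finite {n. lowering \<omega> x n}"
proof (intro AE_ball_countable' countable_slab)
  fix x assume x: "x \<in> slab k"
  note [measurable] = x
  interpret prob_space "glauber_measure k" by (rule prob_space_glauber_measure)
  have "AE \<omega> in glauber_measure k. finite {n. \<omega> \<in> {\<omega>\<in>space (glauber_measure k). lowering \<omega> x n}}"
    using suminf_lowering_le[OF k x] by (intro AE_finite_of_suminf) (auto intro: le_less_trans)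
  then show "AE \<omega> in glauber_measure k. finite {n. lowering \<omega> x n}" using AE_space by eventually_elim simp
qed

text \<open>Every flip is lowering or leaves energy zero at its site. If energy zero at x always
  makes one box \<open>live\<close>, flips of both kinds are finite in number. The other alternative
  serves sites in frozen blocks.\<close>

lemma slab_fixatesI:
  assumes k: "k \<ge> 2"
    and live: "AE \<omega> in glauber_measure k. good_sample k b (fst \<omega>) (fst (snd \<omega>)) (snd (snd \<omega>)) \<longrightarrow>
      (\<forall>x\<in>slab k. (\<forall>n. spin_after (fst \<omega>) (fst (snd \<omega>)) (snd (snd \<omega>)) x (Suc n) = spin_after (fst \<omega>) (fst (snd \<omega>)) (snd (snd \<omega>)) x n) \<or>
        (\<exists>L. x \<in> site_box k L \<and> (\<forall>t. energy k b (config_at (fst \<omega>) (fst (snd \<omega>)) (snd (snd \<omega>)) t) x = 0 \<longrightarrow>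
          live (site_box k L) (config_at (fst \<omega>) (fst (snd \<omega>)) (snd (snd \<omega>)) t))))"
  shows "slab_fixates k b"
  unfolding slab_fixates_def
  using AE_good_sample AE_finite_lowering[OF k] AE_finite_live[OF k] live
proof eventually_elim
  case (elim \<omega>)
  obtain s w c where \<omega>: "\<omega> = (s, w, c)" by (metis prod_cases3)
  interpret good_sample k b s w c using elim(1) by (simp add: \<omega>)
  have "finite {n. spin x (Suc n) \<noteq> spin x n}" if x: "x \<in> slab k" for x
  proof -
    consider "\<forall>n. spin x (Suc n) = spin x n" | L where "x \<in> site_box k L"
        "\<And>t. energy k b (at_time t) x = 0 \<Longrightarrow> live (site_box k L) (at_time t)"
      using elim(4) x good_sample_axioms unfolding \<omega> by auto
    then show ?thesis
    proof cases
      case (2 L)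
      have "{n. spin x (Suc n) \<noteq> spin x n} \<subseteq> {n. lowering \<omega> x n} \<union> {n. live (site_box k L) (at_time (T x n))}"
        using energy_after_flip[OF k x] 2(2) unfolding \<omega> by blast
      moreover have "finite {n. lowering \<omega> x n}" "finite {n. live (site_box k L) (at_time (T x n))}"
        using elim(2,3) x 2(1) by (simp_all add: \<omega>)
      ultimately show ?thesis by (meson finite_UnI finite_subset)
    qed simp
  qed
  then show ?case
    using config_at_is_trajectory trajectory_fixates unfolding \<omega> by blast
qed

end

section \<open>The three slabs\<close>

lemma neighbours_free:
  shows "neighbours 2 Free (x, y, 0) = {(x+1,y,0), (x-1,y,0), (x,y+1,0), (x,y-1,0), (x,y,1)}"
    and "neighbours 2 Free (x, y, 1) = {(x+1,y,1), (x-1,y,1), (x,y+1,1), (x,y-1,1), (x,y,0)}"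
proof -
  have *: "neighbours k Free (x, y, z) = S"
    if "\<And>x' y' z'. (x', y', z') \<in> neighbours k Free (x, y, z) \<Longrightarrow> (x', y', z') \<in> S"
      "S \<subseteq> neighbours k Free (x, y, z)" for k z S
    using that by (intro equalityI subsetI) (metis prod_cases3, blast)
  show "neighbours 2 Free (x, y, 0) = {(x+1,y,0), (x-1,y,0), (x,y+1,0), (x,y-1,0), (x,y,1)}"
    by (rule *, drule neighboursD, force) (simp add: neighbours_def edge_mult_def slab_def)
  show "neighbours 2 Free (x, y, 1) = {(x+1,y,1), (x-1,y,1), (x,y+1,1), (x,y-1,1), (x,y,0)}"
    by (rule *, drule neighboursD, force) (simp add: neighbours_def edge_mult_def slab_def)
qed

lemma energy_2_free_nonzero:
  assumes pm: "\<And>v. v \<in> slab 2 \<Longrightarrow> \<eta> v \<in> {-1, 1}" and u: "u \<in> slab 2"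
  shows "energy 2 Free \<eta> u \<noteq> 0"
proof -
  obtain x y z where xyz: "u = (x, y, z)" by (metis prod_cases3)
  have z: "z = 0 \<or> z = 1" using u by (auto simp: xyz slab_def)
  have odd: "odd (\<eta> v)" if "v \<in> slab 2" for v using pm[OF that] by auto
  have "odd (energy 2 Free \<eta> u)"
    using z odd by (auto simp: xyz energy_def neighbours_free edge_mult_def slab_def)
  then show ?thesis by auto
qed

theorem theorem1:
  "slab_fixates 2 Free \<and> slab_fixates 2 Periodic \<and> slab_fixates 3 Periodic"
proof (intro conjI)
  show "slab_fixates 2 Free"
  proof (rule slab_dynamics.slab_fixatesI, simp, intro AE_I2 impI ballI disjI2)
    fix \<omega> :: sample and x assume g: "good_sample 2 Free (fst \<omega>) (fst (snd \<omega>)) (snd (snd \<omega>))" and x: "x \<in> slab 2"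
    interpret good_sample 2 Free "fst \<omega>" "fst (snd \<omega>)" "snd (snd \<omega>)" by (rule g)
    obtain p q z where pqz: "x = (p, q, z)" by (metis prod_cases3)
    \<comment> \<open>Energy zero never occurs here, so any box that contains x will do.\<close>
    have "x \<in> site_box 2 (nat (\<bar>p\<bar> + \<bar>q\<bar>))" using x by (auto simp: pqz slab_def site_box_def)
    moreover have "energy 2 Free (at_time t) x \<noteq> 0" for t
      using spin_pm1 x by (intro energy_2_free_nonzero) (auto simp: config_at_def)
    ultimately show "\<exists>L. x \<in> site_box 2 L \<and> (\<forall>t. energy 2 Free (at_time t) x = 0 \<longrightarrow> live (site_box 2 L) (at_time t))"
      by blast
  qed
  show "slab_fixates 2 Periodic"
  proof (rule slab_dynamics.slab_fixatesI, simp, intro AE_I2 impI ballI disjI2)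
    fix \<omega> :: sample and x assume g: "good_sample 2 Periodic (fst \<omega>) (fst (snd \<omega>)) (snd (snd \<omega>))" and x: "x \<in> slab 2"
    interpret good_sample 2 Periodic "fst \<omega>" "fst (snd \<omega>)" "snd (snd \<omega>)" by (rule g)
    obtain p q z where pqz: "x = (p, q, z)" by (metis prod_cases3)
    let ?L = "nat (\<bar>p\<bar> + \<bar>q\<bar> + 3)"
    have "x \<in> site_box 2 ?L" using x by (auto simp: pqz slab_def site_box_def)
    moreover have "live (site_box 2 ?L) (at_time t)" if "energy 2 Periodic (at_time t) x = 0" for t
    proof (rule zero_energy_live_2)
      show "at_time t v \<in> {-1, 1}" if "v \<in> slab 2" for v using spin_pm1[OF that] by (simp add: config_at_def)
      show "energy 2 Periodic (at_time t) (p, q, z) = 0" using that by (simp add: pqz)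
    qed (use x in \<open>auto simp: pqz slab_def\<close>)
    ultimately show "\<exists>L. x \<in> site_box 2 L \<and> (\<forall>t. energy 2 Periodic (at_time t) x = 0 \<longrightarrow> live (site_box 2 L) (at_time t))"
      by blast
  qed
  show "slab_fixates 3 Periodic"
  proof (rule slab_dynamics.slab_fixatesI, simp)
    have "AE \<omega> in glauber_measure 3. \<forall>i j. \<forall>d\<in>directions. \<exists>D::nat. D \<ge> 1 \<and> (\<forall>u\<in>block (i + int D * fst d) (j + int D * snd d). fst \<omega> u = 1)"
    proof (intro AE_all_countable[THEN iffD2] allI AE_ball_countable')
      show "AE \<omega> in glauber_measure 3. \<exists>D::nat. D \<ge> 1 \<and> (\<forall>u\<in>block (i + int D * fst d) (j + int D * snd d). fst \<omega> u = 1)"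
        if "d \<in> directions" for i j d
        by (rule AE_block_in_direction) (use that in simp)
    qed (simp add: directions_def)
    then show "AE \<omega> in glauber_measure 3. good_sample 3 Periodic (fst \<omega>) (fst (snd \<omega>)) (snd (snd \<omega>)) \<longrightarrow>
      (\<forall>x\<in>slab 3. (\<forall>n. slab_dynamics.spin_after 3 Periodic (fst \<omega>) (fst (snd \<omega>)) (snd (snd \<omega>)) x (Suc n) = slab_dynamics.spin_after 3 Periodic (fst \<omega>) (fst (snd \<omega>)) (snd (snd \<omega>)) x n) \<or>
        (\<exists>L. x \<in> site_box 3 L \<and> (\<forall>t. energy 3 Periodic (slab_dynamics.config_at 3 Periodic (fst \<omega>) (fst (snd \<omega>)) (snd (snd \<omega>)) t) x = 0 \<longrightarrow>
          plive 3 (site_box 3 L) (slab_dynamics.config_at 3 Periodic (fst \<omega>) (fst (snd \<omega>)) (snd (snd \<omega>)) t))))"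
    proof (eventually_elim, intro impI ballI)
      fix \<omega> :: sample and x
      assume blocks: "\<forall>i j. \<forall>d\<in>directions. \<exists>D::nat. D \<ge> 1 \<and> (\<forall>u\<in>block (i + int D * fst d) (j + int D * snd d). fst \<omega> u = 1)"
        and g: "good_sample 3 Periodic (fst \<omega>) (fst (snd \<omega>)) (snd (snd \<omega>))" and x: "x \<in> slab 3"
      interpret good_sample 3 Periodic "fst \<omega>" "fst (snd \<omega>)" "snd (snd \<omega>)" by (rule g)
      \<comment> \<open>U consists of the lower left cells of blocks that are all plus at time zero.
        The column over such a cell lies in the block, stays plus, and acts as a wall.\<close>
      define U where "U = {(i, j). \<forall>u\<in>block i j. fst \<omega> u = 1}"
      define D where "D i j a c = (SOME D::nat. D \<ge> 1 \<and> (i + int D * a, j + int D * c) \<in> U)" for i j a c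
      have D: "D i j a c \<ge> 1 \<and> (i + int (D i j a c) * a, j + int (D i j a c) * c) \<in> U" if "(a, c) \<in> directions" for i j a c
        unfolding D_def by (rule someI_ex) (use blocks that in \<open>force simp: U_def\<close>)
      have frozen: "spin (i, j, z) n = 1" if "(i, j) \<in> U" "z \<in> {0, 1, 2}" for i j z n
        using that energy_block block_subset_slab
        by (intro spin_frozen[of "block i j"]) (auto simp: U_def block_def)
      obtain p q z where pqz: "x = (p, q, z)" by (metis prod_cases3)
      have z: "z \<in> {0, 1, 2}" using x by (auto simp: pqz slab_def)
      show "(\<forall>n. spin x (Suc n) = spin x n) \<or> (\<exists>L. x \<in> site_box 3 L \<and> (\<forall>t. energy 3 Periodic (at_time t) x = 0 \<longrightarrow> live (site_box 3 L) (at_time t)))"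
      proof (cases "(p, q) \<in> U")
        case True
        then show ?thesis using frozen z by (simp add: pqz)
      next
        case False
        have bound: "\<exists>B\<ge>0. \<forall>i j a c. (i, j) \<in> S \<longrightarrow> (a, c) \<in> directions \<longrightarrow> \<bar>i\<bar> + \<bar>j\<bar> + int (D i j a c) \<le> B" if "finite S" for S
        proof -
          let ?f = "\<lambda>((i, j), (a, c)). \<bar>i\<bar> + \<bar>j\<bar> + int (D i j a c)"
          have fin: "finite (insert 0 (?f ` (S \<times> directions)))" using that by (simp add: directions_def)
          have "\<bar>i\<bar> + \<bar>j\<bar> + int (D i j a c) \<le> Max (insert 0 (?f ` (S \<times> directions)))"
            if "(i, j) \<in> S" "(a, c) \<in> directions" for i j a c
            using that by (intro Max_ge[OF fin]) force
          moreover have "0 \<le> Max (insert 0 (?f ` (S \<times> directions)))" by (rule Max_ge[OF fin]) simp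
          ultimately show ?thesis by blast
        qed
        have within: "\<bar>i + int (D i j a c) * a\<bar> \<le> B \<and> \<bar>j + int (D i j a c) * c\<bar> \<le> B"
          if "\<bar>i\<bar> + \<bar>j\<bar> + int (D i j a c) \<le> B" "(a, c) \<in> directions" for i j a c B
          using that unfolding directions_def by auto
        obtain B where B: "B \<ge> 0" "\<And>i j a c. (i, j) \<in> {(p, q), (p + 1, q)} \<Longrightarrow> (a, c) \<in> directions \<Longrightarrow> \<bar>i\<bar> + \<bar>j\<bar> + int (D i j a c) \<le> B"
          using bound[of "{(p, q), (p + 1, q)}"] by blast
        \<comment> \<open>R has to reach the walls seen from the column of x and from the next one
          at p + 1. Then L has to reach the walls seen from every cell within R, with the margin 3
          that certificates need.\<close>
        define R where "R = B + \<bar>p\<bar> + \<bar>q\<bar> + 1"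
        obtain B' where B': "B' \<ge> 0" "\<And>i j a c. (i, j) \<in> {-R..R} \<times> {-R..R} \<Longrightarrow> (a, c) \<in> directions \<Longrightarrow> \<bar>i\<bar> + \<bar>j\<bar> + int (D i j a c) \<le> B'"
          using bound[of "{-R..R} \<times> {-R..R}"] by blast
        define L where "L = nat (B' + R + 3)"
        have L: "int L = B' + R + 3" using B(1) B'(1) by (simp add: L_def R_def)
        interpret walled U L R
        proof
          fix i j a c :: int assume ij: "\<bar>i\<bar> \<le> R" "\<bar>j\<bar> \<le> R" and ac: "(a, c) \<in> directions"
          then have "\<bar>i\<bar> + \<bar>j\<bar> + int (D i j a c) \<le> B'" by (intro B') auto
          from within[OF this ac] D[OF ac, of i j]
          show "\<exists>D::nat. D \<ge> 1 \<and> (i + int D * a, j + int D * c) \<in> U \<and> \<bar>i + int D * a\<bar> \<le> int L - 3 \<and> \<bar>j + int D * c\<bar> \<le> int L - 3"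
            using B(1) unfolding L R_def by (intro exI[of _ "D i j a c"]) auto
        qed (use L B'(1) in simp)
        have "live (site_box 3 L) (at_time t)" if e: "energy 3 Periodic (at_time t) x = 0" for t
        proof (rule ccontr)
          assume "\<not> live (site_box 3 L) (at_time t)"
          moreover have "at_time t v = 1 \<or> at_time t v = -1" if "v \<in> slab 3" for v
            using spin_pm1[OF that] by (auto simp: config_at_def)
          moreover have "unanimous (at_time t) i j" if "(i, j) \<in> U" for i j
            using frozen[OF that] by (simp add: unanimous_def config_at_def)
          ultimately have st: "stuck (at_time t)" unfolding stuck_def by blast
          show False
          proof (rule zero_energy_impossible[OF st z False])
            show "energy 3 Periodic (at_time t) (p, q, z) = 0" using e by (simp add: pqz)
            show "\<bar>p\<bar> + 1 \<le> R" "\<bar>q\<bar> + 1 \<le> R" using B(1) by (simp_all add: R_def)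
            fix x' a c assume x': "x' \<in> {p, p + 1}" and ac: "(a, c) \<in> directions"
            then have "\<bar>x'\<bar> + \<bar>q\<bar> + int (D x' q a c) \<le> B" by (intro B) auto
            from within[OF this ac] D[OF ac, of x' q]
            show "\<exists>D::nat. D \<ge> 1 \<and> (x' + int D * a, q + int D * c) \<in> U \<and> \<bar>x' + int D * a\<bar> \<le> R \<and> \<bar>q + int D * c\<bar> \<le> R"
              by (intro exI[of _ "D x' q a c"]) (auto simp: R_def)
          qed
        qed
        moreover have "x \<in> site_box 3 L"
          using z L B(1) B'(1) by (auto simp: pqz site_box_def R_def)
        ultimately show ?thesis by blast
      qed
    qed
  qed
qed

end
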